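(* Let $A$ be a set regarded as a discrete category. The assignments $(\mathbb C,\mathbb O)\mapsto\big(\pi\colon\mathrm{Sp}^A(\mathbb C,\mathbb O)\to\mathbb C\big)$, $(F,\tau)\mapsto(F,\mathrm{Sp}^A_{F,\tau})$ and $\alpha\mapsto\alpha$ form a 2-functor $\mathrm{SP}^A$ from the lax coslice 2-category $A/\mathbf{CAT}$ to the 2-category $\mathbf{CAT}^{\mathbf{CLat}_\sqcap}$. Moreover, for every 1-cell $(F,\tau)\colon(\mathbb C,\mathbb O)\to(\mathbb D,\mathbb P)$ of $A/\mathbf{CAT}$, the functor $\mathrm{Sp}^A_{F,\tau}$ preserves Cartesian morphisms and all meets in the fibres.
   Context: A $\mathbf{CLat}_\sqcap$-fibration is a functor $p\colon\mathbb E\to\mathbb B$ such that each fibre $\mathbb E_X$ (objects over $X$, morphisms over $\mathrm{id}_X$) is a complete lattice (order $\sqsubseteq$), there is at most one morphism of $\mathbb E$ above any given morphism of $\mathbb B$, and each $f\colon X\to Y$ has a meet-preserving reindexing $f^*\colon\mathbb E_Y\to\mathbb E_X$ with: a morphism $P\to Q$ above $f$ exists iff $P\sqsubseteq f^*Q$. The lax coslice 2-category $A/\mathbf{CAT}$: 0-cells are pairs $(\mathbb C,\mathbb O)$ of a category and a functor $\mathbb O\colon A\to\mathbb C$; a 1-cell $(\mathbb C,\mathbb O)\to(\mathbb D,\mathbb P)$ is a pair $(F,\tau)$ of a functor $F\colon\mathbb C\to\mathbb D$ and a family $\tau_a\colon F(\mathbb O(a))\to\mathbb P(a)$ ($a\in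 A$); composition is $(G,\upsilon)\circ(F,\tau)=(G\circ F,(\upsilon_a\circ G(\tau_a))_a)$, identities $(\mathrm{Id},(\mathrm{id})_a)$; a 2-cell $(F,\tau)\Rightarrow(G,\upsilon)$ is a natural transformation $\alpha\colon F\Rightarrow G$ with $\upsilon_a\circ\alpha_{\mathbb O(a)}=\tau_a$ for all $a\in A$. The 2-category $\mathbf{CAT}^{\mathbf{CLat}_\sqcap}$: 0-cells are $\mathbf{CLat}_\sqcap$-fibrations; a 1-cell from $p\colon\mathbb E\to\mathbb B$ to $q\colon\mathbb F\to\mathbb C$ is a pair $(F,\dot F)$ of functors $F\colon\mathbb B\to\mathbb C$, $\dot F\colon\mathbb E\to\mathbb F$ with $q\circ\dot F=F\circ p$; a 2-cell $(F,\dot F)\Rightarrow(G,\dot G)$ is a pair of natural transformations $\alpha\colon F\Rightarrow G$, $\dot\alpha\colon\dot F\Rightarrow\dot G$ with $q\dot\alpha=\alpha p$ (such $\dot\alpha$ is unique if it exists). For $\mathbb O\colon A\to\mathbb C$, the category $\mathrm{Sp}^A(\mathbb C,\mathbb O)$ has objects $(X,S)$ with $X\in\mathbb C$ and $S(a)\subseteq\mathbb C(X,\mathbb O(a))$ for each $a\in A$; a morphism $(X,S)\to(Y,S')$ is $f\colon X\to Y$ in $\mathbb C$ such that $k\circ f\in S(a)$ for all $a\in A$, $k\in S'(a)$; $\pi$ is the projection $(X,S)\mapsto X$ (fibre over $X$ ordered by $(X,S)\sqsubseteq(X,S')$ iff $S'(a)\subseteq S(a)$ for all $a$). For a 1-cell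 $(F,\tau)\colon(\mathbb C,\mathbb O)\to(\mathbb D,\mathbb P)$, the functor $\mathrm{Sp}^A_{F,\tau}\colon\mathrm{Sp}^A(\mathbb C,\mathbb O)\to\mathrm{Sp}^A(\mathbb D,\mathbb P)$ is $(X,S)\mapsto(FX,\lambda a.\{\tau_a\circ Fk\mid k\in S(a)\})$ on objects and $f\mapsto Ff$ on morphisms; the 2-cell $\alpha$ is sent to $\alpha$ together with its (unique) lifting. *)

theory Defs
  imports "HOL-Library.FuncSet" "HOL-Algebra.Complete_Lattice"
begin

section \<open>Categories, functors, natural transformations\<close>

text \<open>
  A category has a set of objects and a set of arrows inside two ambient types. All operations are
  undefined outside their proper domain (in the sense of \<^const>\<open>extensional\<close>), and so are
  the maps constituting functors and natural transformations. Hence HOL equality of functors (natural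
  transformations) with given source and target is the mathematical equality.
\<close>

record ('o, 'm) cat =
  Obj :: "'o set"
  Arr :: "'m set"
  Dom :: "'m \<Rightarrow> 'o"
  Cod :: "'m \<Rightarrow> 'o"
  Idt :: "'o \<Rightarrow> 'm"
  Cmp :: "'m \<Rightarrow> 'm \<Rightarrow> 'm"

definition hom :: "('o, 'm) cat \<Rightarrow> 'o \<Rightarrow> 'o \<Rightarrow> 'm set" where
  "hom C X Y = {f \<in> Arr C. Dom C f = X \<and> Cod C f = Y}"

definition composable :: "('o, 'm) cat \<Rightarrow> 'm \<Rightarrow> 'm \<Rightarrow> bool" where
  "composable C g f \<longleftrightarrow> g \<in> Arr C \<and> f \<in> Arr C \<and> Dom C g = Cod C f"

locale category =
  fixes C :: "('o, 'm) cat"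
  assumes Dom_closed: "f \<in> Arr C \<Longrightarrow> Dom C f \<in> Obj C"
    and Cod_closed: "f \<in> Arr C \<Longrightarrow> Cod C f \<in> Obj C"
    and Idt_hom: "X \<in> Obj C \<Longrightarrow> Idt C X \<in> hom C X X"
    and Cmp_hom: "composable C g f \<Longrightarrow> Cmp C g f \<in> hom C (Dom C f) (Cod C g)"
    and Cmp_Idt_left: "f \<in> Arr C \<Longrightarrow> Cmp C (Idt C (Cod C f)) f = f"
    and Cmp_Idt_right: "f \<in> Arr C \<Longrightarrow> Cmp C f (Idt C (Dom C f)) = f"
    and Cmp_assoc: "composable C h g \<Longrightarrow> composable C g f \<Longrightarrow>
          Cmp C h (Cmp C g f) = Cmp C (Cmp C h g) f"
    and Dom_ext: "Dom C \<in> extensional (Arr C)"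
    and Cod_ext: "Cod C \<in> extensional (Arr C)"
    and Idt_ext: "Idt C \<in> extensional (Obj C)"
    and Cmp_ext: "\<not> composable C g f \<Longrightarrow> Cmp C g f = undefined"

record ('o, 'm, 'p, 'n) func =
  OMap :: "'o \<Rightarrow> 'p"
  AMap :: "'m \<Rightarrow> 'n"

locale cfunctor = C: category C + D: category D
  for C :: "('o, 'm) cat" and D :: "('p, 'n) cat" +
  fixes F :: "('o, 'm, 'p, 'n) func"
  assumes OMap_closed: "X \<in> Obj C \<Longrightarrow> OMap F X \<in> Obj D"
    and AMap_hom: "f \<in> Arr C \<Longrightarrow> AMap F f \<in> hom D (OMap F (Dom C f)) (OMap F (Cod C f))"
    and AMap_Idt: "X \<in> Obj C \<Longrightarrow> AMap F (Idt C X) = Idt D (OMap F X)"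
    and AMap_Cmp: "composable C g f \<Longrightarrow> AMap F (Cmp C g f) = Cmp D (AMap F g) (AMap F f)"
    and OMap_ext: "OMap F \<in> extensional (Obj C)"
    and AMap_ext: "AMap F \<in> extensional (Arr C)"

definition fid :: "('o, 'm) cat \<Rightarrow> ('o, 'm, 'o, 'm) func" where
  "fid C = \<lparr> OMap = (\<lambda>X\<in>Obj C. X), AMap = (\<lambda>f\<in>Arr C. f) \<rparr>"

text \<open>The first argument is the source category of \<open>F\<close>.\<close>

definition fcomp :: "('o, 'm) cat \<Rightarrow> ('p, 'n, 'q, 'r) func \<Rightarrow> ('o, 'm, 'p, 'n) func \<Rightarrow>
    ('o, 'm, 'q, 'r) func" where
  "fcomp C G F = \<lparr> OMap = compose (Obj C) (OMap G) (OMap F),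
                   AMap = compose (Arr C) (AMap G) (AMap F) \<rparr>"

locale nat_trans = F: cfunctor C D F + G: cfunctor C D G
  for C :: "('o, 'm) cat" and D :: "('p, 'n) cat" and F G :: "('o, 'm, 'p, 'n) func" +
  fixes \<alpha> :: "'o \<Rightarrow> 'n"
  assumes component: "X \<in> Obj C \<Longrightarrow> \<alpha> X \<in> hom D (OMap F X) (OMap G X)"
    and naturality: "f \<in> Arr C \<Longrightarrow>
          Cmp D (\<alpha> (Cod C f)) (AMap F f) = Cmp D (AMap G f) (\<alpha> (Dom C f))"
    and ext: "\<alpha> \<in> extensional (Obj C)"

definition nid :: "('o, 'm) cat \<Rightarrow> ('p, 'n) cat \<Rightarrow> ('o, 'm, 'p, 'n) func \<Rightarrow> 'o \<Rightarrow> 'n" where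
  "nid C D F = (\<lambda>X\<in>Obj C. Idt D (OMap F X))"

definition vcomp :: "('o, 'm) cat \<Rightarrow> ('p, 'n) cat \<Rightarrow> ('o \<Rightarrow> 'n) \<Rightarrow> ('o \<Rightarrow> 'n) \<Rightarrow> 'o \<Rightarrow> 'n" where
  "vcomp C D \<beta> \<alpha> = (\<lambda>X\<in>Obj C. Cmp D (\<beta> X) (\<alpha> X))"

text \<open>For \<open>\<alpha> : F \<Rightarrow> G : C \<rightarrow> D\<close> and \<open>\<beta> : H \<Rightarrow> K : D \<rightarrow> E\<close>, \<open>hcomp C E H G \<beta> \<alpha> : H F \<Rightarrow> K G\<close>.\<close>

definition hcomp :: "('o, 'm) cat \<Rightarrow> ('q, 'r) cat \<Rightarrow> ('p, 'n, 'q, 'r) func \<Rightarrow>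
    ('o, 'm, 'p, 'n) func \<Rightarrow> ('p \<Rightarrow> 'r) \<Rightarrow> ('o \<Rightarrow> 'n) \<Rightarrow> 'o \<Rightarrow> 'r" where
  "hcomp C E H G \<beta> \<alpha> = (\<lambda>X\<in>Obj C. Cmp E (\<beta> (OMap G X)) (AMap H (\<alpha> X)))"

definition disc_cat :: "'a set \<Rightarrow> ('a, 'a) cat" where
  "disc_cat A = \<lparr> Obj = A, Arr = A, Dom = (\<lambda>a\<in>A. a), Cod = (\<lambda>a\<in>A. a), Idt = (\<lambda>a\<in>A. a),
     Cmp = (\<lambda>b a. if b \<in> A \<and> a \<in> A \<and> b = a then a else undefined) \<rparr>"

text \<open>
  Arrows that remember their source and target, and the category obtained from a family of
  (not necessarily disjoint) hom-sets \<open>H x y\<close>, identities \<open>i x\<close> and a composition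
  \<open>c x y z : H y z \<Rightarrow> H x y \<Rightarrow> H x z\<close>.
\<close>

datatype ('o, 'x) arrow = Arrow (src: 'o) (lab: 'x) (tgt: 'o)

definition hom_cat :: "'o set \<Rightarrow> ('o \<Rightarrow> 'o \<Rightarrow> 'x set) \<Rightarrow> ('o \<Rightarrow> 'x) \<Rightarrow>
    ('o \<Rightarrow> 'o \<Rightarrow> 'o \<Rightarrow> 'x \<Rightarrow> 'x \<Rightarrow> 'x) \<Rightarrow> ('o, ('o, 'x) arrow) cat" where
  "hom_cat Ob H i c =
    (let Ar = {Arrow x f y | x f y. x \<in> Ob \<and> y \<in> Ob \<and> f \<in> H x y} in
     \<lparr> Obj = Ob, Arr = Ar, Dom = restrict src Ar, Cod = restrict tgt Ar,
       Idt = (\<lambda>x\<in>Ob. Arrow x (i x) x),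
       Cmp = (\<lambda>g f. if g \<in> Ar \<and> f \<in> Ar \<and> src g = tgt f
                    then Arrow (src f) (c (src f) (tgt f) (tgt g) (lab g) (lab f)) (tgt g)
                    else undefined) \<rparr>)"


section \<open>Strict 2-categories and 2-functors\<close>

text \<open>
  A 2-category is given by three categories: 0-cells and 1-cells (\<open>Cells\<close>), 1-cells and 2-cells under
  vertical composition (\<open>Vert\<close>), 0-cells and 2-cells under horizontal composition (\<open>Horz\<close>).
\<close>

record ('c0, 'c1, 'c2) two_cat =
  Cells :: "('c0, 'c1) cat"
  Vert :: "('c1, 'c2) cat"
  Horz :: "('c0, 'c2) cat"

locale two_category =
  Cells: category "Cells K" + Vert: category "Vert K" + Horz: category "Horz K"
  for K :: "('c0, 'c1, 'c2) two_cat" +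
  assumes Obj_Vert: "Obj (Vert K) = Arr (Cells K)"
    and Obj_Horz: "Obj (Horz K) = Obj (Cells K)"
    and Arr_Horz: "Arr (Horz K) = Arr (Vert K)"
    and Dom_Dom: "\<alpha> \<in> Arr (Vert K) \<Longrightarrow> Dom (Cells K) (Dom (Vert K) \<alpha>) = Dom (Horz K) \<alpha>"
    and Dom_Cod: "\<alpha> \<in> Arr (Vert K) \<Longrightarrow> Dom (Cells K) (Cod (Vert K) \<alpha>) = Dom (Horz K) \<alpha>"
    and Cod_Dom: "\<alpha> \<in> Arr (Vert K) \<Longrightarrow> Cod (Cells K) (Dom (Vert K) \<alpha>) = Cod (Horz K) \<alpha>"
    and Cod_Cod: "\<alpha> \<in> Arr (Vert K) \<Longrightarrow> Cod (Cells K) (Cod (Vert K) \<alpha>) = Cod (Horz K) \<alpha>"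
    and Dom_Horz_Cmp: "composable (Horz K) \<beta> \<alpha> \<Longrightarrow>
          Dom (Vert K) (Cmp (Horz K) \<beta> \<alpha>) = Cmp (Cells K) (Dom (Vert K) \<beta>) (Dom (Vert K) \<alpha>)"
    and Cod_Horz_Cmp: "composable (Horz K) \<beta> \<alpha> \<Longrightarrow>
          Cod (Vert K) (Cmp (Horz K) \<beta> \<alpha>) = Cmp (Cells K) (Cod (Vert K) \<beta>) (Cod (Vert K) \<alpha>)"
    and Horz_Idt: "X \<in> Obj (Cells K) \<Longrightarrow> Idt (Horz K) X = Idt (Vert K) (Idt (Cells K) X)"
    and Horz_Cmp_Idt: "composable (Cells K) g f \<Longrightarrow>
          Cmp (Horz K) (Idt (Vert K) g) (Idt (Vert K) f) = Idt (Vert K) (Cmp (Cells K) g f)"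
    and interchange: "composable (Vert K) \<beta> \<alpha> \<Longrightarrow> composable (Vert K) \<delta> \<gamma> \<Longrightarrow>
          composable (Horz K) \<gamma> \<alpha> \<Longrightarrow>
          Cmp (Horz K) (Cmp (Vert K) \<delta> \<gamma>) (Cmp (Vert K) \<beta> \<alpha>) =
          Cmp (Vert K) (Cmp (Horz K) \<delta> \<beta>) (Cmp (Horz K) \<gamma> \<alpha>)"

record ('c0, 'c1, 'c2, 'd0, 'd1, 'd2) two_func =
  Map0 :: "'c0 \<Rightarrow> 'd0"
  Map1 :: "'c1 \<Rightarrow> 'd1"
  Map2 :: "'c2 \<Rightarrow> 'd2"

locale two_functor = K: two_category K + L: two_category L +
  Cells: cfunctor "Cells K" "Cells L" "\<lparr> OMap = Map0 \<Phi>, AMap = Map1 \<Phi> \<rparr>" +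
  Vert: cfunctor "Vert K" "Vert L" "\<lparr> OMap = Map1 \<Phi>, AMap = Map2 \<Phi> \<rparr>" +
  Horz: cfunctor "Horz K" "Horz L" "\<lparr> OMap = Map0 \<Phi>, AMap = Map2 \<Phi> \<rparr>"
  for K :: "('c0, 'c1, 'c2) two_cat" and L :: "('d0, 'd1, 'd2) two_cat"
    and \<Phi> :: "('c0, 'c1, 'c2, 'd0, 'd1, 'd2) two_func"

text \<open>
  The 2-categorical data with 1-cells \<open>Arr K\<close> and 2-cells \<open>Arrow f \<alpha> g\<close>, where \<open>\<alpha> \<in> H f g\<close>;
  \<open>i\<close> and \<open>v f g h\<close> give the vertical structure on labels, \<open>h \<beta> \<alpha>\<close> is the label of the horizontal
  composite of two 2-cells.
\<close>

definition mk_two_cat :: "('c0, 'c1) cat \<Rightarrow> ('c1 \<Rightarrow> 'c1 \<Rightarrow> 'x set) \<Rightarrow> ('c1 \<Rightarrow> 'x) \<Rightarrow>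
    ('c1 \<Rightarrow> 'c1 \<Rightarrow> 'c1 \<Rightarrow> 'x \<Rightarrow> 'x \<Rightarrow> 'x) \<Rightarrow>
    (('c1, 'x) arrow \<Rightarrow> ('c1, 'x) arrow \<Rightarrow> 'x) \<Rightarrow> ('c0, 'c1, ('c1, 'x) arrow) two_cat" where
  "mk_two_cat K H i v h =
    (let V = hom_cat (Arr K) H i v in
     \<lparr> Cells = K, Vert = V,
       Horz = \<lparr> Obj = Obj K, Arr = Arr V,
         Dom = (\<lambda>\<alpha>\<in>Arr V. Dom K (src \<alpha>)), Cod = (\<lambda>\<alpha>\<in>Arr V. Cod K (src \<alpha>)),
         Idt = (\<lambda>X\<in>Obj K. Idt V (Idt K X)),
         Cmp = (\<lambda>\<beta> \<alpha>. if \<beta> \<in> Arr V \<and> \<alpha> \<in> Arr V \<and> Dom K (src \<beta>) = Cod K (src \<alpha>)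
                      then Arrow (Cmp K (src \<beta>) (src \<alpha>)) (h \<beta> \<alpha>) (Cmp K (tgt \<beta>) (tgt \<alpha>))
                      else undefined) \<rparr> \<rparr>)"


section \<open>The lax coslice 2-category \<open>A/CAT\<close>\<close>

type_synonym ('a, 'o, 'm) coslice0 = "('o, 'm) cat \<times> ('a, 'a, 'o, 'm) func"
type_synonym ('a, 'o, 'm) coslice1 =
  "(('a, 'o, 'm) coslice0, ('o, 'm, 'o, 'm) func \<times> ('a \<Rightarrow> 'm)) arrow"
type_synonym ('a, 'o, 'm) coslice2 = "(('a, 'o, 'm) coslice1, 'o \<Rightarrow> 'm) arrow"

definition coslice_obj :: "'a set \<Rightarrow> ('a, 'o, 'm) coslice0 set" where
  "coslice_obj A = {(C, \<O>). category C \<and> cfunctor (disc_cat A) C \<O>}"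

fun coslice_hom :: "'a set \<Rightarrow> ('a, 'o, 'm) coslice0 \<Rightarrow> ('a, 'o, 'm) coslice0 \<Rightarrow>
    (('o, 'm, 'o, 'm) func \<times> ('a \<Rightarrow> 'm)) set" where
  "coslice_hom A (C, \<O>) (D, \<P>) =
    {(F, \<tau>). cfunctor C D F \<and> \<tau> \<in> (\<Pi>\<^sub>E a\<in>A. hom D (OMap F (OMap \<O> a)) (OMap \<P> a))}"

fun coslice_id :: "'a set \<Rightarrow> ('a, 'o, 'm) coslice0 \<Rightarrow> ('o, 'm, 'o, 'm) func \<times> ('a \<Rightarrow> 'm)" where
  "coslice_id A (C, \<O>) = (fid C, \<lambda>a\<in>A. Idt C (OMap \<O> a))"

fun coslice_comp :: "'a set \<Rightarrow> ('a, 'o, 'm) coslice0 \<Rightarrow> ('a, 'o, 'm) coslice0 \<Rightarrow>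
    ('a, 'o, 'm) coslice0 \<Rightarrow> ('o, 'm, 'o, 'm) func \<times> ('a \<Rightarrow> 'm) \<Rightarrow>
    ('o, 'm, 'o, 'm) func \<times> ('a \<Rightarrow> 'm) \<Rightarrow> ('o, 'm, 'o, 'm) func \<times> ('a \<Rightarrow> 'm)" where
  "coslice_comp A (C, _) _ (E, _) (G, \<upsilon>) (F, \<tau>) =
    (fcomp C G F, \<lambda>a\<in>A. Cmp E (\<upsilon> a) (AMap G (\<tau> a)))"

fun coslice_hom2 :: "'a set \<Rightarrow> ('a, 'o, 'm) coslice1 \<Rightarrow> ('a, 'o, 'm) coslice1 \<Rightarrow>
    ('o \<Rightarrow> 'm) set" where
  "coslice_hom2 A (Arrow (C, \<O>) (F, \<tau>) (D, \<P>)) (Arrow X (G, \<upsilon>) Y) =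
    {\<alpha>. X = (C, \<O>) \<and> Y = (D, \<P>) \<and> nat_trans C D F G \<alpha> \<and>
        (\<forall>a\<in>A. Cmp D (\<upsilon> a) (\<alpha> (OMap \<O> a)) = \<tau> a)}"

fun coslice_id2 :: "('a, 'o, 'm) coslice1 \<Rightarrow> 'o \<Rightarrow> 'm" where
  "coslice_id2 (Arrow (C, _) (F, _) (D, _)) = nid C D F"

fun coslice_vcomp :: "('a, 'o, 'm) coslice1 \<Rightarrow> ('a, 'o, 'm) coslice1 \<Rightarrow>
    ('a, 'o, 'm) coslice1 \<Rightarrow> ('o \<Rightarrow> 'm) \<Rightarrow> ('o \<Rightarrow> 'm) \<Rightarrow> 'o \<Rightarrow> 'm" where
  "coslice_vcomp (Arrow (C, _) _ (D, _)) _ _ \<beta> \<alpha> = vcomp C D \<beta> \<alpha>"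

fun coslice_hcomp :: "('a, 'o, 'm) coslice2 \<Rightarrow> ('a, 'o, 'm) coslice2 \<Rightarrow> 'o \<Rightarrow> 'm" where
  "coslice_hcomp (Arrow (Arrow _ (H, _) (E, _)) \<beta> _) (Arrow (Arrow (C, _) _ _) \<alpha> (Arrow _ (G, _) _))
    = hcomp C E H G \<beta> \<alpha>"

definition lax_coslice :: "'a set \<Rightarrow>
    (('a, 'o, 'm) coslice0, ('a, 'o, 'm) coslice1, ('a, 'o, 'm) coslice2) two_cat" where
  "lax_coslice A = mk_two_cat
     (hom_cat (coslice_obj A) (coslice_hom A) (coslice_id A) (coslice_comp A))
     (coslice_hom2 A) coslice_id2 coslice_vcomp coslice_hcomp"


section \<open>Fibrations of complete lattices\<close>

definition fibre :: "('e, 'f) cat \<Rightarrow> ('o, 'm) cat \<Rightarrow> ('e, 'f, 'o, 'm) func \<Rightarrow> 'o \<Rightarrow> 'e gorder" where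
  "fibre E B p X = \<lparr> carrier = {P \<in> Obj E. OMap p P = X}, eq = (=),
     le = (\<lambda>P Q. \<exists>f \<in> hom E P Q. AMap p f = Idt B X) \<rparr>"

text \<open>
  The library predicate \<^const>\<open>inf_pres\<close> refers to meets of arbitrary (also empty) families.
  Faithfulness is the condition that there is at most one morphism, between given objects of
  \<open>E\<close>, above a given morphism of \<open>B\<close>.
\<close>

locale clat_fibration = cfunctor E B p
  for E :: "('e, 'f) cat" and B :: "('o, 'm) cat" and p :: "('e, 'f, 'o, 'm) func" +
  assumes fibre_lattice: "X \<in> Obj B \<Longrightarrow> complete_lattice (fibre E B p X)"
    and faithful: "g \<in> hom E P Q \<Longrightarrow> g' \<in> hom E P Q \<Longrightarrow> AMap p g = AMap p g' \<Longrightarrow> g = g'"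
    and reindexing: "f \<in> hom B X Y \<Longrightarrow>
          \<exists>r. r \<in> carrier (fibre E B p Y) \<rightarrow> carrier (fibre E B p X) \<and>
              inf_pres (fibre E B p Y) (fibre E B p X) r \<and>
              (\<forall>P\<in>carrier (fibre E B p X). \<forall>Q\<in>carrier (fibre E B p Y).
                 (\<exists>g\<in>hom E P Q. AMap p g = f) \<longleftrightarrow> P \<sqsubseteq>\<^bsub>fibre E B p X\<^esub> r Q)"

definition cartesian :: "('e, 'f) cat \<Rightarrow> ('o, 'm) cat \<Rightarrow> ('e, 'f, 'o, 'm) func \<Rightarrow> 'f \<Rightarrow> bool" where
  "cartesian E B p g \<longleftrightarrow> g \<in> Arr E \<and>
    (\<forall>R\<in>Obj E. \<forall>h\<in>hom E R (Cod E g). \<forall>u\<in>hom B (OMap p R) (OMap p (Dom E g)).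
       Cmp B (AMap p g) u = AMap p h \<longrightarrow>
       (\<exists>!k. k \<in> hom E R (Dom E g) \<and> AMap p k = u \<and> Cmp E g k = h))"

definition preserves_cartesian :: "('e, 'f) cat \<Rightarrow> ('o, 'm) cat \<Rightarrow> ('e, 'f, 'o, 'm) func \<Rightarrow>
    ('e', 'f') cat \<Rightarrow> ('o', 'm') cat \<Rightarrow> ('e', 'f', 'o', 'm') func \<Rightarrow>
    ('e, 'f, 'e', 'f') func \<Rightarrow> bool" where
  "preserves_cartesian E B p E' B' p' F \<longleftrightarrow>
    (\<forall>g. cartesian E B p g \<longrightarrow> cartesian E' B' p' (AMap F g))"

text \<open>\<open>F\<close> is the total part of a 1-cell \<open>(F\<^sub>0, F)\<close>.\<close>

definition preserves_fibre_meets :: "('e, 'f) cat \<Rightarrow> ('o, 'm) cat \<Rightarrow> ('e, 'f, 'o, 'm) func \<Rightarrow>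
    ('e', 'f') cat \<Rightarrow> ('o', 'm') cat \<Rightarrow> ('e', 'f', 'o', 'm') func \<Rightarrow>
    ('o, 'm, 'o', 'm') func \<Rightarrow> ('e, 'f, 'e', 'f') func \<Rightarrow> bool" where
  "preserves_fibre_meets E B p E' B' p' F\<^sub>0 F \<longleftrightarrow>
    (\<forall>X\<in>Obj B. OMap F \<in> carrier (fibre E B p X) \<rightarrow> carrier (fibre E' B' p' (OMap F\<^sub>0 X)) \<and>
       inf_pres (fibre E B p X) (fibre E' B' p' (OMap F\<^sub>0 X)) (OMap F))"


section \<open>The 2-category of fibrations of complete lattices\<close>

type_synonym ('e, 'f, 'o, 'm) clat0 = "('e, 'f) cat \<times> ('o, 'm) cat \<times> ('e, 'f, 'o, 'm) func"
type_synonym ('e, 'f, 'o, 'm) clat1 =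
  "(('e, 'f, 'o, 'm) clat0, ('o, 'm, 'o, 'm) func \<times> ('e, 'f, 'e, 'f) func) arrow"
type_synonym ('e, 'f, 'o, 'm) clat2 =
  "(('e, 'f, 'o, 'm) clat1, ('o \<Rightarrow> 'm) \<times> ('e \<Rightarrow> 'f)) arrow"

definition clat_obj :: "('e, 'f, 'o, 'm) clat0 set" where
  "clat_obj = {(E, B, p). clat_fibration E B p}"

fun clat_hom :: "('e, 'f, 'o, 'm) clat0 \<Rightarrow> ('e, 'f, 'o, 'm) clat0 \<Rightarrow>
    (('o, 'm, 'o, 'm) func \<times> ('e, 'f, 'e, 'f) func) set" where
  "clat_hom (E, B, p) (E', B', q) =
    {(F, F'). cfunctor B B' F \<and> cfunctor E E' F' \<and> fcomp E q F' = fcomp E F p}"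

fun clat_id :: "('e, 'f, 'o, 'm) clat0 \<Rightarrow> ('o, 'm, 'o, 'm) func \<times> ('e, 'f, 'e, 'f) func" where
  "clat_id (E, B, p) = (fid B, fid E)"

fun clat_comp :: "('e, 'f, 'o, 'm) clat0 \<Rightarrow> ('e, 'f, 'o, 'm) clat0 \<Rightarrow> ('e, 'f, 'o, 'm) clat0 \<Rightarrow>
    ('o, 'm, 'o, 'm) func \<times> ('e, 'f, 'e, 'f) func \<Rightarrow>
    ('o, 'm, 'o, 'm) func \<times> ('e, 'f, 'e, 'f) func \<Rightarrow>
    ('o, 'm, 'o, 'm) func \<times> ('e, 'f, 'e, 'f) func" where
  "clat_comp (E, B, p) _ _ (G, G') (F, F') = (fcomp B G F, fcomp E G' F')"

fun clat_hom2 :: "('e, 'f, 'o, 'm) clat1 \<Rightarrow> ('e, 'f, 'o, 'm) clat1 \<Rightarrow>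
    (('o \<Rightarrow> 'm) \<times> ('e \<Rightarrow> 'f)) set" where
  "clat_hom2 (Arrow (E, B, p) (F, F') (E', B', q)) (Arrow X (G, G') Y) =
    {(\<alpha>, \<alpha>'). X = (E, B, p) \<and> Y = (E', B', q) \<and>
       nat_trans B B' F G \<alpha> \<and> nat_trans E E' F' G' \<alpha>' \<and>
       (\<forall>P\<in>Obj E. AMap q (\<alpha>' P) = \<alpha> (OMap p P))}"

fun clat_id2 :: "('e, 'f, 'o, 'm) clat1 \<Rightarrow> ('o \<Rightarrow> 'm) \<times> ('e \<Rightarrow> 'f)" where
  "clat_id2 (Arrow (E, B, _) (F, F') (E', B', _)) = (nid B B' F, nid E E' F')"

fun clat_vcomp :: "('e, 'f, 'o, 'm) clat1 \<Rightarrow> ('e, 'f, 'o, 'm) clat1 \<Rightarrow> ('e, 'f, 'o, 'm) clat1 \<Rightarrow>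
    ('o \<Rightarrow> 'm) \<times> ('e \<Rightarrow> 'f) \<Rightarrow> ('o \<Rightarrow> 'm) \<times> ('e \<Rightarrow> 'f) \<Rightarrow> ('o \<Rightarrow> 'm) \<times> ('e \<Rightarrow> 'f)" where
  "clat_vcomp (Arrow (E, B, _) _ (E', B', _)) _ _ (\<beta>, \<beta>') (\<alpha>, \<alpha>') =
    (vcomp B B' \<beta> \<alpha>, vcomp E E' \<beta>' \<alpha>')"

fun clat_hcomp :: "('e, 'f, 'o, 'm) clat2 \<Rightarrow> ('e, 'f, 'o, 'm) clat2 \<Rightarrow>
    ('o \<Rightarrow> 'm) \<times> ('e \<Rightarrow> 'f)" where
  "clat_hcomp (Arrow (Arrow _ (H, H') (E', B', _)) (\<beta>, \<beta>') _)
     (Arrow (Arrow (E, B, _) _ _) (\<alpha>, \<alpha>') (Arrow _ (G, G') _)) =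
    (hcomp B B' H G \<beta> \<alpha>, hcomp E E' H' G' \<beta>' \<alpha>')"

definition clat_two_cat ::
    "(('e, 'f, 'o, 'm) clat0, ('e, 'f, 'o, 'm) clat1, ('e, 'f, 'o, 'm) clat2) two_cat" where
  "clat_two_cat = mk_two_cat (hom_cat clat_obj clat_hom clat_id clat_comp)
     clat_hom2 clat_id2 clat_vcomp clat_hcomp"


section \<open>The 2-functor \<open>SP\<close>\<close>

type_synonym ('a, 'o, 'm) sp_obj = "'o \<times> ('a \<Rightarrow> 'm set)"
type_synonym ('a, 'o, 'm) sp_arr = "(('a, 'o, 'm) sp_obj, 'm) arrow"

definition Sp :: "'a set \<Rightarrow> ('o, 'm) cat \<Rightarrow> ('a, 'a, 'o, 'm) func \<Rightarrow>
    (('a, 'o, 'm) sp_obj, ('a, 'o, 'm) sp_arr) cat" where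
  "Sp A C \<O> = hom_cat
     {(X, S). X \<in> Obj C \<and> S \<in> (\<Pi>\<^sub>E a\<in>A. Pow (hom C X (OMap \<O> a)))}
     (\<lambda>(X, S) (Y, S'). {f \<in> hom C X Y. \<forall>a\<in>A. \<forall>k\<in>S' a. Cmp C k f \<in> S a})
     (\<lambda>(X, S). Idt C X)
     (\<lambda>_ _ _ g f. Cmp C g f)"

definition Sp_proj :: "'a set \<Rightarrow> ('o, 'm) cat \<Rightarrow> ('a, 'a, 'o, 'm) func \<Rightarrow>
    (('a, 'o, 'm) sp_obj, ('a, 'o, 'm) sp_arr, 'o, 'm) func" where
  "Sp_proj A C \<O> = \<lparr> OMap = restrict fst (Obj (Sp A C \<O>)), AMap = restrict lab (Arr (Sp A C \<O>)) \<rparr>"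

text \<open>\<open>Sp_func A C \<O> D F \<tau>\<close> is the functor induced by \<open>(F, \<tau>) : (C, \<O>) \<rightarrow> (D, \<P>)\<close>.\<close>

definition Sp_func :: "'a set \<Rightarrow> ('o, 'm) cat \<Rightarrow> ('a, 'a, 'o, 'm) func \<Rightarrow> ('o, 'm) cat \<Rightarrow>
    ('o, 'm, 'o, 'm) func \<Rightarrow> ('a \<Rightarrow> 'm) \<Rightarrow>
    (('a, 'o, 'm) sp_obj, ('a, 'o, 'm) sp_arr, ('a, 'o, 'm) sp_obj, ('a, 'o, 'm) sp_arr) func" where
  "Sp_func A C \<O> D F \<tau> =
    (let ob = (\<lambda>(X, S)\<in>Obj (Sp A C \<O>). (OMap F X, \<lambda>a\<in>A. {Cmp D (\<tau> a) (AMap F k) | k. k \<in> S a})) in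
     \<lparr> OMap = ob,
       AMap = (\<lambda>g\<in>Arr (Sp A C \<O>). Arrow (ob (src g)) (AMap F (lab g)) (ob (tgt g))) \<rparr>)"

fun SP0 :: "'a set \<Rightarrow> ('a, 'o, 'm) coslice0 \<Rightarrow>
    (('a, 'o, 'm) sp_obj, ('a, 'o, 'm) sp_arr, 'o, 'm) clat0" where
  "SP0 A (C, \<O>) = (Sp A C \<O>, C, Sp_proj A C \<O>)"

fun SP1 :: "'a set \<Rightarrow> ('a, 'o, 'm) coslice1 \<Rightarrow>
    (('a, 'o, 'm) sp_obj, ('a, 'o, 'm) sp_arr, 'o, 'm) clat1" where
  "SP1 A (Arrow (C, \<O>) (F, \<tau>) (D, \<P>)) =
    Arrow (SP0 A (C, \<O>)) (F, Sp_func A C \<O> D F \<tau>) (SP0 A (D, \<P>))"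

text \<open>
  The component of the lifting at \<open>(X, S)\<close> is \<open>\<alpha> X\<close>, as a morphism of \<open>Sp\<close>; by faithfulness of the
  projection no other lifting is possible.
\<close>

fun SP2 :: "'a set \<Rightarrow> ('a, 'o, 'm) coslice2 \<Rightarrow>
    (('a, 'o, 'm) sp_obj, ('a, 'o, 'm) sp_arr, 'o, 'm) clat2" where
  "SP2 A (Arrow (Arrow (C, \<O>) (F, \<tau>) (D, \<P>)) \<alpha> (Arrow X (G, \<upsilon>) Y)) =
    Arrow (SP1 A (Arrow (C, \<O>) (F, \<tau>) (D, \<P>)))
      (\<alpha>, \<lambda>x\<in>Obj (Sp A C \<O>). Arrow (OMap (Sp_func A C \<O> D F \<tau>) x) (\<alpha> (fst x))
                                   (OMap (Sp_func A C \<O> D G \<upsilon>) x))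
      (SP1 A (Arrow X (G, \<upsilon>) Y))"

definition SP :: "'a set \<Rightarrow>
    (('a, 'o, 'm) coslice0, ('a, 'o, 'm) coslice1, ('a, 'o, 'm) coslice2,
     (('a, 'o, 'm) sp_obj, ('a, 'o, 'm) sp_arr, 'o, 'm) clat0,
     (('a, 'o, 'm) sp_obj, ('a, 'o, 'm) sp_arr, 'o, 'm) clat1,
     (('a, 'o, 'm) sp_obj, ('a, 'o, 'm) sp_arr, 'o, 'm) clat2) two_func" where
  "SP A = \<lparr> Map0 = restrict (SP0 A) (Obj (Cells (lax_coslice A))),
            Map1 = restrict (SP1 A) (Arr (Cells (lax_coslice A))),
            Map2 = restrict (SP2 A) (Arr (Vert (lax_coslice A))) \<rparr>"

end

theory Submission
  imports Defs
begin

text \<open>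
  In the fibres of \<open>Sp\<close>, the order is reverse pointwise inclusion, so meets are pointwise unions, and a
  morphism \<open>f : (X, S) \<rightarrow> (Y, S')\<close> is Cartesian iff \<open>S a = {k \<circ> f | k \<in> S' a}\<close>. Reindexing and the functors
  \<open>Sp_func\<close> act on the predicates \<open>S a\<close> by direct images, which commute with unions; and
  \<open>\<tau> \<circ> F (k \<circ> f) = (\<tau> \<circ> F k) \<circ> F f\<close> shows that the description of Cartesian morphisms is stable under
  \<open>Sp_func\<close>. A 2-cell \<open>\<alpha>\<close> lifts because \<open>\<upsilon> \<circ> G k \<circ> \<alpha> = \<upsilon> \<circ> \<alpha> \<circ> F k = \<tau> \<circ> F k\<close>. As the projection is faithful,
  the equations of a 2-functor only have to be checked on objects of \<open>Sp\<close> and on underlying arrows.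
\<close>

section \<open>Functors and natural transformations\<close>

text \<open>All laws are strict HOL equations about partially defined data, so each one has to be
  paid for with a typing argument, and equality of functors or transformations means agreement on
  the domain together with extensionality. Two devices keep this manageable. Arrows in the
  categories of 1-cells, of 2-cells and in \<open>Sp\<close> are triples of source, label and
  target, so an equation between them splits into boundaries and labels. Both 2-categories are
  instances of \<open>mk_two_cat\<close>, for which the axioms of a 2-category and of a 2-functor
  are reduced once and for all to equations between labels; for natural transformations these are
  the usual calculus of vertical and horizontal composition. What remains specific is that the
  triangle condition of the coslice and the lifting condition of the fibrations survive both
  compositions, the order theory of a single fibre, and functoriality of \<open>Sp_func\<close> on
  the nose, which is available because an iterated direct image is again a direct image, as a
  set.\<close>

lemma homI: "f \<in> Arr C \<Longrightarrow> f \<in> hom C (Dom C f) (Cod C f)"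
  by (simp add: hom_def)

lemma hom_ArrD: "f \<in> hom C X Y \<Longrightarrow> f \<in> Arr C"
  by (simp add: hom_def)

lemma composable_hom: "g \<in> hom C Y Z \<Longrightarrow> f \<in> hom C X Y \<Longrightarrow> composable C g f"
  by (simp add: hom_def composable_def)

context category
begin

lemma hom_Obj: "f \<in> hom C X Y \<Longrightarrow> X \<in> Obj C \<and> Y \<in> Obj C"
  using Dom_closed Cod_closed by (auto simp: hom_def)

lemma comp_in_hom: "g \<in> hom C Y Z \<Longrightarrow> f \<in> hom C X Y \<Longrightarrow> Cmp C g f \<in> hom C X Z"
  using Cmp_hom[of g f] composable_hom[of g C Y Z f X] by (simp add: hom_def)

lemma comp_id_left: "f \<in> hom C X Y \<Longrightarrow> Cmp C (Idt C Y) f = f"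
  using Cmp_Idt_left[of f] by (simp add: hom_def)

lemma comp_id_right: "f \<in> hom C X Y \<Longrightarrow> Cmp C f (Idt C X) = f"
  using Cmp_Idt_right[of f] by (simp add: hom_def)

text \<open>Oriented towards right-nested composites, opposite to \<open>Cmp_assoc\<close>, so that
  typed instances serve as rewrite rules.\<close>

lemma comp_assoc:
  "h \<in> hom C Z W \<Longrightarrow> g \<in> hom C Y Z \<Longrightarrow> f \<in> hom C X Y \<Longrightarrow>
    Cmp C (Cmp C h g) f = Cmp C h (Cmp C g f)"
  using Cmp_assoc[of h g f] by (metis composable_hom)

end

context cfunctor
begin

lemma AMap_Arr: "f \<in> Arr C \<Longrightarrow> AMap F f \<in> Arr D"
  using AMap_hom[of f] by (simp add: hom_def)

lemma map_in_hom: "f \<in> hom C X Y \<Longrightarrow> AMap F f \<in> hom D (OMap F X) (OMap F Y)"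
  using AMap_hom[of f] by (simp add: hom_def)

lemma map_comp:
  "g \<in> hom C Y Z \<Longrightarrow> f \<in> hom C X Y \<Longrightarrow> AMap F (Cmp C g f) = Cmp D (AMap F g) (AMap F f)"
  by (metis AMap_Cmp composable_hom)

end

lemma (in nat_trans) natural:
  "f \<in> hom C X Y \<Longrightarrow> Cmp D (\<alpha> Y) (AMap F f) = Cmp D (AMap G f) (\<alpha> X)"
  using naturality[of f] by (simp add: hom_def)

text \<open>A functor record stores no target category and its maps are \<open>undefined\<close> off
  the source, so its values on objects and arrows of \<open>C\<close> determine it; this is why the
  two targets may differ.\<close>

lemma cfunctor_eqI:
  assumes "cfunctor C D F" "cfunctor C D' G"
    and "\<And>X. X \<in> Obj C \<Longrightarrow> OMap F X = OMap G X"
    and "\<And>f. f \<in> Arr C \<Longrightarrow> AMap F f = AMap G f"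
  shows "F = G"
proof -
  interpret F: cfunctor C D F by fact
  interpret G: cfunctor C D' G by fact
  have "OMap F = OMap G"
    using assms(3) F.OMap_ext G.OMap_ext by (intro extensionalityI)
  moreover have "AMap F = AMap G"
    using assms(4) F.AMap_ext G.AMap_ext by (intro extensionalityI)
  ultimately show ?thesis by simp
qed

lemma cfunctor_fid: assumes "category C" shows "cfunctor C C (fid C)"
proof -
  interpret category C by fact
  show ?thesis
    by unfold_locales
      (auto simp: fid_def hom_def composable_def Dom_closed Cod_closed
        intro: hom_ArrD[OF Idt_hom] hom_ArrD[OF Cmp_hom])
qed

lemma OMap_fid [simp]: "X \<in> Obj C \<Longrightarrow> OMap (fid C) X = X"
  and AMap_fid [simp]: "f \<in> Arr C \<Longrightarrow> AMap (fid C) f = f"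
  by (simp_all add: fid_def)

lemma OMap_fcomp [simp]: "X \<in> Obj C \<Longrightarrow> OMap (fcomp C G F) X = OMap G (OMap F X)"
  and AMap_fcomp [simp]: "f \<in> Arr C \<Longrightarrow> AMap (fcomp C G F) f = AMap G (AMap F f)"
  by (simp_all add: fcomp_def compose_def)

lemma cfunctor_fcomp:
  assumes "cfunctor C D F" "cfunctor D E G"
  shows "cfunctor C E (fcomp C G F)"
proof -
  interpret F: cfunctor C D F by fact
  interpret G: cfunctor D E G by fact
  show ?thesis
  proof
    fix X assume X: "X \<in> Obj C"
    then show "OMap (fcomp C G F) X \<in> Obj E" by (simp add: F.OMap_closed G.OMap_closed)
    from X show "AMap (fcomp C G F) (Idt C X) = Idt E (OMap (fcomp C G F) X)"
      by (simp add: hom_ArrD[OF F.C.Idt_hom] F.AMap_Idt G.AMap_Idt F.OMap_closed)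
  next
    fix f assume "f \<in> Arr C"
    then show "AMap (fcomp C G F) f \<in> hom E (OMap (fcomp C G F) (Dom C f)) (OMap (fcomp C G F) (Cod C f))"
      by (simp add: F.C.Dom_closed F.C.Cod_closed F.AMap_hom G.map_in_hom)
  next
    fix g f assume gf: "composable C g f"
    then have "g \<in> hom C (Cod C f) (Cod C g)" "f \<in> hom C (Dom C f) (Cod C f)"
      by (simp_all add: composable_def hom_def)
    moreover note F.map_in_hom[OF this(1)] F.map_in_hom[OF this(2)]
    ultimately show "AMap (fcomp C G F) (Cmp C g f) = Cmp E (AMap (fcomp C G F) g) (AMap (fcomp C G F) f)"
      using gf F.C.Cmp_hom[OF gf]
      by (simp add: hom_ArrD F.map_comp G.map_comp composable_def)
  qed (simp_all add: fcomp_def compose_def)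
qed

lemma fcomp_fid_left: assumes "cfunctor C D F" shows "fcomp C (fid D) F = F"
proof -
  interpret cfunctor C D F by fact
  show ?thesis
    by (rule cfunctor_eqI[OF cfunctor_fcomp[OF assms cfunctor_fid] assms])
      (simp_all add: D.category_axioms OMap_closed AMap_Arr)
qed

lemma fcomp_fid_right: assumes "cfunctor C D F" shows "fcomp C F (fid C) = F"
proof -
  interpret cfunctor C D F by fact
  show ?thesis
    by (rule cfunctor_eqI[OF cfunctor_fcomp[OF cfunctor_fid assms] assms])
      (simp_all add: C.category_axioms)
qed

lemma fcomp_assoc:
  assumes "cfunctor B C F" "cfunctor C D G" "cfunctor D E H"
  shows "fcomp B (fcomp C H G) F = fcomp B H (fcomp B G F)"
  by (rule cfunctor_eqI[OF cfunctor_fcomp[OF _ cfunctor_fcomp] cfunctor_fcomp[OF cfunctor_fcomp]])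
    (use assms in \<open>simp_all add: cfunctor.OMap_closed cfunctor.AMap_Arr\<close>)

section \<open>Vertical composition of natural transformations\<close>

lemma nat_trans_nid: assumes "cfunctor C D F" shows "nat_trans C D F F (nid C D F)"
proof -
  interpret cfunctor C D F by fact
  show ?thesis
    by unfold_locales
      (auto simp: nid_def OMap_closed D.Idt_hom C.Dom_closed C.Cod_closed
        D.comp_id_left[OF AMap_hom] D.comp_id_right[OF AMap_hom])
qed

lemma nat_trans_vcomp:
  assumes "nat_trans C D F G \<alpha>" "nat_trans C D G H \<beta>"
  shows "nat_trans C D F H (vcomp C D \<beta> \<alpha>)"
proof -
  interpret a: nat_trans C D F G \<alpha> by fact
  interpret b: nat_trans C D G H \<beta> by fact
  show ?thesis
  proof
    fix X assume "X \<in> Obj C"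
    then show "vcomp C D \<beta> \<alpha> X \<in> hom D (OMap F X) (OMap H X)"
      using a.F.D.comp_in_hom[OF b.component a.component] by (simp add: vcomp_def)
  next
    fix f assume f: "f \<in> Arr C"
    let ?X = "Dom C f" and ?Y = "Cod C f"
    have ob: "?X \<in> Obj C" "?Y \<in> Obj C" using f a.F.C.Dom_closed a.F.C.Cod_closed by auto
    note h = a.component[OF ob(1)] a.component[OF ob(2)] b.component[OF ob(1)] b.component[OF ob(2)]
      a.F.AMap_hom[OF f] a.G.AMap_hom[OF f] b.G.AMap_hom[OF f]
    have "Cmp D (Cmp D (\<beta> ?Y) (\<alpha> ?Y)) (AMap F f) = Cmp D (\<beta> ?Y) (Cmp D (\<alpha> ?Y) (AMap F f))"
      by (rule a.F.D.comp_assoc) (fact h)+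
    also have "\<dots> = Cmp D (\<beta> ?Y) (Cmp D (AMap G f) (\<alpha> ?X))"
      by (simp add: a.naturality[OF f])
    also have "\<dots> = Cmp D (Cmp D (\<beta> ?Y) (AMap G f)) (\<alpha> ?X)"
      by (rule a.F.D.comp_assoc[symmetric]) (fact h)+
    also have "\<dots> = Cmp D (Cmp D (AMap H f) (\<beta> ?X)) (\<alpha> ?X)"
      by (simp add: b.naturality[OF f])
    also have "\<dots> = Cmp D (AMap H f) (Cmp D (\<beta> ?X) (\<alpha> ?X))"
      by (rule a.F.D.comp_assoc) (fact h)+
    finally show "Cmp D (vcomp C D \<beta> \<alpha> ?Y) (AMap F f) = Cmp D (AMap H f) (vcomp C D \<beta> \<alpha> ?X)"
      by (simp add: vcomp_def ob)
  qed (simp add: vcomp_def)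
qed

text \<open>Only extensionality is asked of \<open>\<beta>\<close>, so the unit laws below are
  checked on components without first proving that the composite is natural.\<close>

lemma nat_trans_eqI:
  assumes "nat_trans C D F G \<alpha>" "\<beta> \<in> extensional (Obj C)"
    and "\<And>X. X \<in> Obj C \<Longrightarrow> \<beta> X = \<alpha> X"
  shows "\<beta> = \<alpha>"
  using assms(2) nat_trans.ext[OF assms(1)] assms(3) by (rule extensionalityI)

lemma vcomp_nid_left: assumes "nat_trans C D F G \<alpha>" shows "vcomp C D (nid C D G) \<alpha> = \<alpha>"
proof -
  interpret nat_trans C D F G \<alpha> by fact
  show ?thesis
    by (rule nat_trans_eqI[OF assms])
      (simp_all add: vcomp_def nid_def F.D.comp_id_left[OF component])
qed

lemma vcomp_nid_right: assumes "nat_trans C D F G \<alpha>" shows "vcomp C D \<alpha> (nid C D F) = \<alpha>"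
proof -
  interpret nat_trans C D F G \<alpha> by fact
  show ?thesis
    by (rule nat_trans_eqI[OF assms])
      (simp_all add: vcomp_def nid_def F.D.comp_id_right[OF component])
qed

lemma vcomp_assoc:
  assumes "nat_trans C D F G \<alpha>" "nat_trans C D G H \<beta>" "nat_trans C D H K \<gamma>"
  shows "vcomp C D (vcomp C D \<gamma> \<beta>) \<alpha> = vcomp C D \<gamma> (vcomp C D \<beta> \<alpha>)"
proof -
  interpret a: nat_trans C D F G \<alpha> by fact
  interpret b: nat_trans C D G H \<beta> by fact
  interpret c: nat_trans C D H K \<gamma> by fact
  show ?thesis
    by (auto simp: vcomp_def fun_eq_iff a.F.D.comp_assoc[OF c.component b.component a.component])
qed

section \<open>Horizontal composition of natural transformations and the interchange law\<close>

lemma nat_trans_hcomp: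
  assumes "nat_trans C D F G \<alpha>" "nat_trans D E H K \<beta>"
  shows "nat_trans C E (fcomp C H F) (fcomp C K G) (hcomp C E H G \<beta> \<alpha>)"
proof -
  interpret a: nat_trans C D F G \<alpha> by fact
  interpret b: nat_trans D E H K \<beta> by fact
  interpret HF: cfunctor C E "fcomp C H F" by (rule cfunctor_fcomp) unfold_locales
  interpret KG: cfunctor C E "fcomp C K G" by (rule cfunctor_fcomp) unfold_locales
  note E = b.F.D.comp_in_hom b.F.D.comp_assoc
  show ?thesis
  proof
    fix X assume X: "X \<in> Obj C"
    then show "hcomp C E H G \<beta> \<alpha> X \<in> hom E (OMap (fcomp C H F) X) (OMap (fcomp C K G) X)"
      using E(1)[OF b.component b.F.map_in_hom, OF a.G.OMap_closed a.component]
      by (simp add: hcomp_def)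
  next
    fix f assume f: "f \<in> Arr C"
    let ?X = "Dom C f" and ?Y = "Cod C f"
    have ob: "?X \<in> Obj C" "?Y \<in> Obj C" using f a.F.C.Dom_closed a.F.C.Cod_closed by auto
    note aX = a.component[OF ob(1)] and aY = a.component[OF ob(2)]
      and Ff = a.F.AMap_hom[OF f] and Gf = a.G.AMap_hom[OF f]
    note bGX = b.component[OF a.G.OMap_closed[OF ob(1)]] and bGY = b.component[OF a.G.OMap_closed[OF ob(2)]]
    \<comment> \<open>Two naturality squares are pasted: that of \<open>\<alpha>\<close> at
      \<open>f\<close>, transported by \<open>H\<close>, and that of \<open>\<beta>\<close> at the
      arrow \<open>AMap G f\<close>.\<close>
    have "Cmp E (Cmp E (\<beta> (OMap G ?Y)) (AMap H (\<alpha> ?Y))) (AMap H (AMap F f))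
        = Cmp E (\<beta> (OMap G ?Y)) (AMap H (Cmp D (\<alpha> ?Y) (AMap F f)))"
      by (simp add: E(2)[OF bGY b.F.map_in_hom b.F.map_in_hom, OF aY Ff] b.F.map_comp[OF aY Ff])
    also have "\<dots> = Cmp E (\<beta> (OMap G ?Y)) (Cmp E (AMap H (AMap G f)) (AMap H (\<alpha> ?X)))"
      by (simp add: a.naturality[OF f] b.F.map_comp[OF Gf aX])
    also have "\<dots> = Cmp E (Cmp E (\<beta> (OMap G ?Y)) (AMap H (AMap G f))) (AMap H (\<alpha> ?X))"
      by (simp add: E(2)[OF bGY b.F.map_in_hom b.F.map_in_hom, OF Gf aX])
    also have "\<dots> = Cmp E (Cmp E (AMap K (AMap G f)) (\<beta> (OMap G ?X))) (AMap H (\<alpha> ?X))"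
      by (simp add: b.natural[OF Gf])
    also have "\<dots> = Cmp E (AMap K (AMap G f)) (Cmp E (\<beta> (OMap G ?X)) (AMap H (\<alpha> ?X)))"
      by (rule E(2)[OF b.G.map_in_hom bGX b.F.map_in_hom, OF Gf aX])
    finally show "Cmp E (hcomp C E H G \<beta> \<alpha> ?Y) (AMap (fcomp C H F) f)
        = Cmp E (AMap (fcomp C K G) f) (hcomp C E H G \<beta> \<alpha> ?X)"
      by (simp add: hcomp_def ob f)
  qed (simp add: hcomp_def)
qed

lemma hcomp_nid_left:
  assumes "nat_trans C D F G \<alpha>" shows "hcomp C D (fid D) G (nid D D (fid D)) \<alpha> = \<alpha>"
proof -
  interpret nat_trans C D F G \<alpha> by fact
  show ?thesis
    by (rule nat_trans_eqI[OF assms])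
      (simp_all add: hcomp_def nid_def G.OMap_closed hom_ArrD[OF component]
        F.D.comp_id_left[OF component])
qed

lemma hcomp_nid_right:
  assumes "nat_trans C D F G \<alpha>" shows "hcomp C D F (fid C) \<alpha> (nid C C (fid C)) = \<alpha>"
proof -
  interpret nat_trans C D F G \<alpha> by fact
  show ?thesis
    by (rule nat_trans_eqI[OF assms])
      (simp_all add: hcomp_def nid_def F.AMap_Idt F.D.comp_id_right[OF component])
qed

lemma hcomp_nid_nid:
  assumes "cfunctor C D F" "cfunctor D E G"
  shows "hcomp C E G F (nid D E G) (nid C D F) = nid C E (fcomp C G F)"
proof -
  interpret F: cfunctor C D F by fact
  interpret G: cfunctor D E G by fact
  show ?thesis
    by (auto simp: hcomp_def nid_def fun_eq_iff F.OMap_closed G.AMap_Idt G.OMap_closed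
        G.D.comp_id_left[OF G.D.Idt_hom])
qed

text \<open>On components both sides are a bracketing of the same threefold composite of
  \<open>\<gamma>\<close>, \<open>L\<close> of \<open>\<beta>\<close> and \<open>L H\<close> of
  \<open>\<alpha>\<close>, so functoriality of \<open>L\<close> suffices and naturality does not
  enter.\<close>

lemma hcomp_assoc:
  assumes "nat_trans B C F G \<alpha>" "nat_trans C D H K \<beta>" "nat_trans D E L M \<gamma>"
  shows "hcomp B E L (fcomp B K G) \<gamma> (hcomp B D H G \<beta> \<alpha>)
    = hcomp B E (fcomp C L H) G (hcomp C E L K \<gamma> \<beta>) \<alpha>"
proof
  interpret a: nat_trans B C F G \<alpha> by fact
  interpret b: nat_trans C D H K \<beta> by fact
  interpret c: nat_trans D E L M \<gamma> by fact
  fix X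
  show "hcomp B E L (fcomp B K G) \<gamma> (hcomp B D H G \<beta> \<alpha>) X
    = hcomp B E (fcomp C L H) G (hcomp C E L K \<gamma> \<beta>) \<alpha> X"
  proof (cases "X \<in> Obj B")
    case X: True
    note aX = a.component[OF X] and GX = a.G.OMap_closed[OF X]
    note HaX = b.F.map_in_hom[OF aX] and bGX = b.component[OF GX]
      and cX = c.component[OF b.G.OMap_closed[OF GX]]
    show ?thesis
      using c.F.D.comp_assoc[OF cX c.F.map_in_hom[OF bGX] c.F.map_in_hom[OF HaX]]
      by (simp add: hcomp_def X GX hom_ArrD[OF aX] c.F.map_comp[OF bGX HaX])
  qed (simp add: hcomp_def)
qed

text \<open>The two sides differ in the order of the two middle factors, which naturality of
  \<open>\<gamma>\<close> at the arrow \<open>\<beta> X\<close> exchanges; the rest is functoriality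
  of \<open>H\<close> and rebracketing.\<close>

lemma hcomp_interchange:
  assumes "nat_trans C D F G \<alpha>" "nat_trans C D G K \<beta>" "nat_trans D E H L \<gamma>" "nat_trans D E L M \<delta>"
  shows "hcomp C E H K (vcomp D E \<delta> \<gamma>) (vcomp C D \<beta> \<alpha>)
    = vcomp C E (hcomp C E L K \<delta> \<beta>) (hcomp C E H G \<gamma> \<alpha>)"
proof
  interpret a: nat_trans C D F G \<alpha> by fact
  interpret b: nat_trans C D G K \<beta> by fact
  interpret c: nat_trans D E H L \<gamma> by fact
  interpret d: nat_trans D E L M \<delta> by fact
  fix X
  show "hcomp C E H K (vcomp D E \<delta> \<gamma>) (vcomp C D \<beta> \<alpha>) X
    = vcomp C E (hcomp C E L K \<delta> \<beta>) (hcomp C E H G \<gamma> \<alpha>) X"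
  proof (cases "X \<in> Obj C")
    case X: True
    note aX = a.component[OF X] and bX = b.component[OF X] and KX = b.G.OMap_closed[OF X]
      and GX = a.G.OMap_closed[OF X]
    note cGX = c.component[OF GX] and cKX = c.component[OF KX] and dKX = d.component[OF KX]
      and HaX = c.F.map_in_hom[OF aX] and HbX = c.F.map_in_hom[OF bX] and LbX = c.G.map_in_hom[OF bX]
    note assoc = c.F.D.comp_assoc and comp = c.F.D.comp_in_hom
    have "Cmp E (Cmp E (\<delta> (OMap K X)) (\<gamma> (OMap K X))) (Cmp E (AMap H (\<beta> X)) (AMap H (\<alpha> X)))
        = Cmp E (\<delta> (OMap K X)) (Cmp E (Cmp E (\<gamma> (OMap K X)) (AMap H (\<beta> X))) (AMap H (\<alpha> X)))"
      by (simp add: assoc[OF dKX cKX comp[OF HbX HaX]] assoc[OF cKX HbX HaX])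
    also have "\<dots> = Cmp E (\<delta> (OMap K X)) (Cmp E (Cmp E (AMap L (\<beta> X)) (\<gamma> (OMap G X))) (AMap H (\<alpha> X)))"
      by (simp add: c.natural[OF bX])
    also have "\<dots> = Cmp E (Cmp E (\<delta> (OMap K X)) (AMap L (\<beta> X))) (Cmp E (\<gamma> (OMap G X)) (AMap H (\<alpha> X)))"
      by (simp add: assoc[OF LbX cGX HaX] assoc[OF dKX LbX comp[OF cGX HaX]])
    finally show ?thesis
      by (simp add: hcomp_def vcomp_def X KX c.F.map_comp[OF bX aX])
  qed (simp add: hcomp_def vcomp_def)
qed

section \<open>Categories from hom-sets and 2-categories from labelled 2-cells\<close>

lemma Obj_hom_cat [simp]: "Obj (hom_cat Ob H i c) = Ob"
  by (simp add: hom_cat_def Let_def)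

lemma Arr_hom_cat: "a \<in> Arr (hom_cat Ob H i c) \<longleftrightarrow>
    src a \<in> Ob \<and> tgt a \<in> Ob \<and> lab a \<in> H (src a) (tgt a)"
  by (cases a) (simp add: hom_cat_def Let_def)

lemma Dom_hom_cat [simp]: "a \<in> Arr (hom_cat Ob H i c) \<Longrightarrow> Dom (hom_cat Ob H i c) a = src a"
  and Cod_hom_cat [simp]: "a \<in> Arr (hom_cat Ob H i c) \<Longrightarrow> Cod (hom_cat Ob H i c) a = tgt a"
  and Idt_hom_cat [simp]: "x \<in> Ob \<Longrightarrow> Idt (hom_cat Ob H i c) x = Arrow x (i x) x"
  by (simp_all add: hom_cat_def Let_def)

lemma Cmp_hom_cat [simp]:
  "\<lbrakk>b \<in> Arr (hom_cat Ob H i c); a \<in> Arr (hom_cat Ob H i c); src b = tgt a\<rbrakk> \<Longrightarrow>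
    Cmp (hom_cat Ob H i c) b a = Arrow (src a) (c (src a) (tgt a) (tgt b) (lab b) (lab a)) (tgt b)"
  by (simp add: hom_cat_def Let_def)

lemma composable_hom_cat: "composable (hom_cat Ob H i c) b a \<longleftrightarrow>
    b \<in> Arr (hom_cat Ob H i c) \<and> a \<in> Arr (hom_cat Ob H i c) \<and> src b = tgt a"
  unfolding composable_def by (metis Dom_hom_cat Cod_hom_cat)

lemma hom_hom_cat: "a \<in> hom (hom_cat Ob H i c) x y \<longleftrightarrow>
    (\<exists>f. a = Arrow x f y \<and> x \<in> Ob \<and> y \<in> Ob \<and> f \<in> H x y)"
proof
  assume "a \<in> hom (hom_cat Ob H i c) x y"
  then have a: "a \<in> Arr (hom_cat Ob H i c)" "src a = x" "tgt a = y"
    by (auto simp: hom_def)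
  then show "\<exists>f. a = Arrow x f y \<and> x \<in> Ob \<and> y \<in> Ob \<and> f \<in> H x y"
    by (cases a) (auto simp: Arr_hom_cat)
next
  assume "\<exists>f. a = Arrow x f y \<and> x \<in> Ob \<and> y \<in> Ob \<and> f \<in> H x y"
  then obtain f where "a = Arrow x f y" "a \<in> Arr (hom_cat Ob H i c)"
    by (auto simp: Arr_hom_cat)
  then show "a \<in> hom (hom_cat Ob H i c) x y"
    by (auto simp: hom_def)
qed

text \<open>The category laws as equations between labels. Because an arrow carries its boundary,
  the sets \<open>H x y\<close> may overlap, and the indices of \<open>c\<close> can be recovered
  from the arrows being composed.\<close>

locale hom_data =
  fixes Ob :: "'o set" and H :: "'o \<Rightarrow> 'o \<Rightarrow> 'x set" and i :: "'o \<Rightarrow> 'x"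
    and c :: "'o \<Rightarrow> 'o \<Rightarrow> 'o \<Rightarrow> 'x \<Rightarrow> 'x \<Rightarrow> 'x"
  assumes id_in: "x \<in> Ob \<Longrightarrow> i x \<in> H x x"
    and comp_in: "\<lbrakk>x \<in> Ob; y \<in> Ob; z \<in> Ob; f \<in> H x y; g \<in> H y z\<rbrakk> \<Longrightarrow> c x y z g f \<in> H x z"
    and id_left: "\<lbrakk>x \<in> Ob; y \<in> Ob; f \<in> H x y\<rbrakk> \<Longrightarrow> c x y y (i y) f = f"
    and id_right: "\<lbrakk>x \<in> Ob; y \<in> Ob; f \<in> H x y\<rbrakk> \<Longrightarrow> c x x y f (i x) = f"
    and assoc: "\<lbrakk>x \<in> Ob; y \<in> Ob; z \<in> Ob; w \<in> Ob; f \<in> H x y; g \<in> H y z; h \<in> H z w\<rbrakk> \<Longrightarrow>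
          c x z w h (c x y z g f) = c x y w (c y z w h g) f"
begin

lemma category_hom_cat: "category (hom_cat Ob H i c)"
proof
  let ?C = "hom_cat Ob H i c"
  note A = Arr_hom_cat
  fix f assume f: "f \<in> Arr ?C"
  then have id: "Arrow (src f) (i (src f)) (src f) \<in> Arr ?C" "Arrow (tgt f) (i (tgt f)) (tgt f) \<in> Arr ?C"
    by (auto simp: A id_in)
  show "Dom ?C f \<in> Obj ?C" "Cod ?C f \<in> Obj ?C"
    using f by (auto simp: A)
  show "Cmp ?C (Idt ?C (Cod ?C f)) f = f" "Cmp ?C f (Idt ?C (Dom ?C f)) = f"
    using f id by (cases f; auto simp: A id_left id_right)+
next
  let ?C = "hom_cat Ob H i c"
  fix X assume "X \<in> Obj ?C"
  then show "Idt ?C X \<in> hom ?C X X"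
    by (simp add: hom_hom_cat id_in)
next
  let ?C = "hom_cat Ob H i c"
  fix g f assume "composable ?C g f"
  then show "Cmp ?C g f \<in> hom ?C (Dom ?C f) (Cod ?C g)"
    by (auto simp: composable_hom_cat hom_hom_cat) (auto simp: Arr_hom_cat comp_in)
next
  let ?C = "hom_cat Ob H i c"
  fix h g f assume hg: "composable ?C h g" and gf: "composable ?C g f"
  then have 1: "h \<in> Arr ?C" "g \<in> Arr ?C" "f \<in> Arr ?C" "src h = tgt g" "src g = tgt f"
    by (simp_all add: composable_hom_cat)
  then have "Cmp ?C g f \<in> Arr ?C" "Cmp ?C h g \<in> Arr ?C"
    by (auto simp: Arr_hom_cat comp_in)
  with 1 show "Cmp ?C h (Cmp ?C g f) = Cmp ?C (Cmp ?C h g) f"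
    by (auto simp: assoc Arr_hom_cat)
qed (auto simp: hom_cat_def Let_def composable_def split: if_splits)

end

text \<open>What is left of the axioms of a 2-category once 2-cells are triples: boundaries of
  composites are computed in \<open>K\<close>, and only labels need laws. \<open>parallel\<close> is
  there because \<open>mk_two_cat\<close> reads the 0-cells of a 2-cell off its source 1-cell
  alone.\<close>

locale two_cat_data = category K + V: hom_data "Arr K" H i v
  for K :: "('c0, 'c1) cat" and H :: "'c1 \<Rightarrow> 'c1 \<Rightarrow> 'x set" and i :: "'c1 \<Rightarrow> 'x"
    and v :: "'c1 \<Rightarrow> 'c1 \<Rightarrow> 'c1 \<Rightarrow> 'x \<Rightarrow> 'x \<Rightarrow> 'x" +
  fixes h :: "('c1, 'x) arrow \<Rightarrow> ('c1, 'x) arrow \<Rightarrow> 'x"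
  assumes parallel: "\<lbrakk>f \<in> Arr K; g \<in> Arr K; \<alpha> \<in> H f g\<rbrakk> \<Longrightarrow> Dom K g = Dom K f \<and> Cod K g = Cod K f"
    and hcomp_in: "\<lbrakk>f \<in> Arr K; f' \<in> Arr K; \<alpha> \<in> H f f'; g \<in> Arr K; g' \<in> Arr K; \<beta> \<in> H g g';
            Dom K g = Cod K f\<rbrakk> \<Longrightarrow>
          h (Arrow g \<beta> g') (Arrow f \<alpha> f') \<in> H (Cmp K g f) (Cmp K g' f')"
    and hcomp_id_left: "\<lbrakk>f \<in> Arr K; f' \<in> Arr K; \<alpha> \<in> H f f'; e = Idt K (Cod K f)\<rbrakk> \<Longrightarrow>
          h (Arrow e (i e) e) (Arrow f \<alpha> f') = \<alpha>"
    and hcomp_id_right: "\<lbrakk>f \<in> Arr K; f' \<in> Arr K; \<alpha> \<in> H f f'; e = Idt K (Dom K f)\<rbrakk> \<Longrightarrow>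
          h (Arrow f \<alpha> f') (Arrow e (i e) e) = \<alpha>"
    and hcomp_assoc: "\<lbrakk>f \<in> Arr K; f' \<in> Arr K; \<alpha> \<in> H f f'; g \<in> Arr K; g' \<in> Arr K; \<beta> \<in> H g g';
            k \<in> Arr K; k' \<in> Arr K; \<gamma> \<in> H k k'; Dom K g = Cod K f; Dom K k = Cod K g\<rbrakk> \<Longrightarrow>
          h (Arrow k \<gamma> k') (Arrow (Cmp K g f) (h (Arrow g \<beta> g') (Arrow f \<alpha> f')) (Cmp K g' f'))
          = h (Arrow (Cmp K k g) (h (Arrow k \<gamma> k') (Arrow g \<beta> g')) (Cmp K k' g')) (Arrow f \<alpha> f')"
    and hcomp_id: "\<lbrakk>f \<in> Arr K; g \<in> Arr K; Dom K g = Cod K f\<rbrakk> \<Longrightarrow>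
          h (Arrow g (i g) g) (Arrow f (i f) f) = i (Cmp K g f)"
    and hcomp_vcomp: "\<lbrakk>f \<in> Arr K; f' \<in> Arr K; f'' \<in> Arr K; \<alpha> \<in> H f f'; \<beta> \<in> H f' f'';
            g \<in> Arr K; g' \<in> Arr K; g'' \<in> Arr K; \<gamma> \<in> H g g'; \<delta> \<in> H g' g''; Dom K g = Cod K f\<rbrakk> \<Longrightarrow>
          h (Arrow g (v g g' g'' \<delta> \<gamma>) g'') (Arrow f (v f f' f'' \<beta> \<alpha>) f'')
          = v (Cmp K g f) (Cmp K g' f') (Cmp K g'' f'')
              (h (Arrow g' \<delta> g'') (Arrow f' \<beta> f'')) (h (Arrow g \<gamma> g') (Arrow f \<alpha> f'))"
begin

abbreviation T :: "('c0, 'c1, ('c1, 'x) arrow) two_cat" where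
  "T \<equiv> mk_two_cat K H i v h"

lemma Cells_T [simp]: "Cells T = K"
  and Vert_T [simp]: "Vert T = hom_cat (Arr K) H i v"
  by (simp_all add: mk_two_cat_def Let_def)

abbreviation two_cells :: "('c1, 'x) arrow set" where
  "two_cells \<equiv> Arr (hom_cat (Arr K) H i v)"

lemma Obj_Horz_T [simp]: "Obj (Horz T) = Obj K"
  and Arr_Horz_T [simp]: "Arr (Horz T) = two_cells"
  and Dom_Horz_T [simp]: "\<alpha> \<in> two_cells \<Longrightarrow> Dom (Horz T) \<alpha> = Dom K (src \<alpha>)"
  and Cod_Horz_T [simp]: "\<alpha> \<in> two_cells \<Longrightarrow> Cod (Horz T) \<alpha> = Cod K (src \<alpha>)"
  and Cmp_Horz_T [simp]: "\<lbrakk>\<beta> \<in> two_cells; \<alpha> \<in> two_cells; Dom K (src \<beta>) = Cod K (src \<alpha>)\<rbrakk> \<Longrightarrow>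
    Cmp (Horz T) \<beta> \<alpha> = Arrow (Cmp K (src \<beta>) (src \<alpha>)) (h \<beta> \<alpha>) (Cmp K (tgt \<beta>) (tgt \<alpha>))"
  by (simp_all add: mk_two_cat_def Let_def)

lemma Idt_Arr: "X \<in> Obj K \<Longrightarrow> Idt K X \<in> Arr K"
  by (rule hom_ArrD[OF Idt_hom])

lemma Idt_Horz_T [simp]: "X \<in> Obj K \<Longrightarrow> Idt (Horz T) X = Arrow (Idt K X) (i (Idt K X)) (Idt K X)"
  by (simp add: mk_two_cat_def Let_def Idt_Arr)

lemma composable_Horz_T: "composable (Horz T) \<beta> \<alpha> \<longleftrightarrow>
    \<beta> \<in> two_cells \<and> \<alpha> \<in> two_cells \<and> Dom K (src \<beta>) = Cod K (src \<alpha>)"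
  unfolding composable_def by (metis Arr_Horz_T Dom_Horz_T Cod_Horz_T)

lemma two_cellD:
  "Arrow f \<alpha> g \<in> two_cells \<Longrightarrow>
    f \<in> Arr K \<and> g \<in> Arr K \<and> \<alpha> \<in> H f g \<and> Dom K g = Dom K f \<and> Cod K g = Cod K f"
  using parallel by (auto simp: Arr_hom_cat)

lemma two_cell_iff: "Arrow f \<alpha> g \<in> two_cells \<longleftrightarrow> f \<in> Arr K \<and> g \<in> Arr K \<and> \<alpha> \<in> H f g"
  by (simp add: Arr_hom_cat)

lemma Cmp_1:
  assumes "f \<in> Arr K" "g \<in> Arr K" "Dom K g = Cod K f"
  shows "Cmp K g f \<in> Arr K" "Dom K (Cmp K g f) = Dom K f" "Cod K (Cmp K g f) = Cod K g"
  using Cmp_hom[of g f] assms by (simp_all add: hom_def composable_def)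

lemma Idt_1: "X \<in> Obj K \<Longrightarrow> Dom K (Idt K X) = X" "X \<in> Obj K \<Longrightarrow> Cod K (Idt K X) = X"
  using Idt_hom by (simp_all add: hom_def)

lemma hcomp_two_cell:
  assumes "Arrow g \<beta> g' \<in> two_cells" "Arrow f \<alpha> f' \<in> two_cells" "Dom K g = Cod K f"
  shows "Arrow (Cmp K g f) (h (Arrow g \<beta> g') (Arrow f \<alpha> f')) (Cmp K g' f') \<in> two_cells"
  using two_cellD[OF assms(1)] two_cellD[OF assms(2)] assms(3)
  by (simp add: two_cell_iff hcomp_in Cmp_1)

lemma category_Horz_T: "category (Horz T)"
proof
  fix X assume "X \<in> Obj (Horz T)"
  then have "X \<in> Obj K" by simp
  then show "Idt (Horz T) X \<in> hom (Horz T) X X"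
    using Idt_hom[of X] by (simp add: hom_def two_cell_iff V.id_in Idt_Arr)
next
  fix x assume x: "x \<in> Arr (Horz T)"
  obtain f \<alpha> g where [simp]: "x = Arrow f \<alpha> g" by (cases x)
  from x have x': "Arrow f \<alpha> g \<in> two_cells" by simp
  note xD = two_cellD[OF x']
  show "Dom (Horz T) x \<in> Obj (Horz T)" "Cod (Horz T) x \<in> Obj (Horz T)"
    using x' xD by (simp_all add: Dom_closed Cod_closed)
  from xD have ob: "Dom K f \<in> Obj K" "Cod K f \<in> Obj K" by (simp_all add: Dom_closed Cod_closed)
  then have "Arrow (Idt K (Cod K f)) (i (Idt K (Cod K f))) (Idt K (Cod K f)) \<in> two_cells"
    "Arrow (Idt K (Dom K f)) (i (Idt K (Dom K f))) (Idt K (Dom K f)) \<in> two_cells"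
    by (simp_all add: two_cell_iff V.id_in Idt_Arr)
  \<comment> \<open>The unit laws are needed for the source \<open>f\<close> and also for the target
    \<open>g\<close>. For \<open>g\<close> the unit is written with the endpoints of
    \<open>f\<close>, hence the explicit instances at \<open>g\<close>, matched through
    \<open>parallel\<close>.\<close>
  then show "Cmp (Horz T) (Idt (Horz T) (Cod (Horz T) x)) x = x"
      "Cmp (Horz T) x (Idt (Horz T) (Dom (Horz T) x)) = x"
    using x' xD ob Cmp_Idt_left[of g] Cmp_Idt_right[of g]
    by (simp_all add: Idt_1 Cmp_Idt_left Cmp_Idt_right hcomp_id_left hcomp_id_right)
next
  fix y x assume yx: "composable (Horz T) y x"
  obtain f \<alpha> f' g \<beta> g' where [simp]: "x = Arrow f \<alpha> f'" "y = Arrow g \<beta> g'"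
    by (cases x; cases y)
  from yx show "Cmp (Horz T) y x \<in> hom (Horz T) (Dom (Horz T) x) (Cod (Horz T) y)"
    using two_cellD[of f \<alpha> f'] two_cellD[of g \<beta> g']
    by (simp add: composable_Horz_T hom_def hcomp_two_cell Cmp_1)
next
  fix z y x assume zy: "composable (Horz T) z y" and yx: "composable (Horz T) y x"
  obtain f \<alpha> f' g \<beta> g' k \<gamma> k'
    where [simp]: "x = Arrow f \<alpha> f'" "y = Arrow g \<beta> g'" "z = Arrow k \<gamma> k'"
    by (cases x; cases y; cases z)
  from zy yx have cells: "Arrow f \<alpha> f' \<in> two_cells" "Arrow g \<beta> g' \<in> two_cells" "Arrow k \<gamma> k' \<in> two_cells"
    and bd: "Dom K g = Cod K f" "Dom K k = Cod K g"
    by (simp_all add: composable_Horz_T)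
  note D = two_cellD[OF cells(1)] two_cellD[OF cells(2)] two_cellD[OF cells(3)]
  have "Cmp K k (Cmp K g f) = Cmp K (Cmp K k g) f" "Cmp K k' (Cmp K g' f') = Cmp K (Cmp K k' g') f'"
    using D bd by (simp_all add: Cmp_assoc composable_def)
  then show "Cmp (Horz T) z (Cmp (Horz T) y x) = Cmp (Horz T) (Cmp (Horz T) z y) x"
    using D bd cells hcomp_two_cell[OF cells(2,1)] hcomp_two_cell[OF cells(3,2)]
      hcomp_assoc[of f f' \<alpha> g g' \<beta> k k' \<gamma>]
    by (simp add: Cmp_1)
next
  fix y x assume "\<not> composable (Horz T) y x"
  then show "Cmp (Horz T) y x = undefined"
    unfolding composable_Horz_T by (auto simp: mk_two_cat_def Let_def)
qed (simp_all add: mk_two_cat_def Let_def)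

lemma two_category_T: "two_category T"
proof (intro two_category.intro two_category_axioms.intro)
  show "category (Cells T)" "category (Vert T)" "category (Horz T)"
    by (simp_all add: category_axioms V.category_hom_cat category_Horz_T)
next
  fix x assume x: "x \<in> Arr (Vert T)"
  obtain f \<alpha> g where [simp]: "x = Arrow f \<alpha> g" by (cases x)
  from x have x': "Arrow f \<alpha> g \<in> two_cells" by simp
  show "Dom (Cells T) (Dom (Vert T) x) = Dom (Horz T) x"
    "Dom (Cells T) (Cod (Vert T) x) = Dom (Horz T) x"
    "Cod (Cells T) (Dom (Vert T) x) = Cod (Horz T) x"
    "Cod (Cells T) (Cod (Vert T) x) = Cod (Horz T) x"
    using x' two_cellD[OF x'] by simp_all
next
  fix y x assume yx: "composable (Horz T) y x"
  obtain f \<alpha> f' g \<beta> g' where [simp]: "x = Arrow f \<alpha> f'" "y = Arrow g \<beta> g'"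
    by (cases x; cases y)
  from yx show "Dom (Vert T) (Cmp (Horz T) y x) = Cmp (Cells T) (Dom (Vert T) y) (Dom (Vert T) x)"
    "Cod (Vert T) (Cmp (Horz T) y x) = Cmp (Cells T) (Cod (Vert T) y) (Cod (Vert T) x)"
    by (simp_all add: composable_Horz_T hcomp_two_cell)
next
  fix g f assume "composable (Cells T) g f"
  then have gf: "f \<in> Arr K" "g \<in> Arr K" "Dom K g = Cod K f" by (simp_all add: composable_def)
  then show "Cmp (Horz T) (Idt (Vert T) g) (Idt (Vert T) f) = Idt (Vert T) (Cmp (Cells T) g f)"
    by (simp add: two_cell_iff V.id_in Cmp_1 hcomp_id)
next
  fix y x w z
  assume yx: "composable (Vert T) y x" and wz: "composable (Vert T) w z"
    and zx: "composable (Horz T) z x"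
  obtain f \<alpha> f' \<beta> f'' g \<gamma> g' \<delta> g''
    where xyzw [simp]: "x = Arrow f \<alpha> f'" "y = Arrow f' \<beta> f''" "z = Arrow g \<gamma> g'" "w = Arrow g' \<delta> g''"
    using yx wz by (cases x; cases y; cases z; cases w) (auto simp: composable_hom_cat)
  from yx wz zx have cells: "Arrow f \<alpha> f' \<in> two_cells" "Arrow f' \<beta> f'' \<in> two_cells"
    "Arrow g \<gamma> g' \<in> two_cells" "Arrow g' \<delta> g'' \<in> two_cells"
    and bd: "Dom K g = Cod K f"
    by (simp_all add: composable_hom_cat composable_Horz_T)
  note D = two_cellD[OF cells(1)] two_cellD[OF cells(2)] two_cellD[OF cells(3)] two_cellD[OF cells(4)]
  have "Arrow f (v f f' f'' \<beta> \<alpha>) f'' \<in> two_cells" "Arrow g (v g g' g'' \<delta> \<gamma>) g'' \<in> two_cells"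
    using D by (simp_all add: two_cell_iff V.comp_in)
  then show "Cmp (Horz T) (Cmp (Vert T) w z) (Cmp (Vert T) y x)
      = Cmp (Vert T) (Cmp (Horz T) w y) (Cmp (Horz T) z x)"
    using cells bd D hcomp_two_cell[OF cells(3,1)] hcomp_two_cell[OF cells(4,2)]
    by (simp add: hcomp_vcomp)
qed (simp_all add: Idt_Arr)

end

text \<open>The boundary of the image of a 2-cell is dictated by \<open>F\<close>, so the data of a
  2-functor are a functor on 1-cells and a compatible map of labels. Preservation of horizontal
  identities follows from that of vertical ones, since the former are the vertical identities of
  identity 1-cells.\<close>

lemma two_functor_mk_two_cat:
  assumes "two_cat_data K H i v h" "two_cat_data K' H' i' v' h'" "cfunctor K K' F"
    and \<phi>_in: "\<And>f g \<alpha>. \<lbrakk>f \<in> Arr K; g \<in> Arr K; \<alpha> \<in> H f g\<rbrakk> \<Longrightarrow> \<phi> f g \<alpha> \<in> H' (AMap F f) (AMap F g)"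
    and \<phi>_id: "\<And>f. f \<in> Arr K \<Longrightarrow> \<phi> f f (i f) = i' (AMap F f)"
    and \<phi>_vcomp: "\<And>f g k \<alpha> \<beta>. \<lbrakk>f \<in> Arr K; g \<in> Arr K; k \<in> Arr K; \<alpha> \<in> H f g; \<beta> \<in> H g k\<rbrakk> \<Longrightarrow>
          \<phi> f k (v f g k \<beta> \<alpha>) = v' (AMap F f) (AMap F g) (AMap F k) (\<phi> g k \<beta>) (\<phi> f g \<alpha>)"
    and \<phi>_hcomp: "\<And>f f' \<alpha> g g' \<beta>. \<lbrakk>f \<in> Arr K; f' \<in> Arr K; \<alpha> \<in> H f f'; g \<in> Arr K; g' \<in> Arr K;
            \<beta> \<in> H g g'; Dom K g = Cod K f; Dom K g' = Cod K f'\<rbrakk> \<Longrightarrow>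
          \<phi> (Cmp K g f) (Cmp K g' f') (h (Arrow g \<beta> g') (Arrow f \<alpha> f'))
          = h' (Arrow (AMap F g) (\<phi> g g' \<beta>) (AMap F g')) (Arrow (AMap F f) (\<phi> f f' \<alpha>) (AMap F f'))"
  shows "two_functor (mk_two_cat K H i v h) (mk_two_cat K' H' i' v' h')
    \<lparr> Map0 = OMap F, Map1 = AMap F,
      Map2 = (\<lambda>x\<in>Arr (hom_cat (Arr K) H i v).
        Arrow (AMap F (src x)) (\<phi> (src x) (tgt x) (lab x)) (AMap F (tgt x))) \<rparr>"
    (is "two_functor _ _ \<lparr> Map0 = _, Map1 = _, Map2 = ?\<Phi> \<rparr>")
proof -
  interpret K: two_cat_data K H i v h by fact
  interpret L: two_cat_data K' H' i' v' h' by fact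
  interpret F: cfunctor K K' F by fact
  have bd: "Dom K' (AMap F f) = OMap F (Dom K f)" "Cod K' (AMap F f) = OMap F (Cod K f)" if "f \<in> Arr K" for f
    using F.AMap_hom[OF that] by (simp_all add: hom_def)
  have cmp: "AMap F (Cmp K g f) = Cmp K' (AMap F g) (AMap F f)"
    if "f \<in> Arr K" "g \<in> Arr K" "Dom K g = Cod K f" for f g
    using that F.AMap_Cmp[of g f] by (simp add: composable_def)
  have \<Phi>: "?\<Phi> (Arrow f \<alpha> g) = Arrow (AMap F f) (\<phi> f g \<alpha>) (AMap F g)"
    and \<Phi>_in: "Arrow (AMap F f) (\<phi> f g \<alpha>) (AMap F g) \<in> L.two_cells"
    if "Arrow f \<alpha> g \<in> K.two_cells" for f \<alpha> g
    using that by (simp_all add: K.two_cell_iff L.two_cell_iff F.AMap_Arr \<phi>_in)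
  have F: "\<lparr> OMap = OMap F, AMap = AMap F \<rparr> = F" by simp
  have "cfunctor (hom_cat (Arr K) H i v) (hom_cat (Arr K') H' i' v') \<lparr> OMap = AMap F, AMap = ?\<Phi> \<rparr>"
    (is "cfunctor ?V ?V' ?F")
  proof (intro cfunctor.intro cfunctor_axioms.intro)
    fix x assume x: "x \<in> Arr ?V"
    obtain f \<alpha> g where [simp]: "x = Arrow f \<alpha> g" by (cases x)
    from x show "AMap ?F x \<in> hom ?V' (OMap ?F (Dom ?V x)) (OMap ?F (Cod ?V x))"
      using \<Phi>_in[of f \<alpha> g] by (simp add: hom_def)
  next
    fix y x assume "composable ?V y x"
    moreover obtain f \<alpha> g g' \<beta> k where [simp]: "x = Arrow f \<alpha> g" "y = Arrow g' \<beta> k"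
      by (cases x; cases y)
    ultimately have xy: "Arrow f \<alpha> g \<in> K.two_cells" "Arrow g \<beta> k \<in> K.two_cells" and [simp]: "g' = g"
      by (auto simp: composable_hom_cat)
    have "Arrow f (v f g k \<beta> \<alpha>) k \<in> K.two_cells"
      using K.two_cellD[OF xy(1)] K.two_cellD[OF xy(2)] by (simp add: K.two_cell_iff K.V.comp_in)
    then show "AMap ?F (Cmp ?V y x) = Cmp ?V' (AMap ?F y) (AMap ?F x)"
      using xy K.two_cellD[OF xy(1)] K.two_cellD[OF xy(2)]
      by (simp add: \<Phi>_in \<phi>_vcomp)
  next
    fix f assume f: "f \<in> Obj ?V"
    then have "Arrow f (i f) f \<in> K.two_cells" by (simp add: K.two_cell_iff K.V.id_in)
    then show "AMap ?F (Idt ?V f) = Idt ?V' (OMap ?F f)"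
      using f by (simp add: \<phi>_id F.AMap_Arr)
  qed (simp_all add: K.V.category_hom_cat L.V.category_hom_cat F.AMap_Arr F.AMap_ext)
  moreover have "cfunctor (Horz K.T) (Horz L.T) \<lparr> OMap = OMap F, AMap = ?\<Phi> \<rparr>"
    (is "cfunctor ?V ?V' ?F")
  proof (intro cfunctor.intro cfunctor_axioms.intro)
    fix x assume x: "x \<in> Arr ?V"
    obtain f \<alpha> g where [simp]: "x = Arrow f \<alpha> g" by (cases x)
    from x have x': "Arrow f \<alpha> g \<in> K.two_cells" by simp
    show "AMap ?F x \<in> hom ?V' (OMap ?F (Dom ?V x)) (OMap ?F (Cod ?V x))"
      using x' \<Phi>_in[OF x'] K.two_cellD[OF x'] by (simp add: hom_def bd)
  next
    fix y x assume yx: "composable ?V y x"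
    obtain f \<alpha> f' g \<beta> g' where [simp]: "x = Arrow f \<alpha> f'" "y = Arrow g \<beta> g'"
      by (cases x; cases y)
    from yx have xy: "Arrow f \<alpha> f' \<in> K.two_cells" "Arrow g \<beta> g' \<in> K.two_cells" "Dom K g = Cod K f"
      by (simp_all add: K.composable_Horz_T)
    then show "AMap ?F (Cmp ?V y x) = Cmp ?V' (AMap ?F y) (AMap ?F x)"
      using K.two_cellD[OF xy(1)] K.two_cellD[OF xy(2)]
      by (simp add: \<Phi>_in K.hcomp_two_cell bd cmp \<phi>_hcomp)
  next
    fix X assume X: "X \<in> Obj ?V"
    then have "Arrow (Idt K X) (i (Idt K X)) (Idt K X) \<in> K.two_cells"
      by (simp add: K.two_cell_iff K.V.id_in K.Idt_Arr)
    then show "AMap ?F (Idt ?V X) = Idt ?V' (OMap ?F X)"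
      using X by (simp add: \<phi>_id K.Idt_Arr F.AMap_Idt F.OMap_closed)
  qed (simp_all add: K.category_Horz_T L.category_Horz_T F.OMap_closed F.OMap_ext)
  ultimately show ?thesis
    by (intro two_functor.intro) (simp_all add: K.two_category_T L.two_category_T F F.cfunctor_axioms)
qed

section \<open>The two 2-categories\<close>

abbreviation coslice_cells ::
    "'a set \<Rightarrow> (('a, 'o, 'm) coslice0, ('a, 'o, 'm) coslice1) cat" where
  "coslice_cells A \<equiv> hom_cat (coslice_obj A) (coslice_hom A) (coslice_id A) (coslice_comp A)"

lemma coslice_objD:
  "(C, \<O>) \<in> coslice_obj A \<Longrightarrow> category C \<and> (\<forall>a\<in>A. OMap \<O> a \<in> Obj C)"
  using cfunctor.OMap_closed[of "disc_cat A" C \<O>] by (auto simp: coslice_obj_def disc_cat_def)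

lemma hom_data_coslice:
  fixes A :: "'a set"
  shows "hom_data (coslice_obj A :: ('a, 'o, 'm) coslice0 set) (coslice_hom A) (coslice_id A) (coslice_comp A)"
proof
  fix x :: "('a, 'o, 'm) coslice0" assume x: "x \<in> coslice_obj A"
  obtain C \<O> where [simp]: "x = (C, \<O>)" by (cases x)
  from x show "coslice_id A x \<in> coslice_hom A x x"
    using coslice_objD[of C \<O> A] by (auto simp: cfunctor_fid category.Idt_hom)
next
  fix x y z :: "('a, 'o, 'm) coslice0" and f g
  assume ob: "x \<in> coslice_obj A" "y \<in> coslice_obj A" "z \<in> coslice_obj A"
    and f: "f \<in> coslice_hom A x y" and g: "g \<in> coslice_hom A y z"
  obtain C \<O> D \<P> E \<Q> F \<tau> G \<upsilon>
    where [simp]: "x = (C, \<O>)" "y = (D, \<P>)" "z = (E, \<Q>)" "f = (F, \<tau>)" "g = (G, \<upsilon>)"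
    by (cases x; cases y; cases z; cases f; cases g)
  interpret F: cfunctor C D F using f by simp
  interpret G: cfunctor D E G using g by simp
  have "Cmp E (\<upsilon> a) (AMap G (\<tau> a)) \<in> hom E (OMap G (OMap F (OMap \<O> a))) (OMap \<Q> a)" if "a \<in> A" for a
    by (rule G.D.comp_in_hom[OF _ G.map_in_hom]) (use that f g in auto)
  then show "coslice_comp A x y z g f \<in> coslice_hom A x z"
    using coslice_objD[of C \<O> A] ob
    by (auto intro: cfunctor_fcomp F.cfunctor_axioms G.cfunctor_axioms)
next
  fix x y :: "('a, 'o, 'm) coslice0" and f
  assume ob: "x \<in> coslice_obj A" "y \<in> coslice_obj A" and f: "f \<in> coslice_hom A x y"
  obtain C \<O> D \<P> F \<tau> where [simp]: "x = (C, \<O>)" "y = (D, \<P>)" "f = (F, \<tau>)"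
    by (cases x; cases y; cases f)
  interpret F: cfunctor C D F using f by simp
  have \<tau>: "\<tau> a \<in> hom D (OMap F (OMap \<O> a)) (OMap \<P> a)" "OMap \<O> a \<in> Obj C" if "a \<in> A" for a
    using f that coslice_objD[of C \<O> A] ob by auto
  \<comment> \<open>Composition of 1-cells returns a family cut down to \<open>A\<close>; the unit
    laws hold as equations because \<open>\<tau>\<close> is itself \<open>undefined\<close> outside
    \<open>A\<close>.\<close>
  have "\<tau> \<in> extensional A" using f by (simp add: PiE_def)
  then have "(\<lambda>a\<in>A. \<tau> a) = \<tau>" by (rule extensional_restrict)
  moreover have "(\<lambda>a\<in>A. Cmp D ((\<lambda>a\<in>A. Idt D (OMap \<P> a)) a) (AMap (fid D) (\<tau> a))) = (\<lambda>a\<in>A. \<tau> a)"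
    using \<tau> by (intro restrict_ext) (simp add: F.D.comp_id_left[OF \<tau>(1)] hom_ArrD[OF \<tau>(1)])
  moreover have "(\<lambda>a\<in>A. Cmp D (\<tau> a) (AMap F ((\<lambda>a\<in>A. Idt C (OMap \<O> a)) a))) = (\<lambda>a\<in>A. \<tau> a)"
    using \<tau> by (intro restrict_ext) (simp add: F.AMap_Idt F.D.comp_id_right[OF \<tau>(1)])
  ultimately show "coslice_comp A x y y (coslice_id A y) f = f" "coslice_comp A x x y f (coslice_id A x) = f"
    by (simp_all add: fcomp_fid_left[OF F.cfunctor_axioms] fcomp_fid_right[OF F.cfunctor_axioms])
next
  fix x y z w :: "('a, 'o, 'm) coslice0" and f g h
  assume ob: "x \<in> coslice_obj A" "y \<in> coslice_obj A" "z \<in> coslice_obj A" "w \<in> coslice_obj A"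
    and f: "f \<in> coslice_hom A x y" and g: "g \<in> coslice_hom A y z" and h: "h \<in> coslice_hom A z w"
  obtain C \<O> D \<P> E \<Q> B \<R> F \<tau> G \<upsilon> H \<sigma>
    where [simp]: "x = (C, \<O>)" "y = (D, \<P>)" "z = (E, \<Q>)" "w = (B, \<R>)"
      "f = (F, \<tau>)" "g = (G, \<upsilon>)" "h = (H, \<sigma>)"
    by (cases x; cases y; cases z; cases w; cases f; cases g; cases h)
  interpret F: cfunctor C D F using f by simp
  interpret G: cfunctor D E G using g by simp
  interpret H: cfunctor E B H using h by simp
  have "Cmp B (\<sigma> a) (AMap H (Cmp E (\<upsilon> a) (AMap G (\<tau> a))))
      = Cmp B (Cmp B (\<sigma> a) (AMap H (\<upsilon> a))) (AMap (fcomp D H G) (\<tau> a))" if "a \<in> A" for a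
  proof -
    from that f g h have \<tau>: "\<tau> a \<in> hom D (OMap F (OMap \<O> a)) (OMap \<P> a)"
      and \<upsilon>: "\<upsilon> a \<in> hom E (OMap G (OMap \<P> a)) (OMap \<Q> a)"
      and \<sigma>: "\<sigma> a \<in> hom B (OMap H (OMap \<Q> a)) (OMap \<R> a)"
      by auto
    note G\<tau> = G.map_in_hom[OF \<tau>]
    show ?thesis
      using H.D.comp_assoc[OF \<sigma> H.map_in_hom[OF \<upsilon>] H.map_in_hom[OF G\<tau>]]
      by (simp add: H.map_comp[OF \<upsilon> G\<tau>] hom_ArrD[OF \<tau>])
  qed
  then show "coslice_comp A x z w h (coslice_comp A x y z g f)
      = coslice_comp A x y w (coslice_comp A y z w h g) f"
    by (auto simp: fcomp_assoc[OF F.cfunctor_axioms G.cfunctor_axioms H.cfunctor_axioms]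
        intro!: restrict_ext)
qed

text \<open>\<open>coslice_hom2\<close> forces the two 1-cells to share their 0-cells, so a 2-cell
  can be unpacked with one common pair of endpoints; this is also what yields
  \<open>parallel\<close>.\<close>

lemma coslice_2cellE:
  assumes "\<alpha> \<in> coslice_hom2 A f g"
  obtains C \<O> D \<P> F \<tau> G \<upsilon> where "f = Arrow (C, \<O>) (F, \<tau>) (D, \<P>)" "g = Arrow (C, \<O>) (G, \<upsilon>) (D, \<P>)"
    "nat_trans C D F G \<alpha>" "\<And>a. a \<in> A \<Longrightarrow> Cmp D (\<upsilon> a) (\<alpha> (OMap \<O> a)) = \<tau> a"
proof -
  obtain C \<O> D \<P> F \<tau> X G \<upsilon> Y where "f = Arrow (C, \<O>) (F, \<tau>) (D, \<P>)" "g = Arrow X (G, \<upsilon>) Y"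
    by (metis arrow.exhaust surj_pair)
  with assms show thesis by (auto intro!: that)
qed

lemma coslice_cells_Arr:
  "Arrow (C, \<O>) (F, \<tau>) (D, \<P>) \<in> Arr (coslice_cells A) \<longleftrightarrow>
    cfunctor (disc_cat A) C \<O> \<and> cfunctor (disc_cat A) D \<P> \<and> cfunctor C D F \<and>
    \<tau> \<in> (\<Pi>\<^sub>E a\<in>A. hom D (OMap F (OMap \<O> a)) (OMap \<P> a))"
  by (auto simp: Arr_hom_cat coslice_obj_def cfunctor_def)

lemma coslice_1cellE:
  obtains C \<O> D \<P> F \<tau> where "f = Arrow (C, \<O>) (F, \<tau>) (D, \<P>)"
  by (metis arrow.exhaust surj_pair)

lemma coslice_cellsD:
  assumes "Arrow (C, \<O>) (F, \<tau>) (D, \<P>) \<in> Arr (coslice_cells A)" "a \<in> A"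
  shows "OMap \<O> a \<in> Obj C" "OMap \<P> a \<in> Obj D" "\<tau> a \<in> hom D (OMap F (OMap \<O> a)) (OMap \<P> a)"
  using assms coslice_objD[of C \<O> A] coslice_objD[of D \<P> A] by (auto simp: Arr_hom_cat)

text \<open>Unit, associativity and interchange laws are those of natural transformations. What is
  specific is that the triangle condition holds for identities and survives both
  compositions.\<close>

lemma two_cat_data_coslice:
  fixes A :: "'a set"
  shows "two_cat_data (coslice_cells A :: (('a, 'o, 'm) coslice0, ('a, 'o, 'm) coslice1) cat)
    (coslice_hom2 A) coslice_id2 coslice_vcomp coslice_hcomp"
proof (intro two_cat_data.intro two_cat_data_axioms.intro)
  let ?K = "coslice_cells A :: (('a, 'o, 'm) coslice0, ('a, 'o, 'm) coslice1) cat"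
  interpret K: category ?K by (rule hom_data.category_hom_cat[OF hom_data_coslice])
  show "category ?K" by (rule K.category_axioms)
  show "hom_data (Arr ?K) (coslice_hom2 A) coslice_id2 coslice_vcomp"
  proof
    fix f assume f: "f \<in> Arr ?K"
    obtain C \<O> D \<P> F \<tau> where [simp]: "f = Arrow (C, \<O>) (F, \<tau>) (D, \<P>)" by (rule coslice_1cellE)
    interpret F: cfunctor C D F using f by (simp add: coslice_cells_Arr)
    have "Cmp D (\<tau> a) (nid C D F (OMap \<O> a)) = \<tau> a" if "a \<in> A" for a
      using coslice_cellsD[OF f[simplified] that] by (simp add: nid_def F.D.comp_id_right)
    then show "coslice_id2 f \<in> coslice_hom2 A f f"
      by (simp add: nat_trans_nid F.cfunctor_axioms)
  next
    fix f g k :: "('a, 'o, 'm) coslice1" and \<alpha> \<beta>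
    assume f: "f \<in> Arr ?K" "g \<in> Arr ?K" "k \<in> Arr ?K"
      and \<alpha>: "\<alpha> \<in> coslice_hom2 A f g" and \<beta>: "\<beta> \<in> coslice_hom2 A g k"
    from \<alpha> obtain C \<O> D \<P> F \<tau> G \<upsilon> where
        fg [simp]: "f = Arrow (C, \<O>) (F, \<tau>) (D, \<P>)" "g = Arrow (C, \<O>) (G, \<upsilon>) (D, \<P>)"
        and a: "nat_trans C D F G \<alpha>" "\<And>a. a \<in> A \<Longrightarrow> Cmp D (\<upsilon> a) (\<alpha> (OMap \<O> a)) = \<tau> a"
      by (rule coslice_2cellE) blast
    from \<beta> fg obtain H \<sigma> where k [simp]: "k = Arrow (C, \<O>) (H, \<sigma>) (D, \<P>)"
        and b: "nat_trans C D G H \<beta>" "\<And>a. a \<in> A \<Longrightarrow> Cmp D (\<sigma> a) (\<beta> (OMap \<O> a)) = \<upsilon> a"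
      by (auto elim!: coslice_2cellE)
    interpret a: nat_trans C D F G \<alpha> by fact
    interpret b: nat_trans C D G H \<beta> by fact
    \<comment> \<open>The triangles compose: \<open>\<sigma>\<close> after \<open>\<beta>\<close> is
      \<open>\<upsilon>\<close>, and \<open>\<upsilon>\<close> after \<open>\<alpha>\<close> is
      \<open>\<tau>\<close>.\<close>
    have "Cmp D (\<sigma> a) (vcomp C D \<beta> \<alpha> (OMap \<O> a)) = \<tau> a" if "a \<in> A" for a
    proof -
      note k' = coslice_cellsD[OF f(3)[simplified k] that]
      show ?thesis
        using k'(1) a.F.D.comp_assoc[OF k'(3) b.component[OF k'(1)] a.component[OF k'(1)]]
        by (simp add: vcomp_def a(2)[OF that] b(2)[OF that])
    qed
    then show "coslice_vcomp f g k \<beta> \<alpha> \<in> coslice_hom2 A f k"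
      using nat_trans_vcomp[OF a(1) b(1)] by simp
  next
    fix f g :: "('a, 'o, 'm) coslice1" and \<alpha>
    assume "\<alpha> \<in> coslice_hom2 A f g"
    then show "coslice_vcomp f g g (coslice_id2 g) \<alpha> = \<alpha>" "coslice_vcomp f f g \<alpha> (coslice_id2 f) = \<alpha>"
      by (auto elim!: coslice_2cellE intro: vcomp_nid_left vcomp_nid_right)
  next
    fix f g k l :: "('a, 'o, 'm) coslice1" and \<alpha> \<beta> \<gamma>
    assume "\<alpha> \<in> coslice_hom2 A f g" "\<beta> \<in> coslice_hom2 A g k" "\<gamma> \<in> coslice_hom2 A k l"
    then show "coslice_vcomp f k l \<gamma> (coslice_vcomp f g k \<beta> \<alpha>)
        = coslice_vcomp f g l (coslice_vcomp g k l \<gamma> \<beta>) \<alpha>"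
      by (auto elim!: coslice_2cellE intro: vcomp_assoc[symmetric])
  qed
next
  let ?K = "coslice_cells A :: (('a, 'o, 'm) coslice0, ('a, 'o, 'm) coslice1) cat"
  fix f g :: "('a, 'o, 'm) coslice1" and \<alpha>
  assume "f \<in> Arr ?K" "g \<in> Arr ?K" "\<alpha> \<in> coslice_hom2 A f g"
  then show "Dom ?K g = Dom ?K f \<and> Cod ?K g = Cod ?K f"
    by (auto elim!: coslice_2cellE)
next
  let ?K = "coslice_cells A :: (('a, 'o, 'm) coslice0, ('a, 'o, 'm) coslice1) cat"
  fix f f' g g' :: "('a, 'o, 'm) coslice1" and \<alpha> \<beta>
  assume cells: "f \<in> Arr ?K" "f' \<in> Arr ?K" "g \<in> Arr ?K" "g' \<in> Arr ?K"
    and \<alpha>: "\<alpha> \<in> coslice_hom2 A f f'" and \<beta>: "\<beta> \<in> coslice_hom2 A g g'" and bd: "Dom ?K g = Cod ?K f"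
  from \<alpha> obtain C \<O> D \<P> F \<tau> G \<upsilon> where
      f [simp]: "f = Arrow (C, \<O>) (F, \<tau>) (D, \<P>)" "f' = Arrow (C, \<O>) (G, \<upsilon>) (D, \<P>)"
      and a: "nat_trans C D F G \<alpha>" "\<And>a. a \<in> A \<Longrightarrow> Cmp D (\<upsilon> a) (\<alpha> (OMap \<O> a)) = \<tau> a"
    by (rule coslice_2cellE) blast
  from \<beta> bd cells(1,3) obtain E \<Q> H \<sigma> K \<rho> where
      g [simp]: "g = Arrow (D, \<P>) (H, \<sigma>) (E, \<Q>)" "g' = Arrow (D, \<P>) (K, \<rho>) (E, \<Q>)"
      and b: "nat_trans D E H K \<beta>" "\<And>a. a \<in> A \<Longrightarrow> Cmp E (\<rho> a) (\<beta> (OMap \<P> a)) = \<sigma> a"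
    by (auto elim!: coslice_2cellE)
  interpret a: nat_trans C D F G \<alpha> by fact
  interpret b: nat_trans D E H K \<beta> by fact
  \<comment> \<open>Naturality of \<open>\<beta>\<close> at \<open>\<upsilon> a\<close> moves its
    component to the object \<open>OMap \<P> a\<close>, where the triangle of \<open>\<beta>\<close>
    applies; the remaining factor is \<open>H\<close> applied to the triangle of
    \<open>\<alpha>\<close>.\<close>
  have "Cmp E (Cmp E (\<rho> a) (AMap K (\<upsilon> a))) (hcomp C E H G \<beta> \<alpha> (OMap \<O> a)) = Cmp E (\<sigma> a) (AMap H (\<tau> a))"
    if "a \<in> A" for a
  proof -
    note f' = coslice_cellsD[OF cells(2)[simplified f] that]
      and g' = coslice_cellsD[OF cells(4)[simplified g] that]
    note aO = a.component[OF f'(1)] and assoc = b.F.D.comp_assoc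
    note bGO = b.component[OF a.G.OMap_closed[OF f'(1)]] and bP = b.component[OF f'(2)]
    note K\<upsilon> = b.G.map_in_hom[OF f'(3)] and H\<upsilon> = b.F.map_in_hom[OF f'(3)] and HaO = b.F.map_in_hom[OF aO]
    let ?b = "\<beta> (OMap G (OMap \<O> a))" and ?Ha = "AMap H (\<alpha> (OMap \<O> a))"
    have "Cmp E (Cmp E (\<rho> a) (AMap K (\<upsilon> a))) (Cmp E ?b ?Ha) = Cmp E (\<rho> a) (Cmp E (Cmp E (AMap K (\<upsilon> a)) ?b) ?Ha)"
      using b.F.D.comp_in_hom[OF bGO HaO]
      by (simp add: assoc[OF g'(3) K\<upsilon>] assoc[OF K\<upsilon> bGO HaO])
    also have "\<dots> = Cmp E (\<rho> a) (Cmp E (Cmp E (\<beta> (OMap \<P> a)) (AMap H (\<upsilon> a))) ?Ha)"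
      by (simp add: b.natural[OF f'(3)])
    also have "\<dots> = Cmp E (Cmp E (\<rho> a) (\<beta> (OMap \<P> a))) (Cmp E (AMap H (\<upsilon> a)) ?Ha)"
      by (simp add: assoc[OF g'(3) bP b.F.D.comp_in_hom[OF H\<upsilon> HaO]] assoc[OF bP H\<upsilon> HaO])
    also have "\<dots> = Cmp E (\<sigma> a) (AMap H (\<tau> a))"
      using a(2)[OF that] b.F.map_comp[OF f'(3) aO] by (simp add: b(2)[OF that])
    finally show ?thesis
      using f'(1) by (simp add: hcomp_def)
  qed
  then show "coslice_hcomp (Arrow g \<beta> g') (Arrow f \<alpha> f') \<in> coslice_hom2 A (Cmp ?K g f) (Cmp ?K g' f')"
    using nat_trans_hcomp[OF a(1) b(1)] cells by simp
next
  let ?K = "coslice_cells A :: (('a, 'o, 'm) coslice0, ('a, 'o, 'm) coslice1) cat"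
  fix f f' e :: "('a, 'o, 'm) coslice1" and \<alpha>
  assume f: "f \<in> Arr ?K" and \<alpha>: "\<alpha> \<in> coslice_hom2 A f f'"
  have ob: "src f \<in> coslice_obj A" "tgt f \<in> coslice_obj A" using f by (simp_all add: Arr_hom_cat)
  show "coslice_hcomp (Arrow e (coslice_id2 e) e) (Arrow f \<alpha> f') = \<alpha>" if "e = Idt ?K (Cod ?K f)"
    using \<alpha> ob f that by (auto elim!: coslice_2cellE intro: hcomp_nid_left)
  show "coslice_hcomp (Arrow f \<alpha> f') (Arrow e (coslice_id2 e) e) = \<alpha>" if "e = Idt ?K (Dom ?K f)"
    using \<alpha> ob f that by (auto elim!: coslice_2cellE intro: hcomp_nid_right)
next
  let ?K = "coslice_cells A :: (('a, 'o, 'm) coslice0, ('a, 'o, 'm) coslice1) cat"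
  fix f f' g g' k k' :: "('a, 'o, 'm) coslice1" and \<alpha> \<beta> \<gamma>
  assume cells: "f \<in> Arr ?K" "f' \<in> Arr ?K" "g \<in> Arr ?K" "g' \<in> Arr ?K" "k \<in> Arr ?K" "k' \<in> Arr ?K"
    and \<alpha>: "\<alpha> \<in> coslice_hom2 A f f'" and \<beta>: "\<beta> \<in> coslice_hom2 A g g'" and \<gamma>: "\<gamma> \<in> coslice_hom2 A k k'"
    and bd: "Dom ?K g = Cod ?K f" "Dom ?K k = Cod ?K g"
  then show "coslice_hcomp (Arrow k \<gamma> k')
        (Arrow (Cmp ?K g f) (coslice_hcomp (Arrow g \<beta> g') (Arrow f \<alpha> f')) (Cmp ?K g' f'))
      = coslice_hcomp (Arrow (Cmp ?K k g) (coslice_hcomp (Arrow k \<gamma> k') (Arrow g \<beta> g')) (Cmp ?K k' g'))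
        (Arrow f \<alpha> f')"
    by (auto elim!: coslice_2cellE intro: hcomp_assoc)
next
  let ?K = "coslice_cells A :: (('a, 'o, 'm) coslice0, ('a, 'o, 'm) coslice1) cat"
  fix f g assume "f \<in> Arr ?K" "g \<in> Arr ?K" "Dom ?K g = Cod ?K f"
  then show "coslice_hcomp (Arrow g (coslice_id2 g) g) (Arrow f (coslice_id2 f) f) = coslice_id2 (Cmp ?K g f)"
    by (cases f rule: coslice_1cellE; cases g rule: coslice_1cellE)
      (auto simp: coslice_cells_Arr intro: hcomp_nid_nid)
next
  let ?K = "coslice_cells A :: (('a, 'o, 'm) coslice0, ('a, 'o, 'm) coslice1) cat"
  fix f f' f'' g g' g'' :: "('a, 'o, 'm) coslice1" and \<alpha> \<beta> \<gamma> \<delta>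
  assume cells: "f \<in> Arr ?K" "f' \<in> Arr ?K" "f'' \<in> Arr ?K" "g \<in> Arr ?K" "g' \<in> Arr ?K" "g'' \<in> Arr ?K"
    and "\<alpha> \<in> coslice_hom2 A f f'" "\<beta> \<in> coslice_hom2 A f' f''"
      "\<gamma> \<in> coslice_hom2 A g g'" "\<delta> \<in> coslice_hom2 A g' g''" "Dom ?K g = Cod ?K f"
  then show "coslice_hcomp (Arrow g (coslice_vcomp g g' g'' \<delta> \<gamma>) g'') (Arrow f (coslice_vcomp f f' f'' \<beta> \<alpha>) f'')
      = coslice_vcomp (Cmp ?K g f) (Cmp ?K g' f') (Cmp ?K g'' f'')
          (coslice_hcomp (Arrow g' \<delta> g'') (Arrow f' \<beta> f'')) (coslice_hcomp (Arrow g \<gamma> g') (Arrow f \<alpha> f'))"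
    by (auto elim!: coslice_2cellE intro: hcomp_interchange)
qed

section \<open>The 2-category of fibrations of complete lattices\<close>

abbreviation clat_cells :: "(('e, 'f, 'o, 'm) clat0, ('e, 'f, 'o, 'm) clat1) cat" where
  "clat_cells \<equiv> hom_cat clat_obj clat_hom clat_id clat_comp"

lemma clat_objD: "(E, B, p) \<in> clat_obj \<Longrightarrow> cfunctor E B p"
  by (simp add: clat_obj_def clat_fibration.axioms(1))

lemma fcomp_OMapD: "fcomp E q F' = fcomp E F p \<Longrightarrow> P \<in> Obj E \<Longrightarrow> OMap q (OMap F' P) = OMap F (OMap p P)"
  by (metis OMap_fcomp)

lemma fcomp_AMapD: "fcomp E q F' = fcomp E F p \<Longrightarrow> g \<in> Arr E \<Longrightarrow> AMap q (AMap F' g) = AMap F (AMap p g)"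
  by (metis AMap_fcomp)

lemma hom_data_clat: "hom_data clat_obj clat_hom clat_id clat_comp"
proof
  fix x :: "('e, 'f, 'o, 'm) clat0" assume x: "x \<in> clat_obj"
  obtain E B p where [simp]: "x = (E, B, p)" by (cases x)
  interpret p: cfunctor E B p using x by (simp add: clat_objD)
  show "clat_id x \<in> clat_hom x x"
    by (simp add: cfunctor_fid p.C.category_axioms p.D.category_axioms
        fcomp_fid_left[OF p.cfunctor_axioms] fcomp_fid_right[OF p.cfunctor_axioms])
next
  fix x y z :: "('e, 'f, 'o, 'm) clat0" and f g
  assume ob: "x \<in> clat_obj" "y \<in> clat_obj" "z \<in> clat_obj"
    and f: "f \<in> clat_hom x y" and g: "g \<in> clat_hom y z"
  obtain E B p E' B' q E'' B'' r F F' G G'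
    where [simp]: "x = (E, B, p)" "y = (E', B', q)" "z = (E'', B'', r)" "f = (F, F')" "g = (G, G')"
    by (metis prod_cases3 surj_pair)
  from ob have p: "cfunctor E B p" and q: "cfunctor E' B' q" and r: "cfunctor E'' B'' r"
    by (simp_all add: clat_objD)
  from f g have F: "cfunctor B B' F" "cfunctor E E' F'" "fcomp E q F' = fcomp E F p"
    and G: "cfunctor B' B'' G" "cfunctor E' E'' G'" "fcomp E' r G' = fcomp E' G q"
    by simp_all
  \<comment> \<open>Pasting of the two commuting squares: r G' F' = G q F' = G F p.\<close>
  have "fcomp E r (fcomp E G' F') = fcomp E (fcomp E' G q) F'"
    by (simp add: fcomp_assoc[OF F(2) G(2) r, symmetric] G)
  also have "\<dots> = fcomp E (fcomp B G F) p"
    by (simp add: fcomp_assoc[OF F(2) q G(1)] F fcomp_assoc[OF p F(1) G(1)])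
  finally show "clat_comp x y z g f \<in> clat_hom x z"
    using cfunctor_fcomp[OF F(1) G(1)] cfunctor_fcomp[OF F(2) G(2)] by simp
next
  fix x y z w :: "('e, 'f, 'o, 'm) clat0" and f g h
  assume f: "f \<in> clat_hom x y" and g: "g \<in> clat_hom y z" and h: "h \<in> clat_hom z w"
  obtain E B p E' B' q E'' B'' r E3 B3 s F F' G G' H H'
    where [simp]: "x = (E, B, p)" "y = (E', B', q)" "z = (E'', B'', r)" "w = (E3, B3, s)"
      "f = (F, F')" "g = (G, G')" "h = (H, H')"
    by (metis prod_cases3 surj_pair)
  from f g h show "clat_comp x z w h (clat_comp x y z g f) = clat_comp x y w (clat_comp y z w h g) f"
    by (auto intro: fcomp_assoc[symmetric])
next
  fix x y :: "('e, 'f, 'o, 'm) clat0" and f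
  assume f: "f \<in> clat_hom x y"
  obtain E B p E' B' q F F' where [simp]: "x = (E, B, p)" "y = (E', B', q)" "f = (F, F')"
    by (metis prod_cases3 surj_pair)
  from f show "clat_comp x y y (clat_id y) f = f" "clat_comp x x y f (clat_id x) = f"
    by (auto intro: fcomp_fid_left fcomp_fid_right)
qed

lemma clat_2cellE:
  assumes "\<alpha> \<in> clat_hom2 f g"
  obtains E B p F F' E' B' q G G' a a' where "f = Arrow (E, B, p) (F, F') (E', B', q)"
    "g = Arrow (E, B, p) (G, G') (E', B', q)" "\<alpha> = (a, a')"
    "nat_trans B B' F G a" "nat_trans E E' F' G' a'" "\<And>P. P \<in> Obj E \<Longrightarrow> AMap q (a' P) = a (OMap p P)"
proof -
  obtain E B p F F' E' B' q X G G' Y a a' where "f = Arrow (E, B, p) (F, F') (E', B', q)"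
      "g = Arrow X (G, G') Y" "\<alpha> = (a, a')"
    by (metis arrow.exhaust prod_cases3 surj_pair)
  with assms show thesis by (auto intro!: that)
qed

lemma clat_1cellE:
  obtains E B p F F' E' B' q where "f = Arrow (E, B, p) (F, F') (E', B', q)"
  by (metis arrow.exhaust prod_cases3 surj_pair)

lemma clat_cellsD:
  "Arrow (E, B, p) (F, F') (E', B', q) \<in> Arr clat_cells \<Longrightarrow>
    cfunctor E B p \<and> cfunctor E' B' q \<and> cfunctor B B' F \<and> cfunctor E E' F' \<and> fcomp E q F' = fcomp E F p"
  by (simp add: Arr_hom_cat clat_objD)

lemma two_cat_data_clat:
  "two_cat_data (clat_cells :: (('e, 'f, 'o, 'm) clat0, ('e, 'f, 'o, 'm) clat1) cat)
    clat_hom2 clat_id2 clat_vcomp clat_hcomp"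
proof (intro two_cat_data.intro two_cat_data_axioms.intro)
  let ?K = "clat_cells :: (('e, 'f, 'o, 'm) clat0, ('e, 'f, 'o, 'm) clat1) cat"
  show "category ?K" by (rule hom_data.category_hom_cat[OF hom_data_clat])
  show "hom_data (Arr ?K) clat_hom2 clat_id2 clat_vcomp"
  proof
    fix f assume f: "f \<in> Arr ?K"
    obtain E B p F F' E' B' q where fd [simp]: "f = Arrow (E, B, p) (F, F') (E', B', q)"
      by (rule clat_1cellE)
    have *: "cfunctor E B p" "cfunctor E' B' q" "cfunctor B B' F" "cfunctor E E' F'"
      "fcomp E q F' = fcomp E F p"
      using clat_cellsD[OF f[unfolded fd]] by simp_all
    have "AMap q (nid E E' F' P) = nid B B' F (OMap p P)" if "P \<in> Obj E" for P
      using that by (simp add: nid_def cfunctor.OMap_closed[OF *(1)] cfunctor.OMap_closed[OF *(4)]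
          cfunctor.AMap_Idt[OF *(2)] fcomp_OMapD[OF *(5)])
    with * show "clat_id2 f \<in> clat_hom2 f f"
      by (simp add: nat_trans_nid)
  next
    fix f g k :: "('e, 'f, 'o, 'm) clat1" and \<alpha> \<beta>
    assume f: "f \<in> Arr ?K" "g \<in> Arr ?K" "k \<in> Arr ?K"
      and \<alpha>: "\<alpha> \<in> clat_hom2 f g" and \<beta>: "\<beta> \<in> clat_hom2 g k"
    from \<alpha> obtain E B p F F' E' B' q G G' a a' where
        fg [simp]: "f = Arrow (E, B, p) (F, F') (E', B', q)" "g = Arrow (E, B, p) (G, G') (E', B', q)"
        "\<alpha> = (a, a')"
        and a: "nat_trans B B' F G a" "nat_trans E E' F' G' a'" "\<And>P. P \<in> Obj E \<Longrightarrow> AMap q (a' P) = a (OMap p P)"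
      by (rule clat_2cellE) blast
    from \<beta> obtain H H' b b' where
        k [simp]: "k = Arrow (E, B, p) (H, H') (E', B', q)" "\<beta> = (b, b')"
        and b: "nat_trans B B' G H b" "nat_trans E E' G' H' b'" "\<And>P. P \<in> Obj E \<Longrightarrow> AMap q (b' P) = b (OMap p P)"
      by (auto elim!: clat_2cellE)
    interpret p: cfunctor E B p using clat_cellsD[OF f(1)[unfolded fg]] by simp
    interpret q: cfunctor E' B' q using clat_cellsD[OF f(1)[unfolded fg]] by simp
    have "AMap q (vcomp E E' b' a' P) = vcomp B B' b a (OMap p P)" if "P \<in> Obj E" for P
      using that q.map_comp[OF nat_trans.component[OF b(2)] nat_trans.component[OF a(2)], of P]
      by (simp add: vcomp_def a b p.OMap_closed)
    then show "clat_vcomp f g k \<beta> \<alpha> \<in> clat_hom2 f k"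
      using nat_trans_vcomp[OF a(1) b(1)] nat_trans_vcomp[OF a(2) b(2)] by simp
  next
    fix f g :: "('e, 'f, 'o, 'm) clat1" and \<alpha>
    assume "\<alpha> \<in> clat_hom2 f g"
    then show "clat_vcomp f g g (clat_id2 g) \<alpha> = \<alpha>" "clat_vcomp f f g \<alpha> (clat_id2 f) = \<alpha>"
      by (auto elim!: clat_2cellE intro: vcomp_nid_left vcomp_nid_right)
  next
    fix f g k l :: "('e, 'f, 'o, 'm) clat1" and \<alpha> \<beta> \<gamma>
    assume "\<alpha> \<in> clat_hom2 f g" "\<beta> \<in> clat_hom2 g k" "\<gamma> \<in> clat_hom2 k l"
    then show "clat_vcomp f k l \<gamma> (clat_vcomp f g k \<beta> \<alpha>)
        = clat_vcomp f g l (clat_vcomp g k l \<gamma> \<beta>) \<alpha>"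
      by (auto elim!: clat_2cellE intro: vcomp_assoc[symmetric])
  qed
next
  let ?K = "clat_cells :: (('e, 'f, 'o, 'm) clat0, ('e, 'f, 'o, 'm) clat1) cat"
  fix f g :: "('e, 'f, 'o, 'm) clat1" and \<alpha>
  assume "f \<in> Arr ?K" "g \<in> Arr ?K" "\<alpha> \<in> clat_hom2 f g"
  then show "Dom ?K g = Dom ?K f \<and> Cod ?K g = Cod ?K f"
    by (auto elim!: clat_2cellE)
next
  let ?K = "clat_cells :: (('e, 'f, 'o, 'm) clat0, ('e, 'f, 'o, 'm) clat1) cat"
  fix f f' g g' :: "('e, 'f, 'o, 'm) clat1" and \<alpha> \<beta>
  assume cells: "f \<in> Arr ?K" "f' \<in> Arr ?K" "g \<in> Arr ?K" "g' \<in> Arr ?K"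
    and \<alpha>: "\<alpha> \<in> clat_hom2 f f'" and \<beta>: "\<beta> \<in> clat_hom2 g g'" and bd: "Dom ?K g = Cod ?K f"
  from \<alpha> obtain E B p F F' E' B' q G G' a a' where
      f [simp]: "f = Arrow (E, B, p) (F, F') (E', B', q)" "f' = Arrow (E, B, p) (G, G') (E', B', q)"
      "\<alpha> = (a, a')"
      and a: "nat_trans B B' F G a" "nat_trans E E' F' G' a'" "\<And>P. P \<in> Obj E \<Longrightarrow> AMap q (a' P) = a (OMap p P)"
    by (rule clat_2cellE) blast
  from \<beta> bd cells(1,3) obtain E'' B'' r H H' K K' b b' where
      g [simp]: "g = Arrow (E', B', q) (H, H') (E'', B'', r)" "g' = Arrow (E', B', q) (K, K') (E'', B'', r)"
      "\<beta> = (b, b')"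
      and b: "nat_trans B' B'' H K b" "nat_trans E' E'' H' K' b'" "\<And>P. P \<in> Obj E' \<Longrightarrow> AMap r (b' P) = b (OMap q P)"
    by (auto elim!: clat_2cellE)
  interpret p: cfunctor E B p using clat_cellsD[OF cells(1)[unfolded f]] by simp
  interpret r: cfunctor E'' B'' r using clat_cellsD[OF cells(3)[unfolded g]] by simp
  interpret a: nat_trans E E' F' G' a' by fact
  interpret b: nat_trans E' E'' H' K' b' by fact
  \<comment> \<open>\<open>hcomp\<close> mixes the target of the first 2-cell with the source of the
    second, so the squares needed are those of \<open>G'\<close> and \<open>H'\<close>: one gives
    the base of the object \<open>OMap G' P\<close>, the other the base of the arrow
    \<open>AMap H' (a' P)\<close>.\<close>
  have sq: "fcomp E q G' = fcomp E G p" "fcomp E' r H' = fcomp E' H q"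
    using clat_cellsD[OF cells(2)[unfolded f]] clat_cellsD[OF cells(3)[unfolded g]] by simp_all
  have "AMap r (hcomp E E'' H' G' b' a' P) = hcomp B B'' H G b a (OMap p P)" if P: "P \<in> Obj E" for P
    using r.map_comp[OF b.component[OF a.G.OMap_closed[OF P]] b.F.map_in_hom[OF a.component[OF P]]]
    by (simp add: hcomp_def P p.OMap_closed b a a.G.OMap_closed fcomp_OMapD[OF sq(1)]
        fcomp_AMapD[OF sq(2)] hom_ArrD[OF a.component[OF P]])
  then show "clat_hcomp (Arrow g \<beta> g') (Arrow f \<alpha> f') \<in> clat_hom2 (Cmp ?K g f) (Cmp ?K g' f')"
    using nat_trans_hcomp[OF a(1) b(1)] nat_trans_hcomp[OF a(2) b(2)] cells by simp
next
  let ?K = "clat_cells :: (('e, 'f, 'o, 'm) clat0, ('e, 'f, 'o, 'm) clat1) cat"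
  fix f f' e :: "('e, 'f, 'o, 'm) clat1" and \<alpha>
  assume f: "f \<in> Arr ?K" and \<alpha>: "\<alpha> \<in> clat_hom2 f f'"
  have ob: "src f \<in> clat_obj" "tgt f \<in> clat_obj" using f by (simp_all add: Arr_hom_cat)
  show "clat_hcomp (Arrow e (clat_id2 e) e) (Arrow f \<alpha> f') = \<alpha>" if "e = Idt ?K (Cod ?K f)"
    using \<alpha> ob f that by (auto elim!: clat_2cellE intro: hcomp_nid_left)
  show "clat_hcomp (Arrow f \<alpha> f') (Arrow e (clat_id2 e) e) = \<alpha>" if "e = Idt ?K (Dom ?K f)"
    using \<alpha> ob f that by (auto elim!: clat_2cellE intro: hcomp_nid_right)
next
  let ?K = "clat_cells :: (('e, 'f, 'o, 'm) clat0, ('e, 'f, 'o, 'm) clat1) cat"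
  fix f f' g g' k k' :: "('e, 'f, 'o, 'm) clat1" and \<alpha> \<beta> \<gamma>
  assume "f \<in> Arr ?K" "f' \<in> Arr ?K" "g \<in> Arr ?K" "g' \<in> Arr ?K" "k \<in> Arr ?K" "k' \<in> Arr ?K"
    "\<alpha> \<in> clat_hom2 f f'" "\<beta> \<in> clat_hom2 g g'" "\<gamma> \<in> clat_hom2 k k'"
    "Dom ?K g = Cod ?K f" "Dom ?K k = Cod ?K g"
  then show "clat_hcomp (Arrow k \<gamma> k')
        (Arrow (Cmp ?K g f) (clat_hcomp (Arrow g \<beta> g') (Arrow f \<alpha> f')) (Cmp ?K g' f'))
      = clat_hcomp (Arrow (Cmp ?K k g) (clat_hcomp (Arrow k \<gamma> k') (Arrow g \<beta> g')) (Cmp ?K k' g'))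
        (Arrow f \<alpha> f')"
    by (auto elim!: clat_2cellE intro: hcomp_assoc)
next
  let ?K = "clat_cells :: (('e, 'f, 'o, 'm) clat0, ('e, 'f, 'o, 'm) clat1) cat"
  fix f g assume fg: "f \<in> Arr ?K" "g \<in> Arr ?K" "Dom ?K g = Cod ?K f"
  obtain E B p F F' E' B' q where f: "f = Arrow (E, B, p) (F, F') (E', B', q)"
    by (rule clat_1cellE)
  with fg obtain G G' E'' B'' r where g: "g = Arrow (E', B', q) (G, G') (E'', B'', r)"
    by (cases g rule: clat_1cellE) auto
  show "clat_hcomp (Arrow g (clat_id2 g) g) (Arrow f (clat_id2 f) f) = clat_id2 (Cmp ?K g f)"
    using clat_cellsD[OF fg(1)[unfolded f]] clat_cellsD[OF fg(2)[unfolded g]] fg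
    by (simp add: f g hcomp_nid_nid)
next
  let ?K = "clat_cells :: (('e, 'f, 'o, 'm) clat0, ('e, 'f, 'o, 'm) clat1) cat"
  fix f f' f'' g g' g'' :: "('e, 'f, 'o, 'm) clat1" and \<alpha> \<beta> \<gamma> \<delta>
  assume "f \<in> Arr ?K" "f' \<in> Arr ?K" "f'' \<in> Arr ?K" "g \<in> Arr ?K" "g' \<in> Arr ?K" "g'' \<in> Arr ?K"
    "\<alpha> \<in> clat_hom2 f f'" "\<beta> \<in> clat_hom2 f' f''"
    "\<gamma> \<in> clat_hom2 g g'" "\<delta> \<in> clat_hom2 g' g''" "Dom ?K g = Cod ?K f"
  then show "clat_hcomp (Arrow g (clat_vcomp g g' g'' \<delta> \<gamma>) g'') (Arrow f (clat_vcomp f f' f'' \<beta> \<alpha>) f'')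
      = clat_vcomp (Cmp ?K g f) (Cmp ?K g' f') (Cmp ?K g'' f'')
          (clat_hcomp (Arrow g' \<delta> g'') (Arrow f' \<beta> f'')) (clat_hcomp (Arrow g \<gamma> g') (Arrow f \<alpha> f'))"
    by (auto elim!: clat_2cellE intro: hcomp_interchange)
qed

section \<open>The fibration \<open>Sp\<close>\<close>

lemma Obj_Sp: "(X, S) \<in> Obj (Sp A C \<O>) \<longleftrightarrow> X \<in> Obj C \<and> S \<in> (\<Pi>\<^sub>E a\<in>A. Pow (hom C X (OMap \<O> a)))"
  by (simp add: Sp_def)

lemma hom_Sp: "g \<in> hom (Sp A C \<O>) (X, S) (Y, S') \<longleftrightarrow>
    (\<exists>f. g = Arrow (X, S) f (Y, S') \<and> (X, S) \<in> Obj (Sp A C \<O>) \<and> (Y, S') \<in> Obj (Sp A C \<O>) \<and>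
      f \<in> hom C X Y \<and> (\<forall>a\<in>A. \<forall>k\<in>S' a. Cmp C k f \<in> S a))"
  by (simp add: Sp_def hom_hom_cat)

lemma Arr_Sp: "Arrow (X, S) f (Y, S') \<in> Arr (Sp A C \<O>) \<longleftrightarrow>
    (X, S) \<in> Obj (Sp A C \<O>) \<and> (Y, S') \<in> Obj (Sp A C \<O>) \<and>
    f \<in> hom C X Y \<and> (\<forall>a\<in>A. \<forall>k\<in>S' a. Cmp C k f \<in> S a)"
  by (simp add: Sp_def Arr_hom_cat)

lemma Dom_Sp [simp]: "g \<in> Arr (Sp A C \<O>) \<Longrightarrow> Dom (Sp A C \<O>) g = src g"
  and Cod_Sp [simp]: "g \<in> Arr (Sp A C \<O>) \<Longrightarrow> Cod (Sp A C \<O>) g = tgt g"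
  and Idt_Sp [simp]: "x \<in> Obj (Sp A C \<O>) \<Longrightarrow> Idt (Sp A C \<O>) x = Arrow x (Idt C (fst x)) x"
  and Cmp_Sp [simp]: "\<lbrakk>h \<in> Arr (Sp A C \<O>); g \<in> Arr (Sp A C \<O>); src h = tgt g\<rbrakk> \<Longrightarrow>
    Cmp (Sp A C \<O>) h g = Arrow (src g) (Cmp C (lab h) (lab g)) (tgt h)"
  by (auto simp: Sp_def split: prod.splits)

lemma composable_Sp: "composable (Sp A C \<O>) h g \<longleftrightarrow>
    h \<in> Arr (Sp A C \<O>) \<and> g \<in> Arr (Sp A C \<O>) \<and> src h = tgt g"
  unfolding Sp_def by (rule composable_hom_cat)

lemma Sp_objD:
  "(X, S) \<in> Obj (Sp A C \<O>) \<Longrightarrow> a \<in> A \<Longrightarrow> k \<in> S a \<Longrightarrow> k \<in> hom C X (OMap \<O> a)"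
  by (auto simp: Obj_Sp)

lemma Sp_obj_eqI:
  assumes "(X, S) \<in> Obj (Sp A C \<O>)" "(X, S') \<in> Obj (Sp A C \<O>)"
    and "\<And>a. a \<in> A \<Longrightarrow> S a = S' a"
  shows "S = S'"
  using assms by (intro extensionalityI[of S A S']) (auto simp: Obj_Sp PiE_iff)

lemma OMap_Sp_proj [simp]: "x \<in> Obj (Sp A C \<O>) \<Longrightarrow> OMap (Sp_proj A C \<O>) x = fst x"
  and AMap_Sp_proj [simp]: "g \<in> Arr (Sp A C \<O>) \<Longrightarrow> AMap (Sp_proj A C \<O>) g = lab g"
  by (simp_all add: Sp_proj_def)

text \<open>\<open>Sp\<close> mentions \<open>\<O>\<close> only through the objects
  \<open>OMap \<O> a\<close>, so the locale records exactly that these lie in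
  \<open>C\<close>.\<close>

locale sp_data = category C
  for A :: "'a set" and C :: "('o, 'm) cat" and \<O> :: "('a, 'a, 'o, 'm) func" +
  assumes \<O>_closed: "a \<in> A \<Longrightarrow> OMap \<O> a \<in> Obj C"
begin

abbreviation "SpC \<equiv> Sp A C \<O>"
abbreviation "\<pi> \<equiv> Sp_proj A C \<O>"
abbreviation "Fib X \<equiv> fibre SpC C \<pi> X"

lemma category_Sp: "category SpC"
  unfolding Sp_def
proof (rule hom_data.category_hom_cat, unfold_locales, goal_cases)
  case (1 x)
  obtain X S where [simp]: "x = (X, S)" by (cases x)
  from 1 have "k \<in> hom C X (OMap \<O> a)" if "a \<in> A" "k \<in> S a" for a k
    using that by auto
  then have "Cmp C k (Idt C X) = k" if "a \<in> A" "k \<in> S a" for a k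
    using that comp_id_right by blast
  with 1 show ?case by (auto simp: Idt_hom)
next
  case (2 x y z f g)
  obtain X S Y S' Z S'' where [simp]: "x = (X, S)" "y = (Y, S')" "z = (Z, S'')"
    by (cases x; cases y; cases z)
  from 2 have f: "f \<in> hom C X Y" and g: "g \<in> hom C Y Z" by auto
  have "Cmp C k (Cmp C g f) \<in> S a" if "a \<in> A" "k \<in> S'' a" for a k
  proof -
    have "k \<in> hom C Z (OMap \<O> a)" using 2 that by auto
    from comp_assoc[OF this g f, symmetric] show ?thesis using 2 that by simp
  qed
  with f g show ?case by (auto intro: comp_in_hom)
next
  case (3 x y f)
  then show ?case by (auto simp: comp_id_left)
next
  case (4 x y f)
  then show ?case by (auto simp: comp_id_right)
next
  case (5 x y z w f g h)
  then show ?case by (auto intro: comp_assoc[symmetric])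
qed

lemma cfunctor_Sp_proj: "cfunctor SpC C \<pi>"
proof (intro cfunctor.intro cfunctor_axioms.intro)
  fix x assume "x \<in> Obj SpC"
  then show "OMap \<pi> x \<in> Obj C" "AMap \<pi> (Idt SpC x) = Idt C (OMap \<pi> x)"
    using hom_ArrD[OF category.Idt_hom[OF category_Sp, of x]] by (cases x; simp add: Obj_Sp)+
next
  fix g assume "g \<in> Arr SpC"
  then show "AMap \<pi> g \<in> hom C (OMap \<pi> (Dom SpC g)) (OMap \<pi> (Cod SpC g))"
    by (cases g; cases "src g"; cases "tgt g") (auto simp: Arr_Sp)
next
  fix h g assume "composable SpC h g"
  then show "AMap \<pi> (Cmp SpC h g) = Cmp C (AMap \<pi> h) (AMap \<pi> g)"
    using hom_ArrD[OF category.Cmp_hom[OF category_Sp, of h g]] by (simp add: composable_Sp)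
qed (simp_all add: category_Sp category_axioms Sp_proj_def)

text \<open>A morphism above \<open>f\<close> with given ends can only be the triple itself, which
  is faithfulness made explicit. Existence statements, in the fibre order as well as in the
  reindexing condition, thereby become membership statements.\<close>

lemma ex_hom_Sp_above: "(\<exists>g\<in>hom SpC x y. AMap \<pi> g = f) \<longleftrightarrow> Arrow x f y \<in> Arr SpC"
proof
  assume "\<exists>g\<in>hom SpC x y. AMap \<pi> g = f"
  then obtain g where "g \<in> Arr SpC" "src g = x" "tgt g = y" "lab g = f"
    by (auto simp: hom_def)
  then show "Arrow x f y \<in> Arr SpC" by (cases g) auto
next
  assume "Arrow x f y \<in> Arr SpC"
  then show "\<exists>g\<in>hom SpC x y. AMap \<pi> g = f"
    by (intro bexI[of _ "Arrow x f y"]) (simp_all add: hom_def)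
qed

section \<open>The fibres as complete lattices\<close>

lemma carrier_Fib: "(X', S) \<in> carrier (Fib X) \<longleftrightarrow> X' = X \<and> (X, S) \<in> Obj SpC"
  by (auto simp: fibre_def)

lemma carrier_FibE:
  assumes "x \<in> carrier (Fib X)"
  obtains S where "x = (X, S)" "(X, S) \<in> Obj SpC"
  using assms carrier_Fib by (cases x) blast

text \<open>A morphism over the identity of \<open>X\<close> demands that \<open>k\<close> composed
  with that identity, that is \<open>k\<close> itself, lies in \<open>S a\<close> whenever it lies
  in \<open>S' a\<close>; here the order turns around.\<close>

lemma le_Fib:
  assumes "(X, S) \<in> Obj SpC" "(X, S') \<in> Obj SpC"
  shows "(X, S) \<sqsubseteq>\<^bsub>Fib X\<^esub> (X, S') \<longleftrightarrow> (\<forall>a\<in>A. S' a \<subseteq> S a)"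
proof -
  have X: "X \<in> Obj C" using assms by (simp add: Obj_Sp)
  have [simp]: "Cmp C k (Idt C X) = k" if "a \<in> A" "k \<in> S' a" for a k
    using comp_id_right Sp_objD[OF assms(2) that] by blast
  have "(X, S) \<sqsubseteq>\<^bsub>Fib X\<^esub> (X, S') \<longleftrightarrow> Arrow (X, S) (Idt C X) (X, S') \<in> Arr SpC"
    by (simp add: fibre_def ex_hom_Sp_above)
  also have "\<dots> \<longleftrightarrow> (\<forall>a\<in>A. S' a \<subseteq> S a)"
    using assms X by (auto simp: Arr_Sp Idt_hom)
  finally show ?thesis .
qed

lemma partial_order_Fib: "partial_order (Fib X)"
proof
  show "(.=\<^bsub>Fib X\<^esub>) = (=)" by (simp add: fibre_def)
  show "x \<sqsubseteq>\<^bsub>Fib X\<^esub> x" if "x \<in> carrier (Fib X)" for x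
    using that by (auto elim!: carrier_FibE simp: le_Fib)
  show "x .=\<^bsub>Fib X\<^esub> y"
    if xy: "x \<sqsubseteq>\<^bsub>Fib X\<^esub> y" "y \<sqsubseteq>\<^bsub>Fib X\<^esub> x" "x \<in> carrier (Fib X)" "y \<in> carrier (Fib X)" for x y
  proof -
    obtain S S' where *: "x = (X, S)" "y = (X, S')" "(X, S) \<in> Obj SpC" "(X, S') \<in> Obj SpC"
      using xy(3,4) by (metis carrier_FibE)
    with xy have "S = S'"
      by (intro Sp_obj_eqI[OF *(3,4)]) (auto simp: le_Fib)
    with * show ?thesis by (simp add: fibre_def)
  qed
  show "x \<sqsubseteq>\<^bsub>Fib X\<^esub> z"
    if xyz: "x \<sqsubseteq>\<^bsub>Fib X\<^esub> y" "y \<sqsubseteq>\<^bsub>Fib X\<^esub> z" "x \<in> carrier (Fib X)" "y \<in> carrier (Fib X)" "z \<in> carrier (Fib X)"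
    for x y z
  proof -
    obtain S S' S'' where *: "x = (X, S)" "y = (X, S')" "z = (X, S'')"
        "(X, S) \<in> Obj SpC" "(X, S') \<in> Obj SpC" "(X, S'') \<in> Obj SpC"
      using xyz(3-5) by (metis carrier_FibE)
    with xyz show ?thesis by (simp add: le_Fib) blast
  qed
qed (simp_all add: fibre_def)

text \<open>The base object is an explicit argument because \<open>M\<close> may be empty; the union
  is then the pointwise empty family over \<open>X\<close>, the top of the fibre.\<close>

definition meet_Fib :: "'o \<Rightarrow> ('a, 'o, 'm) sp_obj set \<Rightarrow> ('a, 'o, 'm) sp_obj" where
  "meet_Fib X M = (X, \<lambda>a\<in>A. \<Union>x\<in>M. snd x a)"

lemma meet_Fib_closed:
  assumes "X \<in> Obj C" "M \<subseteq> carrier (Fib X)"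
  shows "meet_Fib X M \<in> carrier (Fib X)"
proof -
  have "k \<in> hom C X (OMap \<O> a)" if x: "x \<in> M" and a: "a \<in> A" "k \<in> snd x a" for x a k
  proof -
    obtain S where "x = (X, S)" "(X, S) \<in> Obj SpC"
      by (rule carrier_FibE[OF subsetD[OF assms(2) x]])
    with a show ?thesis using Sp_objD by simp
  qed
  with assms(1) show ?thesis
    by (auto simp: meet_Fib_def carrier_Fib Obj_Sp)
qed

lemma greatest_meet_Fib:
  assumes X: "X \<in> Obj C" and M: "M \<subseteq> carrier (Fib X)"
  shows "greatest (Fib X) (meet_Fib X M) (Lower (Fib X) M)"
proof (rule greatest_LowerI)
  have m: "(X, \<lambda>a\<in>A. \<Union>x\<in>M. snd x a) \<in> Obj SpC"
    using meet_Fib_closed[OF assms] by (simp add: meet_Fib_def carrier_Fib)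
  show "meet_Fib X M \<sqsubseteq>\<^bsub>Fib X\<^esub> x" if xM: "x \<in> M" for x
  proof -
    obtain S where x: "x = (X, S)" "(X, S) \<in> Obj SpC"
      by (rule carrier_FibE[OF subsetD[OF M xM]])
    then show ?thesis
      using xM by (auto simp: meet_Fib_def le_Fib[OF m] intro: bexI[of _ x])
  qed
  show "y \<sqsubseteq>\<^bsub>Fib X\<^esub> meet_Fib X M" if "y \<in> Lower (Fib X) M" for y
  proof -
    have y: "y \<in> carrier (Fib X)" "\<And>x. x \<in> M \<Longrightarrow> y \<sqsubseteq>\<^bsub>Fib X\<^esub> x"
      using that M by (auto simp: Lower_def)
    then obtain T where T: "y = (X, T)" "(X, T) \<in> Obj SpC"
      by (metis carrier_FibE)
    have "snd x a \<subseteq> T a" if xa: "x \<in> M" "a \<in> A" for x a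
    proof -
      obtain S where x: "x = (X, S)" "(X, S) \<in> Obj SpC"
        by (rule carrier_FibE[OF subsetD[OF M xa(1)]])
      with y(2)[OF xa(1)] T xa(2) show ?thesis by (simp add: le_Fib)
    qed
    then show ?thesis
      by (auto simp: T meet_Fib_def le_Fib[OF T(2) m])
  qed
qed (simp_all add: M meet_Fib_closed[OF assms])

lemma complete_lattice_Fib:
  assumes "X \<in> Obj C" shows "complete_lattice (Fib X)"
proof (rule partial_order.complete_lattice_criterion1[OF partial_order_Fib])
  \<comment> \<open>The criterion asks for a top element separately from the meets of nonempty sets.
    It is the meet of the empty family, whose lower bounds form the whole carrier.\<close>
  show "\<exists>g. greatest (Fib X) g (carrier (Fib X))"
    using greatest_meet_Fib[OF assms, of "{}"] by (simp only: Lower_empty empty_subsetI) blast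
qed (use greatest_meet_Fib[OF assms] in blast)

text \<open>The infimum is defined by choosing some greatest lower bound, so antisymmetry of the
  fibre order is what identifies it with the explicit union.\<close>

lemma inf_Fib:
  assumes "X \<in> Obj C" "M \<subseteq> carrier (Fib X)"
  shows "\<Sqinter>\<^bsub>Fib X\<^esub> M = meet_Fib X M"
  unfolding inf_def using greatest_meet_Fib[OF assms]
  by (metis partial_order.greatest_unique[OF partial_order_Fib] someI)

end

text \<open>Meets in the fibres are pointwise unions, so every map given pointwise by direct images preserves them.\<close>

lemma inf_pres_image:
  assumes "sp_data A C \<O>" "sp_data A D \<P>" and X: "X \<in> Obj C" and Y: "Y \<in> Obj D"
    and r: "\<And>S. (X, S) \<in> Obj (Sp A C \<O>) \<Longrightarrow> r (X, S) = (Y, \<lambda>a\<in>A. \<phi> a ` S a)"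
    and closed: "r \<in> carrier (fibre (Sp A C \<O>) C (Sp_proj A C \<O>) X) \<rightarrow>
      carrier (fibre (Sp A D \<P>) D (Sp_proj A D \<P>) Y)"
  shows "inf_pres (fibre (Sp A C \<O>) C (Sp_proj A C \<O>) X) (fibre (Sp A D \<P>) D (Sp_proj A D \<P>) Y) r"
proof -
  interpret C: sp_data A C \<O> by fact
  interpret D: sp_data A D \<P> by fact
  have "r (\<Sqinter>\<^bsub>C.Fib X\<^esub> M) = \<Sqinter>\<^bsub>D.Fib Y\<^esub> (r ` M)" if M: "M \<subseteq> carrier (C.Fib X)" for M
  proof -
    have rM: "r ` M \<subseteq> carrier (D.Fib Y)" using M closed by auto
    have "snd (r x) a = \<phi> a ` snd x a" if xa: "x \<in> M" "a \<in> A" for x a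
    proof -
      obtain S where "x = (X, S)" "(X, S) \<in> Obj (Sp A C \<O>)"
        by (rule C.carrier_FibE[OF subsetD[OF M xa(1)]])
      with r xa show ?thesis by simp
    qed
    \<comment> \<open>The shape of \<open>r\<close> is known only on objects over \<open>X\<close>;
      \<open>meet_Fib_closed\<close> makes the union one of them, and direct images commute with it
      also when \<open>M\<close> is empty.\<close>
    moreover have "r (C.meet_Fib X M) = (Y, \<lambda>a\<in>A. \<phi> a ` (\<Union>x\<in>M. snd x a))"
      using r[of "\<lambda>a\<in>A. \<Union>x\<in>M. snd x a"] C.meet_Fib_closed[OF X M]
      by (simp add: C.meet_Fib_def C.carrier_Fib cong: restrict_cong)
    ultimately have "r (C.meet_Fib X M) = D.meet_Fib Y (r ` M)"
      by (auto simp: D.meet_Fib_def image_UN intro!: restrict_ext)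
    then show ?thesis using C.inf_Fib[OF X M] D.inf_Fib[OF Y rM] by simp
  qed
  then show ?thesis
    by (simp add: inf_pres_def C.complete_lattice_Fib[OF X] D.complete_lattice_Fib[OF Y])
qed

section \<open>Reindexing and Cartesian morphisms in \<open>Sp\<close>\<close>

context sp_data
begin

lemma clat_fibration_Sp: "clat_fibration SpC C \<pi>"
proof (intro clat_fibration.intro clat_fibration_axioms.intro)
  show "cfunctor SpC C \<pi>" by (rule cfunctor_Sp_proj)
  show "complete_lattice (Fib X)" if "X \<in> Obj C" for X by (rule complete_lattice_Fib[OF that])
  show "g = g'" if "g \<in> hom SpC P Q" "g' \<in> hom SpC P Q" "AMap \<pi> g = AMap \<pi> g'" for g g' P Q
    using that by (cases g; cases g') (auto simp: hom_def)
  fix f X Y assume f: "f \<in> hom C X Y"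
  have X: "X \<in> Obj C" and Y: "Y \<in> Obj C" using hom_Obj[OF f] by auto
  \<comment> \<open>Precomposition with \<open>f\<close> yields the smallest family containing all
    composites k f, hence, in the reversed order, the largest object over \<open>X\<close> from
    which \<open>f\<close> is a morphism to the given one. The first component can be ignored since
    \<open>r\<close> is applied only to objects over \<open>Y\<close>.\<close>
  define r where "r = (\<lambda>(Y' :: 'o, S). (X, \<lambda>a\<in>A. (\<lambda>k. Cmp C k f) ` S a))"
  have r_obj: "(X, \<lambda>a\<in>A. (\<lambda>k. Cmp C k f) ` S a) \<in> Obj SpC" if "(Y, S) \<in> Obj SpC" for S
    using X Sp_objD[OF that] by (auto simp: Obj_Sp intro!: comp_in_hom[OF _ f])
  then have r: "r \<in> carrier (Fib Y) \<rightarrow> carrier (Fib X)"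
    by (auto elim!: carrier_FibE simp: r_def carrier_Fib)
  \<comment> \<open>Here the image lemma is used within one fibration, the direct image being taken
    along precomposition with \<open>f\<close> for every index.\<close>
  moreover have "inf_pres (Fib Y) (Fib X) r"
    by (rule inf_pres_image[OF sp_data_axioms sp_data_axioms Y X _ r]) (simp add: r_def)
  moreover have "(\<exists>g\<in>hom SpC P Q. AMap \<pi> g = f) \<longleftrightarrow> P \<sqsubseteq>\<^bsub>Fib X\<^esub> r Q"
    if P: "P \<in> carrier (Fib X)" and Q: "Q \<in> carrier (Fib Y)" for P Q
  proof -
    obtain S where [simp]: "P = (X, S)" and S: "(X, S) \<in> Obj SpC" using P by (rule carrier_FibE)
    obtain S' where [simp]: "Q = (Y, S')" and S': "(Y, S') \<in> Obj SpC" using Q by (rule carrier_FibE)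
    have "(\<exists>g\<in>hom SpC P Q. AMap \<pi> g = f) \<longleftrightarrow> Arrow P f Q \<in> Arr SpC"
      by (simp add: ex_hom_Sp_above)
    also have "\<dots> \<longleftrightarrow> P \<sqsubseteq>\<^bsub>Fib X\<^esub> r Q"
      using S S' f by (auto simp: r_def Arr_Sp le_Fib[OF S r_obj[OF S']])
    finally show ?thesis .
  qed
  ultimately show "\<exists>r. r \<in> carrier (Fib Y) \<rightarrow> carrier (Fib X) \<and> inf_pres (Fib Y) (Fib X) r \<and>
      (\<forall>P\<in>carrier (Fib X). \<forall>Q\<in>carrier (Fib Y). (\<exists>g\<in>hom SpC P Q. AMap \<pi> g = f) \<longleftrightarrow> P \<sqsubseteq>\<^bsub>Fib X\<^esub> r Q)"
    by blast
qed

text \<open>One inclusion is the condition that \<open>f\<close> is a morphism; the other carries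
  the universal property. Cartesianness thus becomes an equation between images in \<open>C\<close>,
  which a functor can transport, whereas the universal property quantifies over objects that need
  not come from the source fibration.\<close>

lemma cartesian_Sp_iff:
  assumes g: "Arrow (X, S) f (Y, S') \<in> Arr SpC"
  shows "cartesian SpC C \<pi> (Arrow (X, S) f (Y, S')) \<longleftrightarrow> (\<forall>a\<in>A. S a = (\<lambda>k. Cmp C k f) ` S' a)"
proof
  let ?g = "Arrow (X, S) f (Y, S')"
  have S: "(X, S) \<in> Obj SpC" and S': "(Y, S') \<in> Obj SpC" and f: "f \<in> hom C X Y"
    and fk: "\<And>a k. a \<in> A \<Longrightarrow> k \<in> S' a \<Longrightarrow> Cmp C k f \<in> S a"
    using g by (auto simp: Arr_Sp)
  have X: "X \<in> Obj C" using hom_Obj[OF f] by simp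
  {
    assume cart: "cartesian SpC C \<pi> ?g"
    \<comment> \<open>The test object is the reindexing of \<open>(Y, S')\<close> along
      \<open>f\<close>. Factoring its arrow over \<open>f\<close> through \<open>?g\<close> above
      the identity of \<open>X\<close> gives \<open>(X, T)\<close> \<sqsubseteq>
      \<open>(X, S)\<close>, which is the inclusion of \<open>S\<close> in \<open>T\<close>.\<close>
    define T where "T = (\<lambda>a\<in>A. (\<lambda>k. Cmp C k f) ` S' a)"
    have T: "(X, T) \<in> Obj SpC"
      using X Sp_objD[OF S'] by (auto simp: T_def Obj_Sp intro!: comp_in_hom[OF _ f])
    have h: "Arrow (X, T) f (Y, S') \<in> hom SpC (X, T) (Y, S')"
      using T S' f by (auto simp: hom_Sp T_def)
    have "Cmp C f (Idt C X) = f" by (rule comp_id_right[OF f])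
    then obtain k where k: "k \<in> hom SpC (X, T) (X, S)" "AMap \<pi> k = Idt C X"
      using cart[unfolded cartesian_def, THEN conjunct2, rule_format, OF T, of "Arrow (X, T) f (Y, S')" "Idt C X"]
        g T S hom_ArrD[OF h] h Idt_hom[OF X] by auto
    then have "(X, T) \<sqsubseteq>\<^bsub>Fib X\<^esub> (X, S)" by (auto simp: fibre_def)
    then have "\<forall>a\<in>A. S a \<subseteq> T a" by (simp add: le_Fib[OF T S])
    then show "\<forall>a\<in>A. S a = (\<lambda>k. Cmp C k f) ` S' a"
      using fk by (auto simp: T_def)
  next
    assume eq: "\<forall>a\<in>A. S a = (\<lambda>k. Cmp C k f) ` S' a"
    show "cartesian SpC C \<pi> ?g"
      unfolding cartesian_def
    proof (intro conjI ballI impI)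
      fix R h u
      assume R: "R \<in> Obj SpC" and h: "h \<in> hom SpC R (Cod SpC ?g)"
        and u: "u \<in> hom C (OMap \<pi> R) (OMap \<pi> (Dom SpC ?g))" and fu: "Cmp C (AMap \<pi> ?g) u = AMap \<pi> h"
      obtain Z U where [simp]: "R = (Z, U)" by (cases R)
      have u': "u \<in> hom C Z X" using u g R S by simp
      obtain l where [simp]: "h = Arrow (Z, U) l (Y, S')" and hA: "h \<in> Arr SpC"
        and l: "\<And>a k. a \<in> A \<Longrightarrow> k \<in> S' a \<Longrightarrow> Cmp C k l \<in> U a"
        using h g by (auto simp: hom_Sp Arr_Sp)
      have fu': "Cmp C f u = l" using fu g hA by simp
      \<comment> \<open>Every \<open>k\<close> in \<open>S a\<close> has the form k' f, and k' f u =
        k' l lies in \<open>U a\<close> because \<open>h\<close> is a morphism of \<open>Sp\<close>;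
        so \<open>u\<close> lifts to \<open>(X, S)\<close>.\<close>
      have "Cmp C k u \<in> U a" if a: "a \<in> A" and k: "k \<in> S a" for a k
      proof -
        obtain k' where k': "k' \<in> S' a" "k = Cmp C k' f" using eq a k by auto
        then have "Cmp C k u = Cmp C k' l"
          using comp_assoc[OF Sp_objD[OF S' a k'(1)] f u'] fu' by simp
        then show ?thesis using l a k' by simp
      qed
      then have k: "Arrow (Z, U) u (X, S) \<in> hom SpC (Z, U) (X, S)"
        using R S u' by (auto simp: hom_Sp)
      show "\<exists>!k. k \<in> hom SpC R (Dom SpC ?g) \<and> AMap \<pi> k = u \<and> Cmp SpC ?g k = h"
      proof (rule ex1I)
        show "Arrow (Z, U) u (X, S) \<in> hom SpC R (Dom SpC ?g) \<and> AMap \<pi> (Arrow (Z, U) u (X, S)) = u \<and>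
            Cmp SpC ?g (Arrow (Z, U) u (X, S)) = h"
          using k g hom_ArrD[OF k] fu' by simp
      next
        fix k assume "k \<in> hom SpC R (Dom SpC ?g) \<and> AMap \<pi> k = u \<and> Cmp SpC ?g k = h"
        then show "k = Arrow (Z, U) u (X, S)"
          using g by (auto simp: hom_Sp Arr_Sp)
      qed
    qed (fact g)
  }
qed

end

section \<open>The functors \<open>Sp_func\<close> and the 2-functor\<close>

locale sp_map = C: sp_data A C \<O> + D: sp_data A D \<P> + F: cfunctor C D F
  for A :: "'a set" and C :: "('o, 'm) cat" and \<O> and D :: "('o, 'm) cat" and \<P> and F +
  fixes \<tau> :: "'a \<Rightarrow> 'm"
  assumes \<tau>: "a \<in> A \<Longrightarrow> \<tau> a \<in> hom D (OMap F (OMap \<O> a)) (OMap \<P> a)"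
begin

abbreviation "\<Phi> \<equiv> Sp_func A C \<O> D F \<tau>"

lemma OMap_Sp_func:
  "(X, S) \<in> Obj C.SpC \<Longrightarrow>
    OMap \<Phi> (X, S) = (OMap F X, \<lambda>a\<in>A. (\<lambda>k. Cmp D (\<tau> a) (AMap F k)) ` S a)"
  by (simp add: Sp_func_def Let_def Setcompr_eq_image)

lemma fst_OMap_Sp_func: "x \<in> Obj C.SpC \<Longrightarrow> fst (OMap \<Phi> x) = OMap F (fst x)"
  by (cases x) (simp add: OMap_Sp_func)

lemma AMap_Sp_func [simp]:
  "g \<in> Arr C.SpC \<Longrightarrow> AMap \<Phi> g = Arrow (OMap \<Phi> (src g)) (AMap F (lab g)) (OMap \<Phi> (tgt g))"
  by (simp add: Sp_func_def Let_def)

lemma Sp_func_closed: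
  assumes x: "x \<in> Obj C.SpC" shows "OMap \<Phi> x \<in> Obj D.SpC"
proof -
  obtain X S where [simp]: "x = (X, S)" by (cases x)
  have "Cmp D (\<tau> a) (AMap F k) \<in> hom D (OMap F X) (OMap \<P> a)" if "a \<in> A" "k \<in> S a" for a k
    using x that by (auto intro: D.comp_in_hom[OF \<tau> F.map_in_hom] Sp_objD)
  then show ?thesis
    using x by (auto simp: OMap_Sp_func[of X S] Obj_Sp[of "OMap F X"] F.OMap_closed Obj_Sp[of X])
qed

text \<open>Precomposing the image of \<open>k\<close> with \<open>AMap F f\<close> gives the image
  of k f, by functoriality of \<open>F\<close>, and k f belongs to \<open>S a\<close> because
  \<open>g\<close> is a morphism.\<close>

lemma Sp_func_Arr:
  assumes g: "g \<in> Arr C.SpC" shows "AMap \<Phi> g \<in> Arr D.SpC"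
proof -
  obtain X S f Y S' where [simp]: "g = Arrow (X, S) f (Y, S')"
    by (metis arrow.exhaust surj_pair)
  from g have ob: "(X, S) \<in> Obj C.SpC" "(Y, S') \<in> Obj C.SpC" and f: "f \<in> hom C X Y"
    and fk: "\<And>a k. a \<in> A \<Longrightarrow> k \<in> S' a \<Longrightarrow> Cmp C k f \<in> S a"
    by (auto simp: Arr_Sp)
  have "Cmp D (Cmp D (\<tau> a) (AMap F k)) (AMap F f) \<in> (\<lambda>k. Cmp D (\<tau> a) (AMap F k)) ` S a"
    if a: "a \<in> A" "k \<in> S' a" for a k
  proof -
    note k = Sp_objD[OF ob(2) a]
    have "Cmp D (Cmp D (\<tau> a) (AMap F k)) (AMap F f) = Cmp D (\<tau> a) (AMap F (Cmp C k f))"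
      by (simp add: D.comp_assoc[OF \<tau>[OF a(1)] F.map_in_hom[OF k] F.map_in_hom[OF f]] F.map_comp[OF k f])
    then show ?thesis using fk[OF a] by simp
  qed
  then show ?thesis
    using Sp_func_closed[OF ob(1)] Sp_func_closed[OF ob(2)] F.map_in_hom[OF f] g
    by (simp add: OMap_Sp_func[OF ob(1)] OMap_Sp_func[OF ob(2)] Arr_Sp[of "OMap F X"])
qed

lemma cfunctor_Sp_func: "cfunctor C.SpC D.SpC \<Phi>"
proof (intro cfunctor.intro cfunctor_axioms.intro)
  fix x assume x: "x \<in> Obj C.SpC"
  show "OMap \<Phi> x \<in> Obj D.SpC" by (rule Sp_func_closed[OF x])
  have "fst x \<in> Obj C" using x by (cases x) (simp add: Obj_Sp)
  then show "AMap \<Phi> (Idt C.SpC x) = Idt D.SpC (OMap \<Phi> x)"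
    using x hom_ArrD[OF category.Idt_hom[OF C.category_Sp x]]
    by (simp add: Sp_func_closed F.AMap_Idt fst_OMap_Sp_func)
next
  fix g assume g: "g \<in> Arr C.SpC"
  then show "AMap \<Phi> g \<in> hom D.SpC (OMap \<Phi> (Dom C.SpC g)) (OMap \<Phi> (Cod C.SpC g))"
    using Sp_func_Arr[OF g] by (simp add: hom_def)
next
  fix h g assume hg: "composable C.SpC h g"
  then have h: "h \<in> Arr C.SpC" and g: "g \<in> Arr C.SpC" and "src h = tgt g"
    by (simp_all add: composable_Sp)
  \<comment> \<open>The underlying arrows get their types in \<open>C\<close> by applying the
    projection functor to \<open>h\<close> and \<open>g\<close>.\<close>
  moreover have "AMap F (Cmp C (lab h) (lab g)) = Cmp D (AMap F (lab h)) (AMap F (lab g))"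
    using hg cfunctor.map_in_hom[OF C.cfunctor_Sp_proj homI[OF h]]
      cfunctor.map_in_hom[OF C.cfunctor_Sp_proj homI[OF g]] h g
    by (intro F.map_comp) (simp_all add: composable_Sp)
  ultimately show "AMap \<Phi> (Cmp C.SpC h g) = Cmp D.SpC (AMap \<Phi> h) (AMap \<Phi> g)"
    using hom_ArrD[OF category.Cmp_hom[OF C.category_Sp hg]] Sp_func_Arr[OF h] Sp_func_Arr[OF g]
    by simp
qed (simp_all add: C.category_Sp D.category_Sp Sp_func_def Let_def)

lemma Sp_func_over: "fcomp C.SpC D.\<pi> \<Phi> = fcomp C.SpC F C.\<pi>"
proof (rule cfunctor_eqI[OF cfunctor_fcomp cfunctor_fcomp])
  show "cfunctor C.SpC D.SpC \<Phi>" by (rule cfunctor_Sp_func)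
  show "cfunctor D.SpC D D.\<pi>" by (rule D.cfunctor_Sp_proj)
  show "cfunctor C.SpC C C.\<pi>" by (rule C.cfunctor_Sp_proj)
  show "cfunctor C D F" by (rule F.cfunctor_axioms)
next
  fix x assume "x \<in> Obj C.SpC"
  then show "OMap (fcomp C.SpC D.\<pi> \<Phi>) x = OMap (fcomp C.SpC F C.\<pi>) x"
    by (simp add: Sp_func_closed fst_OMap_Sp_func)
next
  fix g assume g: "g \<in> Arr C.SpC"
  then show "AMap (fcomp C.SpC D.\<pi> \<Phi>) g = AMap (fcomp C.SpC F C.\<pi>) g"
    using Sp_func_Arr[OF g] by simp
qed

lemma preserves_cartesian_Sp_func: "preserves_cartesian C.SpC C C.\<pi> D.SpC D D.\<pi> \<Phi>"
  unfolding preserves_cartesian_def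
proof (intro allI impI)
  fix g assume cart: "cartesian C.SpC C C.\<pi> g"
  then have g: "g \<in> Arr C.SpC" by (simp add: cartesian_def)
  obtain X S f Y S' where gd [simp]: "g = Arrow (X, S) f (Y, S')"
    by (metis arrow.exhaust surj_pair)
  from g have ob: "(X, S) \<in> Obj C.SpC" "(Y, S') \<in> Obj C.SpC" and f: "f \<in> hom C X Y"
    by (auto simp: Arr_Sp)
  have S: "\<forall>a\<in>A. S a = (\<lambda>k. Cmp C k f) ` S' a"
    using cart C.cartesian_Sp_iff g by simp
  have "(\<lambda>k. Cmp D (\<tau> a) (AMap F k)) ` S a = (\<lambda>k. Cmp D k (AMap F f)) ` (\<lambda>k. Cmp D (\<tau> a) (AMap F k)) ` S' a"
    if a: "a \<in> A" for a
  proof -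
    have "Cmp D (\<tau> a) (AMap F (Cmp C k f)) = Cmp D (Cmp D (\<tau> a) (AMap F k)) (AMap F f)"
      if "k \<in> S' a" for k
    proof -
      note k = Sp_objD[OF ob(2) a that]
      show ?thesis
        by (simp add: D.comp_assoc[OF \<tau>[OF a] F.map_in_hom[OF k] F.map_in_hom[OF f]] F.map_comp[OF k f])
    qed
    with S a show ?thesis by (simp add: image_image)
  qed
  then show "cartesian D.SpC D D.\<pi> (AMap \<Phi> g)"
    using g Sp_func_Arr[OF g] by (simp add: OMap_Sp_func[OF ob(1)] OMap_Sp_func[OF ob(2)] D.cartesian_Sp_iff)
qed

lemma preserves_fibre_meets_Sp_func: "preserves_fibre_meets C.SpC C C.\<pi> D.SpC D D.\<pi> F \<Phi>"
  unfolding preserves_fibre_meets_def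
proof (intro ballI conjI)
  fix X assume X: "X \<in> Obj C"
  show closed: "OMap \<Phi> \<in> carrier (C.Fib X) \<rightarrow> carrier (D.Fib (OMap F X))"
  proof
    fix x assume "x \<in> carrier (C.Fib X)"
    then obtain S where S: "x = (X, S)" "(X, S) \<in> Obj C.SpC" by (rule C.carrier_FibE)
    then show "OMap \<Phi> x \<in> carrier (D.Fib (OMap F X))"
      using Sp_func_closed[OF S(2)] by (simp add: OMap_Sp_func D.carrier_Fib)
  qed
  show "inf_pres (C.Fib X) (D.Fib (OMap F X)) (OMap \<Phi>)"
    by (rule inf_pres_image[OF C.sp_data_axioms D.sp_data_axioms X F.OMap_closed[OF X] OMap_Sp_func closed])
qed

end

section \<open>Strict functoriality of the assignment on 1-cells\<close>

lemma Sp_func_fid: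
  assumes "sp_data A C \<O>"
  shows "Sp_func A C \<O> C (fid C) (\<lambda>a\<in>A. Idt C (OMap \<O> a)) = fid (Sp A C \<O>)"
proof -
  interpret C: sp_data A C \<O> by fact
  interpret sp_map A C \<O> C \<O> "fid C" "\<lambda>a\<in>A. Idt C (OMap \<O> a)"
    by (intro sp_map.intro sp_map_axioms.intro assms cfunctor_fid C.category_axioms)
      (simp add: C.Idt_hom C.\<O>_closed)
  have ob: "OMap \<Phi> x = x" if x: "x \<in> Obj C.SpC" for x
  proof -
    obtain X S where xd [simp]: "x = (X, S)" by (cases x)
    have X: "X \<in> Obj C" using x by (simp add: Obj_Sp)
    have "(\<lambda>k. Cmp C (Idt C (OMap \<O> a)) (AMap (fid C) k)) ` S a = S a" if "a \<in> A" for a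
    proof -
      have "Cmp C (Idt C (OMap \<O> a)) (AMap (fid C) k) = k" if "k \<in> S a" for k
        using Sp_objD[of X S A C \<O> a k] x \<open>a \<in> A\<close> that C.comp_id_left hom_ArrD by fastforce
      then show ?thesis by simp
    qed
    then have "OMap \<Phi> (X, S) = (X, restrict S A)"
      using x X by (simp add: OMap_Sp_func cong: restrict_cong)
    \<comment> \<open>The induced functor cuts families down to \<open>A\<close>. Objects of
      \<open>Sp\<close> carry extensional families, so the identity 1-cell acts as the identity and
      not merely up to values outside \<open>A\<close>.\<close>
    also have "restrict S A = S"
      using x by (auto simp: Obj_Sp PiE_iff intro!: extensional_restrict)
    finally show ?thesis unfolding xd .
  qed
  have lab: "lab g \<in> Arr C" "src g \<in> Obj C.SpC" "tgt g \<in> Obj C.SpC" if "g \<in> Arr C.SpC" for g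
    using that hom_ArrD[OF cfunctor.map_in_hom[OF C.cfunctor_Sp_proj homI[OF that]]]
      category.Dom_closed[OF C.category_Sp that] category.Cod_closed[OF C.category_Sp that] by simp_all
  show ?thesis
    by (rule cfunctor_eqI[OF cfunctor_Sp_func cfunctor_fid[OF C.category_Sp]]) (simp_all add: ob lab)
qed

text \<open>A direct image of a direct image is the direct image along the composite, and that
  composite is the correct one since \<open>\<upsilon>\<close> G\<open>\<tau>\<close> GFk =
  \<open>\<upsilon>\<close> G(\<open>\<tau>\<close> Fk). The predicates agree as sets, so the
  functors are equal and not only isomorphic.\<close>

lemma Sp_func_fcomp:
  assumes "sp_map A C \<O> D \<P> F \<tau>" "sp_map A D \<P> E \<Q> G \<upsilon>"
  shows "Sp_func A C \<O> E (fcomp C G F) (\<lambda>a\<in>A. Cmp E (\<upsilon> a) (AMap G (\<tau> a)))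
    = fcomp (Sp A C \<O>) (Sp_func A D \<P> E G \<upsilon>) (Sp_func A C \<O> D F \<tau>)"
proof -
  interpret F: sp_map A C \<O> D \<P> F \<tau> by fact
  interpret G: sp_map A D \<P> E \<Q> G \<upsilon> by fact
  interpret GF: sp_map A C \<O> E \<Q> "fcomp C G F" "\<lambda>a\<in>A. Cmp E (\<upsilon> a) (AMap G (\<tau> a))"
    by (intro sp_map.intro sp_map_axioms.intro F.C.sp_data_axioms G.D.sp_data_axioms
        cfunctor_fcomp[OF F.F.cfunctor_axioms G.F.cfunctor_axioms])
      (simp add: F.C.\<O>_closed G.D.comp_in_hom[OF G.\<tau> G.F.map_in_hom[OF F.\<tau>]])
  have ob: "OMap GF.\<Phi> x = OMap G.\<Phi> (OMap F.\<Phi> x)" if x: "x \<in> Obj F.C.SpC" for x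
  proof -
    obtain X S where [simp]: "x = (X, S)" by (cases x)
    have X: "X \<in> Obj C" using x by (simp add: Obj_Sp)
    have "Cmp E (Cmp E (\<upsilon> a) (AMap G (\<tau> a))) (AMap (fcomp C G F) k)
        = Cmp E (\<upsilon> a) (AMap G (Cmp D (\<tau> a) (AMap F k)))" if a: "a \<in> A" "k \<in> S a" for a k
    proof -
      have k: "k \<in> hom C X (OMap \<O> a)" using Sp_objD[of X S A C \<O> a k] x a by simp
      note \<tau> = F.\<tau>[OF a(1)] and Fk = F.F.map_in_hom[OF k]
      show ?thesis
        by (simp add: hom_ArrD[OF k] G.F.map_comp[OF \<tau> Fk]
            G.D.comp_assoc[OF G.\<tau>[OF a(1)] G.F.map_in_hom[OF \<tau>] G.F.map_in_hom[OF Fk]])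
    qed
    moreover have "(OMap F X, \<lambda>a\<in>A. (\<lambda>k. Cmp D (\<tau> a) (AMap F k)) ` S a) \<in> Obj F.D.SpC"
      using F.Sp_func_closed[OF x] x by (simp add: F.OMap_Sp_func)
    ultimately show ?thesis
      using x X by (simp add: F.OMap_Sp_func G.OMap_Sp_func GF.OMap_Sp_func image_image cong: restrict_cong image_cong)
  qed
  have lab: "lab g \<in> Arr C" "src g \<in> Obj F.C.SpC" "tgt g \<in> Obj F.C.SpC" if "g \<in> Arr F.C.SpC" for g
    using that hom_ArrD[OF cfunctor.map_in_hom[OF F.C.cfunctor_Sp_proj homI[OF that]]]
      category.Dom_closed[OF F.C.category_Sp that] category.Cod_closed[OF F.C.category_Sp that] by simp_all
  show ?thesis
  proof (rule cfunctor_eqI[OF GF.cfunctor_Sp_func cfunctor_fcomp[OF F.cfunctor_Sp_func G.cfunctor_Sp_func]])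
    fix g assume g: "g \<in> Arr F.C.SpC"
    then show "AMap GF.\<Phi> g = AMap (fcomp F.C.SpC G.\<Phi> F.\<Phi>) g"
      using F.Sp_func_Arr[OF g] by (simp add: ob lab)
  qed (simp_all add: ob)
qed

section \<open>Liftings of 2-cells to \<open>Sp\<close> and their compositions\<close>

definition Sp_lift :: "'a set \<Rightarrow> ('o, 'm) cat \<Rightarrow> ('a, 'a, 'o, 'm) func \<Rightarrow> ('o, 'm) cat \<Rightarrow>
    ('o, 'm, 'o, 'm) func \<Rightarrow> ('a \<Rightarrow> 'm) \<Rightarrow> ('o, 'm, 'o, 'm) func \<Rightarrow> ('a \<Rightarrow> 'm) \<Rightarrow>
    ('o \<Rightarrow> 'm) \<Rightarrow> ('a, 'o, 'm) sp_obj \<Rightarrow> ('a, 'o, 'm) sp_arr" where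
  "Sp_lift A C \<O> D F \<tau> G \<upsilon> \<alpha> = (\<lambda>x\<in>Obj (Sp A C \<O>).
    Arrow (OMap (Sp_func A C \<O> D F \<tau>) x) (\<alpha> (fst x)) (OMap (Sp_func A C \<O> D G \<upsilon>) x))"

locale sp_2cell = F: sp_map A C \<O> D \<P> F \<tau> + G: sp_map A C \<O> D \<P> G \<upsilon> + \<alpha>: nat_trans C D F G \<alpha>
  for A :: "'a set" and C :: "('o, 'm) cat" and \<O> D \<P> F \<tau> G \<upsilon> \<alpha> +
  assumes compat: "a \<in> A \<Longrightarrow> Cmp D (\<upsilon> a) (\<alpha> (OMap \<O> a)) = \<tau> a"
begin

abbreviation "\<Lambda> \<equiv> Sp_lift A C \<O> D F \<tau> G \<upsilon> \<alpha>"

lemma Sp_lift_apply: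
  "x \<in> Obj F.C.SpC \<Longrightarrow> \<Lambda> x = Arrow (OMap F.\<Phi> x) (\<alpha> (fst x)) (OMap G.\<Phi> x)"
  by (simp add: Sp_lift_def)

lemma Sp_lift_Arr:
  assumes x: "x \<in> Obj F.C.SpC"
  shows "Arrow (OMap F.\<Phi> x) (\<alpha> (fst x)) (OMap G.\<Phi> x) \<in> Arr F.D.SpC"
proof -
  obtain X S where [simp]: "x = (X, S)" by (cases x)
  have X: "X \<in> Obj C" using x by (simp add: Obj_Sp)
  note \<alpha>X = \<alpha>.component[OF X] and x' = x[simplified]
  have "Cmp D (Cmp D (\<upsilon> a) (AMap G k)) (\<alpha> X) \<in> (\<lambda>k. Cmp D (\<tau> a) (AMap F k)) ` S a"
    if a: "a \<in> A" "k \<in> S a" for a k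
  proof -
    note k = Sp_objD[OF x' a] and \<upsilon> = G.\<tau>[OF a(1)] and \<alpha>O = \<alpha>.component[OF F.C.\<O>_closed[OF a(1)]]
    have "Cmp D (Cmp D (\<upsilon> a) (AMap G k)) (\<alpha> X) = Cmp D (\<upsilon> a) (Cmp D (\<alpha> (OMap \<O> a)) (AMap F k))"
      by (simp add: F.D.comp_assoc[OF \<upsilon> G.F.map_in_hom[OF k] \<alpha>X] \<alpha>.natural[OF k])
    also have "\<dots> = Cmp D (\<tau> a) (AMap F k)"
      by (simp add: F.D.comp_assoc[OF \<upsilon> \<alpha>O F.F.map_in_hom[OF k], symmetric] compat[OF a(1)])
    finally show ?thesis using a by simp
  qed
  then show ?thesis
    using F.Sp_func_closed[OF x'] G.Sp_func_closed[OF x'] \<alpha>X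
    by (simp add: F.OMap_Sp_func[OF x'] G.OMap_Sp_func[OF x'] Arr_Sp)
qed

text \<open>As triples both sides of the naturality square have the same ends, so it remains to use
  naturality of \<open>\<alpha>\<close> at the underlying arrow of \<open>g\<close>.\<close>

lemma nat_trans_Sp_lift: "nat_trans F.C.SpC F.D.SpC F.\<Phi> G.\<Phi> \<Lambda>"
proof (intro nat_trans.intro nat_trans_axioms.intro F.cfunctor_Sp_func G.cfunctor_Sp_func)
  fix x assume "x \<in> Obj F.C.SpC"
  then show "\<Lambda> x \<in> hom F.D.SpC (OMap F.\<Phi> x) (OMap G.\<Phi> x)"
    using Sp_lift_Arr[of x] by (simp add: Sp_lift_apply hom_def)
next
  fix g assume g: "g \<in> Arr F.C.SpC"
  have ob: "src g \<in> Obj F.C.SpC" "tgt g \<in> Obj F.C.SpC"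
    using category.Dom_closed[OF F.C.category_Sp g] category.Cod_closed[OF F.C.category_Sp g] g by simp_all
  have "lab g \<in> hom C (fst (src g)) (fst (tgt g))"
    using cfunctor.map_in_hom[OF F.C.cfunctor_Sp_proj homI[OF g]] g ob by simp
  then show "Cmp F.D.SpC (\<Lambda> (Cod F.C.SpC g)) (AMap F.\<Phi> g) = Cmp F.D.SpC (AMap G.\<Phi> g) (\<Lambda> (Dom F.C.SpC g))"
    using g ob Sp_lift_Arr[OF ob(1)] Sp_lift_Arr[OF ob(2)] F.Sp_func_Arr[OF g] G.Sp_func_Arr[OF g]
    by (simp add: Sp_lift_apply \<alpha>.natural)
qed (simp add: Sp_lift_def)

end

lemma Sp_lift_nid:
  assumes "sp_map A C \<O> D \<P> F \<tau>"
  shows "Sp_lift A C \<O> D F \<tau> F \<tau> (nid C D F) = nid (Sp A C \<O>) (Sp A D \<P>) (Sp_func A C \<O> D F \<tau>)"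
proof
  interpret sp_map A C \<O> D \<P> F \<tau> by fact
  fix x
  show "Sp_lift A C \<O> D F \<tau> F \<tau> (nid C D F) x = nid (Sp A C \<O>) (Sp A D \<P>) (Sp_func A C \<O> D F \<tau>) x"
  proof (cases "x \<in> Obj C.SpC")
    case True
    then have "fst x \<in> Obj C" by (cases x) (simp add: Obj_Sp)
    then show ?thesis
      using True by (simp add: Sp_lift_def nid_def Sp_func_closed fst_OMap_Sp_func)
  qed (simp add: Sp_lift_def nid_def)
qed

lemma Sp_lift_vcomp:
  assumes "sp_2cell A C \<O> D \<P> F \<tau> G \<upsilon> \<alpha>" "sp_2cell A C \<O> D \<P> G \<upsilon> H \<sigma> \<beta>"
  shows "Sp_lift A C \<O> D F \<tau> H \<sigma> (vcomp C D \<beta> \<alpha>)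
    = vcomp (Sp A C \<O>) (Sp A D \<P>) (Sp_lift A C \<O> D G \<upsilon> H \<sigma> \<beta>) (Sp_lift A C \<O> D F \<tau> G \<upsilon> \<alpha>)"
proof
  interpret a: sp_2cell A C \<O> D \<P> F \<tau> G \<upsilon> \<alpha> by fact
  interpret b: sp_2cell A C \<O> D \<P> G \<upsilon> H \<sigma> \<beta> by fact
  fix x
  show "Sp_lift A C \<O> D F \<tau> H \<sigma> (vcomp C D \<beta> \<alpha>) x
    = vcomp (Sp A C \<O>) (Sp A D \<P>) (Sp_lift A C \<O> D G \<upsilon> H \<sigma> \<beta>) (Sp_lift A C \<O> D F \<tau> G \<upsilon> \<alpha>) x"
  proof (cases "x \<in> Obj a.F.C.SpC")
    case True
    then have "fst x \<in> Obj C" by (cases x) (simp add: Obj_Sp)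
    then show ?thesis
      using True a.Sp_lift_Arr[OF True] b.Sp_lift_Arr[OF True] by (simp add: Sp_lift_def vcomp_def)
  qed (simp add: Sp_lift_def vcomp_def)
qed

text \<open>The labels agree by the formula for \<open>hcomp\<close>. The work lies in the ends of
  the arrows, where \<open>Sp_func_fcomp\<close> is applied to the source 1-cells and to the target
  1-cells.\<close>

lemma Sp_lift_hcomp:
  assumes "sp_2cell A C \<O> D \<P> F \<tau> G \<upsilon> \<alpha>" "sp_2cell A D \<P> E \<Q> H \<sigma> K \<rho> \<beta>"
  shows "Sp_lift A C \<O> E (fcomp C H F) (\<lambda>a\<in>A. Cmp E (\<sigma> a) (AMap H (\<tau> a)))
      (fcomp C K G) (\<lambda>a\<in>A. Cmp E (\<rho> a) (AMap K (\<upsilon> a))) (hcomp C E H G \<beta> \<alpha>)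
    = hcomp (Sp A C \<O>) (Sp A E \<Q>) (Sp_func A D \<P> E H \<sigma>) (Sp_func A C \<O> D G \<upsilon>)
        (Sp_lift A D \<P> E H \<sigma> K \<rho> \<beta>) (Sp_lift A C \<O> D F \<tau> G \<upsilon> \<alpha>)"
    (is "?l = ?r")
proof
  interpret a: sp_2cell A C \<O> D \<P> F \<tau> G \<upsilon> \<alpha> by fact
  interpret b: sp_2cell A D \<P> E \<Q> H \<sigma> K \<rho> \<beta> by fact
  fix x
  show "?l x = ?r x"
  proof (cases "x \<in> Obj a.F.C.SpC")
    case x: True
    then have X: "fst x \<in> Obj C" by (cases x) (simp add: Obj_Sp)
    note Gx = a.G.Sp_func_closed[OF x] and \<alpha>x = a.Sp_lift_Arr[OF x]
    have "?r x = Cmp b.F.D.SpC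
        (Arrow (OMap b.F.\<Phi> (OMap a.G.\<Phi> x)) (\<beta> (OMap G (fst x))) (OMap b.G.\<Phi> (OMap a.G.\<Phi> x)))
        (Arrow (OMap b.F.\<Phi> (OMap a.F.\<Phi> x)) (AMap H (\<alpha> (fst x))) (OMap b.F.\<Phi> (OMap a.G.\<Phi> x)))"
      using x Gx \<alpha>x by (simp add: hcomp_def Sp_lift_def a.G.fst_OMap_Sp_func)
    also have "\<dots> = Arrow (OMap b.F.\<Phi> (OMap a.F.\<Phi> x)) (Cmp E (\<beta> (OMap G (fst x))) (AMap H (\<alpha> (fst x))))
        (OMap b.G.\<Phi> (OMap a.G.\<Phi> x))"
      using b.Sp_lift_Arr[OF Gx] b.F.Sp_func_Arr[OF \<alpha>x] \<alpha>x x by (simp add: a.G.fst_OMap_Sp_func)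
    also have "\<dots> = ?l x"
      using x X by (simp add: Sp_lift_def hcomp_def Sp_func_fcomp[OF a.F.sp_map_axioms b.F.sp_map_axioms]
          Sp_func_fcomp[OF a.G.sp_map_axioms b.G.sp_map_axioms])
    finally show ?thesis by simp
  qed (simp add: Sp_lift_def hcomp_def)
qed

section \<open>Assembly of the 2-functor\<close>

lemma sp_dataI: "(C, \<O>) \<in> coslice_obj A \<Longrightarrow> sp_data A C \<O>"
  using coslice_objD[of C \<O> A] by (simp add: sp_data_def sp_data_axioms_def)

lemma sp_mapI:
  assumes "Arrow (C, \<O>) (F, \<tau>) (D, \<P>) \<in> Arr (coslice_cells A)"
  shows "sp_map A C \<O> D \<P> F \<tau>"
  using assms sp_dataI[of C \<O> A] sp_dataI[of D \<P> A]
  by (auto simp: Arr_hom_cat sp_map_def sp_map_axioms_def)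

lemma sp_2cellE:
  assumes "\<alpha> \<in> coslice_hom2 A f g" "f \<in> Arr (coslice_cells A)" "g \<in> Arr (coslice_cells A)"
  obtains C \<O> D \<P> F \<tau> G \<upsilon> where "f = Arrow (C, \<O>) (F, \<tau>) (D, \<P>)" "g = Arrow (C, \<O>) (G, \<upsilon>) (D, \<P>)"
    "sp_2cell A C \<O> D \<P> F \<tau> G \<upsilon> \<alpha>"
  using assms(1)
proof (rule coslice_2cellE)
  fix C \<O> D \<P> F \<tau> G \<upsilon>
  assume *: "f = Arrow (C, \<O>) (F, \<tau>) (D, \<P>)" "g = Arrow (C, \<O>) (G, \<upsilon>) (D, \<P>)"
    "nat_trans C D F G \<alpha>" "\<And>a. a \<in> A \<Longrightarrow> Cmp D (\<upsilon> a) (\<alpha> (OMap \<O> a)) = \<tau> a"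
  have "sp_2cell A C \<O> D \<P> F \<tau> G \<upsilon> \<alpha>"
    using * sp_mapI assms(2,3) by (auto intro!: sp_2cell.intro sp_2cell_axioms.intro)
  with * show thesis by (intro that)
qed

lemma clat_hom_SP1:
  assumes "sp_map A C \<O> D \<P> F \<tau>"
  shows "(F, Sp_func A C \<O> D F \<tau>) \<in> clat_hom (SP0 A (C, \<O>)) (SP0 A (D, \<P>))"
proof -
  interpret sp_map A C \<O> D \<P> F \<tau> by fact
  show ?thesis by (simp add: F.cfunctor_axioms cfunctor_Sp_func Sp_func_over)
qed

text \<open>This is the one-dimensional part, to which \<open>two_functor_mk_two_cat\<close> adds
  the 2-cells. The restrictions supply the extensionality that \<open>cfunctor\<close>
  demands.\<close>

lemma cfunctor_SP1:
  fixes A :: "'a set"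
  defines "K \<equiv> coslice_cells A :: (('a, 'o, 'm) coslice0, ('a, 'o, 'm) coslice1) cat"
  shows "cfunctor K clat_cells \<lparr> OMap = restrict (SP0 A) (Obj K), AMap = restrict (SP1 A) (Arr K) \<rparr>"
    (is "cfunctor K ?L ?F")
proof (intro cfunctor.intro cfunctor_axioms.intro)
  show "category K" unfolding K_def by (rule hom_data.category_hom_cat[OF hom_data_coslice])
  show "category ?L" by (rule hom_data.category_hom_cat[OF hom_data_clat])
  have SP0: "SP0 A x \<in> clat_obj" if "x \<in> coslice_obj A" for x :: "('a, 'o, 'm) coslice0"
    using that sp_dataI[of "fst x" "snd x" A] sp_data.clat_fibration_Sp
    by (cases x) (auto simp: clat_obj_def)
  have SP1: "SP1 A f \<in> Arr ?L" "src (SP1 A f) = SP0 A (src f)" "tgt (SP1 A f) = SP0 A (tgt f)"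
    if f: "f \<in> Arr K" for f
  proof -
    obtain C \<O> D \<P> F \<tau> where fd [simp]: "f = Arrow (C, \<O>) (F, \<tau>) (D, \<P>)" by (rule coslice_1cellE)
    have "(C, \<O>) \<in> coslice_obj A" "(D, \<P>) \<in> coslice_obj A"
      using f by (simp_all add: K_def Arr_hom_cat)
    then show "SP1 A f \<in> Arr ?L"
      using clat_hom_SP1[OF sp_mapI[OF f[unfolded K_def fd]]]
      by (simp add: Arr_hom_cat SP0 del: SP0.simps)
    show "src (SP1 A f) = SP0 A (src f)" "tgt (SP1 A f) = SP0 A (tgt f)" by simp_all
  qed
  {
    fix x assume "x \<in> Obj K"
    then have x: "x \<in> coslice_obj A" by (simp add: K_def)
    then show "OMap ?F x \<in> Obj ?L" using \<open>x \<in> Obj K\<close> by (simp add: SP0)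
    obtain C \<O> where [simp]: "x = (C, \<O>)" by (cases x)
    have "Arrow x (coslice_id A x) x \<in> Arr K"
      using x hom_data.id_in[OF hom_data_coslice x] by (simp add: K_def Arr_hom_cat)
    then show "AMap ?F (Idt K x) = Idt ?L (OMap ?F x)"
      using x \<open>x \<in> Obj K\<close> SP0[OF x] Sp_func_fid[OF sp_dataI, of C \<O> A] by (simp add: K_def)
  next
    fix f assume f: "f \<in> Arr K"
    then have "src f \<in> Obj K" "tgt f \<in> Obj K" "Dom K f = src f" "Cod K f = tgt f"
      by (simp_all add: K_def Arr_hom_cat)
    then show "AMap ?F f \<in> hom ?L (OMap ?F (Dom K f)) (OMap ?F (Cod K f))"
      using f SP1[OF f] by (simp add: hom_def)
  next
    fix g f assume gf: "composable K g f"
    then have f: "f \<in> Arr K" and g: "g \<in> Arr K" and st: "src g = tgt f"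
      by (simp_all add: K_def composable_hom_cat)
    obtain C \<O> D \<P> F \<tau> where fd: "f = Arrow (C, \<O>) (F, \<tau>) (D, \<P>)" by (rule coslice_1cellE)
    with st obtain E \<Q> G \<upsilon> where gd: "g = Arrow (D, \<P>) (G, \<upsilon>) (E, \<Q>)"
      by (cases g rule: coslice_1cellE) auto
    have "Cmp K g f \<in> Arr K"
      using hom_ArrD[OF category.Cmp_hom[OF \<open>category K\<close> gf]] .
    moreover have "Cmp K g f = Arrow (C, \<O>) (fcomp C G F, \<lambda>a\<in>A. Cmp E (\<upsilon> a) (AMap G (\<tau> a))) (E, \<Q>)"
      using f g st by (simp add: K_def) (simp add: fd gd)
    ultimately show "AMap ?F (Cmp K g f) = Cmp ?L (AMap ?F g) (AMap ?F f)"
      using f g SP1(1)[OF f] SP1(1)[OF g]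
        Sp_func_fcomp[OF sp_mapI[OF f[unfolded K_def fd]] sp_mapI[OF g[unfolded K_def gd]]]
      by (simp add: fd gd)
  }
qed simp_all

text \<open>Used in place of the equation of \<open>SP2\<close>, so that the lifting stays folded as
  \<open>Sp_lift\<close> and its composition laws apply.\<close>

lemma lab_SP2:
  "lab (SP2 A (Arrow (Arrow (C, \<O>) (F, \<tau>) (D, \<P>)) \<alpha> (Arrow X (G, \<upsilon>) Y)))
    = (\<alpha>, Sp_lift A C \<O> D F \<tau> G \<upsilon> \<alpha>)"
  by (simp add: Sp_lift_def)

lemma two_functor_SP:
  fixes A :: "'a set"
  shows "two_functor
    (lax_coslice A :: (('a, 'o, 'm) coslice0, ('a, 'o, 'm) coslice1, ('a, 'o, 'm) coslice2) two_cat)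
    clat_two_cat (SP A)"
proof -
  let ?K = "coslice_cells A :: (('a, 'o, 'm) coslice0, ('a, 'o, 'm) coslice1) cat"
  let ?V = "hom_cat (Arr ?K) (coslice_hom2 A) coslice_id2 coslice_vcomp"
  let ?F = "\<lparr> OMap = restrict (SP0 A) (Obj ?K), AMap = restrict (SP1 A) (Arr ?K) \<rparr>"
  \<comment> \<open>\<open>SP2\<close> produces complete 2-cells, while
    \<open>two_functor_mk_two_cat\<close> expects a map of labels; the label is extracted here and
    the boundary is put back at the end.\<close>
  let ?\<phi> = "\<lambda>f g \<alpha>. lab (SP2 A (Arrow f \<alpha> g))"
  interpret K: category ?K by (rule hom_data.category_hom_cat[OF hom_data_coslice])
  note SP = SP0.simps SP1.simps lab_SP2
  have "two_functor (mk_two_cat ?K (coslice_hom2 A) coslice_id2 coslice_vcomp coslice_hcomp)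
      (mk_two_cat clat_cells clat_hom2 clat_id2 clat_vcomp clat_hcomp)
      \<lparr> Map0 = OMap ?F, Map1 = AMap ?F,
        Map2 = (\<lambda>x\<in>Arr ?V. Arrow (AMap ?F (src x)) (?\<phi> (src x) (tgt x) (lab x)) (AMap ?F (tgt x))) \<rparr>"
  proof (rule two_functor_mk_two_cat[OF two_cat_data_coslice two_cat_data_clat cfunctor_SP1])
    fix f g \<alpha> assume fg: "f \<in> Arr ?K" "g \<in> Arr ?K" and \<alpha>: "\<alpha> \<in> coslice_hom2 A f g"
    obtain C \<O> D \<P> F \<tau> G \<upsilon> where [simp]: "f = Arrow (C, \<O>) (F, \<tau>) (D, \<P>)" "g = Arrow (C, \<O>) (G, \<upsilon>) (D, \<P>)"
      and "sp_2cell A C \<O> D \<P> F \<tau> G \<upsilon> \<alpha>"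
      using \<alpha> fg by (rule sp_2cellE)
    then interpret sp_2cell A C \<O> D \<P> F \<tau> G \<upsilon> \<alpha> by simp
    have "AMap F.D.\<pi> (\<Lambda> x) = \<alpha> (OMap F.C.\<pi> x)" if "x \<in> Obj F.C.SpC" for x
      using Sp_lift_Arr[OF that] that by (simp add: Sp_lift_apply)
    then show "?\<phi> f g \<alpha> \<in> clat_hom2 (AMap ?F f) (AMap ?F g)"
      using fg by (simp add: SP nat_trans_Sp_lift \<alpha>.nat_trans_axioms del: SP2.simps)
  next
    fix f assume f: "f \<in> Arr ?K"
    obtain C \<O> D \<P> F \<tau> where fd: "f = Arrow (C, \<O>) (F, \<tau>) (D, \<P>)" by (rule coslice_1cellE)
    show "?\<phi> f f (coslice_id2 f) = clat_id2 (AMap ?F f)"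
      using f Sp_lift_nid[OF sp_mapI[OF f[unfolded fd]]] by (simp add: fd SP del: SP2.simps)
  next
    fix f g k \<alpha> \<beta>
    assume cells: "f \<in> Arr ?K" "g \<in> Arr ?K" "k \<in> Arr ?K"
      and \<alpha>: "\<alpha> \<in> coslice_hom2 A f g" and \<beta>: "\<beta> \<in> coslice_hom2 A g k"
    obtain C \<O> D \<P> F \<tau> G \<upsilon> where fg: "f = Arrow (C, \<O>) (F, \<tau>) (D, \<P>)" "g = Arrow (C, \<O>) (G, \<upsilon>) (D, \<P>)"
      and a: "sp_2cell A C \<O> D \<P> F \<tau> G \<upsilon> \<alpha>"
      using \<alpha> cells(1,2) by (rule sp_2cellE)
    obtain H \<sigma> where k: "k = Arrow (C, \<O>) (H, \<sigma>) (D, \<P>)" and b: "sp_2cell A C \<O> D \<P> G \<upsilon> H \<sigma> \<beta>"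
      using \<beta> cells(2,3) by (rule sp_2cellE) (simp add: fg)
    show "?\<phi> f k (coslice_vcomp f g k \<beta> \<alpha>)
        = clat_vcomp (AMap ?F f) (AMap ?F g) (AMap ?F k) (?\<phi> g k \<beta>) (?\<phi> f g \<alpha>)"
      using cells Sp_lift_vcomp[OF a b] by (simp add: fg k SP del: SP2.simps)
  next
    fix f f' \<alpha> g g' \<beta>
    assume cells: "f \<in> Arr ?K" "f' \<in> Arr ?K" "g \<in> Arr ?K" "g' \<in> Arr ?K"
      and \<alpha>: "\<alpha> \<in> coslice_hom2 A f f'" and \<beta>: "\<beta> \<in> coslice_hom2 A g g'"
      and bd: "Dom ?K g = Cod ?K f" "Dom ?K g' = Cod ?K f'"
    obtain C \<O> D \<P> F \<tau> G \<upsilon> where f: "f = Arrow (C, \<O>) (F, \<tau>) (D, \<P>)" "f' = Arrow (C, \<O>) (G, \<upsilon>) (D, \<P>)"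
      and a: "sp_2cell A C \<O> D \<P> F \<tau> G \<upsilon> \<alpha>"
      using \<alpha> cells(1,2) by (rule sp_2cellE)
    have "src g = (D, \<P>)" using bd(1) cells(1,3) f by simp
    with \<beta> cells(3,4) obtain E \<Q> H \<sigma> K \<rho> where
      g: "g = Arrow (D, \<P>) (H, \<sigma>) (E, \<Q>)" "g' = Arrow (D, \<P>) (K, \<rho>) (E, \<Q>)"
      and b: "sp_2cell A D \<P> E \<Q> H \<sigma> K \<rho> \<beta>"
      by (auto elim!: sp_2cellE)
    have "Cmp ?K g f \<in> Arr ?K" "Cmp ?K g' f' \<in> Arr ?K"
      using K.Cmp_hom[of g f] K.Cmp_hom[of g' f'] cells bd by (simp_all add: composable_def hom_def)
    moreover have
      "Cmp ?K g f = Arrow (C, \<O>) (fcomp C H F, \<lambda>a\<in>A. Cmp E (\<sigma> a) (AMap H (\<tau> a))) (E, \<Q>)"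
      "Cmp ?K g' f' = Arrow (C, \<O>) (fcomp C K G, \<lambda>a\<in>A. Cmp E (\<rho> a) (AMap K (\<upsilon> a))) (E, \<Q>)"
      using cells by (simp_all add: f g)
    ultimately show "?\<phi> (Cmp ?K g f) (Cmp ?K g' f') (coslice_hcomp (Arrow g \<beta> g') (Arrow f \<alpha> f'))
        = clat_hcomp (Arrow (AMap ?F g) (?\<phi> g g' \<beta>) (AMap ?F g')) (Arrow (AMap ?F f) (?\<phi> f f' \<alpha>) (AMap ?F f'))"
      using cells Sp_lift_hcomp[OF a b] by (simp add: f g SP del: SP2.simps)
  qed
  \<comment> \<open>The source and target of \<open>SP2 A x\<close> are the images under
    \<open>SP1 A\<close> of those of \<open>x\<close>, so reassembling the triple from its label
    returns \<open>SP2 A x\<close>.\<close>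
  moreover have "(\<lambda>x\<in>Arr ?V. Arrow (AMap ?F (src x)) (?\<phi> (src x) (tgt x) (lab x)) (AMap ?F (tgt x)))
      = restrict (SP2 A) (Arr ?V)"
  proof (rule restrict_ext)
    fix x assume x: "x \<in> Arr ?V"
    then have "src x \<in> Arr ?K" "tgt x \<in> Arr ?K" "lab x \<in> coslice_hom2 A (src x) (tgt x)"
      unfolding Arr_hom_cat[of x "Arr ?K"] by simp_all
    moreover from this(3) obtain C \<O> D \<P> F \<tau> G \<upsilon> where
      "src x = Arrow (C, \<O>) (F, \<tau>) (D, \<P>)" "tgt x = Arrow (C, \<O>) (G, \<upsilon>) (D, \<P>)"
      by (rule coslice_2cellE)
    ultimately show "Arrow (AMap ?F (src x)) (?\<phi> (src x) (tgt x) (lab x)) (AMap ?F (tgt x)) = SP2 A x"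
      by (cases x) simp
  qed
  ultimately show ?thesis
    by (simp add: lax_coslice_def clat_two_cat_def SP_def mk_two_cat_def Let_def)
qed

theorem theorem2:
  fixes A :: "'a set"
  shows "two_functor
           (lax_coslice A :: (('a, 'o, 'm) coslice0, ('a, 'o, 'm) coslice1, ('a, 'o, 'm) coslice2) two_cat)
           clat_two_cat (SP A) \<and>
         (\<forall>(C :: ('o, 'm) cat) \<O> F \<tau> D \<P>.
            Arrow (C, \<O>) (F, \<tau>) (D, \<P>) \<in> Arr (Cells (lax_coslice A)) \<longrightarrow>
            preserves_cartesian (Sp A C \<O>) C (Sp_proj A C \<O>) (Sp A D \<P>) D (Sp_proj A D \<P>)
              (Sp_func A C \<O> D F \<tau>) \<and>
            preserves_fibre_meets (Sp A C \<O>) C (Sp_proj A C \<O>) (Sp A D \<P>) D (Sp_proj A D \<P>)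
              F (Sp_func A C \<O> D F \<tau>))"
proof (intro conjI allI impI)
  show "two_functor
      (lax_coslice A :: (('a, 'o, 'm) coslice0, ('a, 'o, 'm) coslice1, ('a, 'o, 'm) coslice2) two_cat)
      clat_two_cat (SP A)"
    by (rule two_functor_SP)
next
  fix C :: "('o, 'm) cat" and \<O> F \<tau> D \<P>
  assume "Arrow (C, \<O>) (F, \<tau>) (D, \<P>) \<in> Arr (Cells (lax_coslice A))"
  then have "sp_map A C \<O> D \<P> F \<tau>"
    by (intro sp_mapI) (simp add: lax_coslice_def mk_two_cat_def Let_def)
  then interpret sp_map A C \<O> D \<P> F \<tau> .
  show "preserves_cartesian C.SpC C C.\<pi> D.SpC D D.\<pi> \<Phi>"
    by (rule preserves_cartesian_Sp_func)
  show "preserves_fibre_meets C.SpC C C.\<pi> D.SpC D D.\<pi> F \<Phi>"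
    by (rule preserves_fibre_meets_Sp_func)
qed

end
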